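(* Let $(S,\Sigma,\mu)$ be a finite positive measure space, let $(E,\mathcal{E})$ be a measurable space, let $Z$ be a Fréchet space, and let $\boldsymbol{m}:\mathcal{E}\to L_0(\mu,Z)$ be a countably additive vector measure. Then $\boldsymbol{m}$ has a control measure, that is, there exists a finite positive measure $\nu$ on $\mathcal{E}$ such that, for every $A\in\mathcal{E}$, $\nu(A)=0$ implies $\boldsymbol{m}(A)=0$.
   Context: A Fréchet space is a complete metrizable locally convex topological vector space; its topology is defined by an $F$-norm $\|\cdot\|$. A measurable space $(E,\mathcal{E})$ is a set $E$ with a $\sigma$-algebra $\mathcal{E}$ of its subsets. A function $f:S\to Z$ is Bochner measurable (or $\mu$-measurable) if some sequence of $\Sigma$-simple $Z$-valued functions converges to $f$ $\mu$-a.e. on $S$. $L_0(\mu,Z)$ is the linear space of $\mu$-equivalence classes of Bochner measurable functions $S\to Z$, equipped with the topology $\tau_\mu$ of convergence in measure $\mu$, given by the $F$-norm $\|f\|_\mu=\inf\{\varepsilon>0:\mu(\{s:\|f(s)\|\ge\varepsilon\})\le\varepsilon\}$ (if needed, $\mu$ is replaced by the associated outer measure $A\mapsto\inf\{\mu(B):A\subset B\in\Sigma\}$). Countable additivity of $\boldsymbol{m}$ is with respect to $\tau_\mu$. *)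

theory Defs
  imports "HOL-Analysis.Analysis"
begin

section \<open>Frechet spaces\<close>

text \<open>
  A real vector space whose topology is given by an F-norm. Any complex space is a real one by
  restriction of scalars, with the same F-norm topology. That \<open>fnorm x = 0\<close> only for \<open>x = 0\<close>, and
  the triangle inequality, follow from \<open>dist_fnorm\<close> and the metric axioms; joint continuity of the
  linear operations follows from all the axioms together.
\<close>

class fnormed_vector = real_vector + metric_space +
  fixes fnorm :: "'a \<Rightarrow> real"
  assumes dist_fnorm: "dist x y = fnorm (x - y)"
    and fnorm_scaleR_le: "\<bar>a\<bar> \<le> 1 \<Longrightarrow> fnorm (a *\<^sub>R x) \<le> fnorm x"
    and fnorm_scaleR_tendsto_0: "((\<lambda>a. fnorm (a *\<^sub>R x)) \<longlongrightarrow> 0) (at 0)"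

text \<open>The constant \<open>convex\<close> cannot occur in a class specification, so its definition is written out.\<close>

class frechet_space = fnormed_vector + complete_space +
  assumes locally_convex:
    "open U \<Longrightarrow> 0 \<in> U \<Longrightarrow>
       \<exists>V. open V \<and> 0 \<in> V \<and> V \<subseteq> U \<and>
         (\<forall>x\<in>V. \<forall>y\<in>V. \<forall>u\<ge>0. \<forall>v\<ge>0. u + v = 1 \<longrightarrow> u *\<^sub>R x + v *\<^sub>R y \<in> V)"

lemma ex_convex_nhd_0:
  fixes U :: "'a::frechet_space set"
  assumes "open U" "0 \<in> U"
  shows "\<exists>V. open V \<and> convex V \<and> 0 \<in> V \<and> V \<subseteq> U"
  using locally_convex[OF assms] unfolding convex_def by blast

lemma fnorm_eq_dist: "fnorm x = dist x 0" for x :: "'a::fnormed_vector"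
  by (simp add: dist_fnorm)

lemma fnorm_nonneg [simp]: "0 \<le> fnorm x" for x :: "'a::fnormed_vector"
  by (simp add: fnorm_eq_dist)

lemma fnorm_eq_0 [simp]: "fnorm x = 0 \<longleftrightarrow> x = 0" for x :: "'a::fnormed_vector"
  by (simp add: fnorm_eq_dist)

lemma fnorm_0 [simp]: "fnorm (0 :: 'a::fnormed_vector) = 0"
  by simp

lemma fnorm_minus [simp]: "fnorm (- x) = fnorm x" for x :: "'a::fnormed_vector"
  using dist_commute[of x 0] by (simp add: dist_fnorm)

lemma fnorm_triangle: "fnorm (x + y) \<le> fnorm x + fnorm y" for x y :: "'a::fnormed_vector"
  using dist_triangle[of x "- y" 0] by (simp add: dist_fnorm)


section \<open>The space of classes of Bochner measurable functions\<close>

definition bochner_measurable :: "'s measure \<Rightarrow> ('s \<Rightarrow> 'z::topological_space) \<Rightarrow> bool" where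
  "bochner_measurable M f \<longleftrightarrow>
     (\<exists>g. (\<forall>n. simple_function M (g n)) \<and> (AE s in M. (\<lambda>n. g n s) \<longlonglongrightarrow> f s))"

text \<open>
  Functions are total on the type \<open>'s\<close>; their values off \<open>space M\<close> are ignored by \<open>AE\<close>, so the
  classes below correspond to those of functions defined on \<open>space M\<close> only.
\<close>

definition AE_eq_rel :: "'s measure \<Rightarrow> (('s \<Rightarrow> 'z) \<times> ('s \<Rightarrow> 'z)) set" where
  "AE_eq_rel M = {(f, g). AE s in M. f s = g s}"

definition L0 :: "'s measure \<Rightarrow> ('s \<Rightarrow> 'z::topological_space) set set" where
  "L0 M = {f. bochner_measurable M f} // AE_eq_rel M"

definition L0_class :: "'s measure \<Rightarrow> ('s \<Rightarrow> 'z) \<Rightarrow> ('s \<Rightarrow> 'z) set" where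
  "L0_class M f = AE_eq_rel M `` {f}"

definition L0_rep :: "('s \<Rightarrow> 'z) set \<Rightarrow> 's \<Rightarrow> 'z" where
  "L0_rep F = (SOME f. f \<in> F)"

definition L0_zero :: "'s measure \<Rightarrow> ('s \<Rightarrow> 'z::real_vector) set" where
  "L0_zero M = L0_class M (\<lambda>s. 0)"

definition L0_add :: "'s measure \<Rightarrow> ('s \<Rightarrow> 'z::real_vector) set \<Rightarrow> ('s \<Rightarrow> 'z) set \<Rightarrow> ('s \<Rightarrow> 'z) set" where
  "L0_add M F G = L0_class M (\<lambda>s. L0_rep F s + L0_rep G s)"

definition L0_scaleR :: "'s measure \<Rightarrow> real \<Rightarrow> ('s \<Rightarrow> 'z::real_vector) set \<Rightarrow> ('s \<Rightarrow> 'z) set" where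
  "L0_scaleR M a F = L0_class M (\<lambda>s. a *\<^sub>R L0_rep F s)"

primrec L0_sum :: "'s measure \<Rightarrow> (nat \<Rightarrow> ('s \<Rightarrow> 'z::real_vector) set) \<Rightarrow> nat \<Rightarrow> ('s \<Rightarrow> 'z) set" where
  "L0_sum M F 0 = L0_zero M"
| "L0_sum M F (Suc n) = L0_add M (L0_sum M F n) (F n)"

text \<open>
  The outer measure is needed because \<open>M\<close> may be incomplete, so that \<open>fnorm \<circ> f\<close> need only be
  measurable up to a null set.
\<close>

definition measure_fnorm :: "'s measure \<Rightarrow> ('s \<Rightarrow> 'z::fnormed_vector) \<Rightarrow> real" where
  "measure_fnorm M f =
     Inf {\<epsilon>. 0 < \<epsilon> \<and> outer_measure_of M {s \<in> space M. \<epsilon> \<le> fnorm (f s)} \<le> ennreal \<epsilon>}"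

definition L0_fnorm :: "'s measure \<Rightarrow> ('s \<Rightarrow> 'z::fnormed_vector) set \<Rightarrow> real" where
  "L0_fnorm M F = measure_fnorm M (L0_rep F)"

definition L0_dist ::
  "'s measure \<Rightarrow> ('s \<Rightarrow> 'z::fnormed_vector) set \<Rightarrow> ('s \<Rightarrow> 'z) set \<Rightarrow> real" where
  "L0_dist M F G = L0_fnorm M (L0_add M F (L0_scaleR M (- 1) G))"

text \<open>Convergence in measure; \<open>Metric_space_L0\<close> below shows that this is a metric topology.\<close>

definition L0_topology :: "'s measure \<Rightarrow> ('s \<Rightarrow> 'z::fnormed_vector) set topology" where
  "L0_topology M = Metric_space.mtopology (L0 M) (L0_dist M)"


subsection \<open>Independence of representatives and the metric\<close>

lemma equiv_AE_eq_rel: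
  "equiv UNIV (AE_eq_rel M :: (('s \<Rightarrow> 'z) \<times> ('s \<Rightarrow> 'z)) set)" (is "equiv UNIV ?R")
proof (rule equivI)
  show "refl ?R" by (auto simp: refl_on_def AE_eq_rel_def)
  show "sym ?R" by (auto simp: sym_def AE_eq_rel_def eq_commute)
  show "trans ?R"
  proof (rule transI)
    fix f g h :: "'s \<Rightarrow> 'z"
    assume "(f, g) \<in> ?R" "(g, h) \<in> ?R"
    then have "AE s in M. f s = g s" "AE s in M. g s = h s" by (auto simp: AE_eq_rel_def)
    then have "AE s in M. f s = h s" by eventually_elim simp
    then show "(f, h) \<in> ?R" by (simp add: AE_eq_rel_def)
  qed
qed auto

lemma bochner_measurableE:
  assumes "bochner_measurable M f"
  obtains g where "\<forall>n. simple_function M (g n)" "AE s in M. (\<lambda>n. g n s) \<longlonglongrightarrow> f s"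
  using assms unfolding bochner_measurable_def by (elim exE conjE)

lemma bochner_measurable_cong_AE:
  assumes "bochner_measurable M f" "AE s in M. f s = g s"
  shows "bochner_measurable M g"
proof -
  from assms(1) obtain h where h: "\<forall>n. simple_function M (h n)"
    "AE s in M. (\<lambda>n. h n s) \<longlonglongrightarrow> f s"
    by (rule bochner_measurableE)
  from h(2) assms(2) have "AE s in M. (\<lambda>n. h n s) \<longlonglongrightarrow> g s"
    by eventually_elim simp
  with h(1) show ?thesis by (auto simp: bochner_measurable_def)
qed

lemma L0_class_eq_iff: "L0_class M f = L0_class M g \<longleftrightarrow> (AE s in M. f s = g s)"
  using eq_equiv_class_iff[OF equiv_AE_eq_rel, of f g M]
  by (simp add: L0_class_def AE_eq_rel_def)

lemma L0_rep_class: "AE s in M. L0_rep (L0_class M f) s = f s"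
proof -
  have "f \<in> L0_class M f" by (simp add: L0_class_def AE_eq_rel_def)
  then have "L0_rep (L0_class M f) \<in> L0_class M f"
    unfolding L0_rep_def by (rule someI[of "\<lambda>g. g \<in> L0_class M f"])
  then have "AE s in M. f s = L0_rep (L0_class M f) s"
    by (simp add: L0_class_def AE_eq_rel_def)
  then show ?thesis by eventually_elim simp
qed

lemma L0_class_mem: "bochner_measurable M f \<Longrightarrow> L0_class M f \<in> L0 M"
  by (auto simp: L0_def L0_class_def intro: quotientI)

lemma L0_mem_E:
  assumes "F \<in> L0 M"
  obtains f where "bochner_measurable M f" "F = L0_class M f"
  using assms by (auto simp: L0_def L0_class_def elim: quotientE)

lemma L0_class_rep: "F \<in> L0 M \<Longrightarrow> L0_class M (L0_rep F) = F"
  by (elim L0_mem_E) (simp add: L0_class_eq_iff L0_rep_class)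

lemma bochner_measurable_rep:
  assumes "F \<in> L0 M" shows "bochner_measurable M (L0_rep F)"
proof -
  from assms obtain f where f: "bochner_measurable M f" "F = L0_class M f" by (rule L0_mem_E)
  have "AE s in M. f s = L0_rep F s"
    using L0_rep_class[of M f] unfolding f(2) by eventually_elim simp
  with f(1) show ?thesis by (rule bochner_measurable_cong_AE)
qed

lemma L0_add_class: "L0_add M (L0_class M f) (L0_class M g) = L0_class M (\<lambda>s. f s + g s)"
  unfolding L0_add_def L0_class_eq_iff
  using L0_rep_class[of M f] L0_rep_class[of M g] by eventually_elim simp

lemma L0_scaleR_class: "L0_scaleR M a (L0_class M f) = L0_class M (\<lambda>s. a *\<^sub>R f s)"
  unfolding L0_scaleR_def L0_class_eq_iff
  using L0_rep_class[of M f] by eventually_elim simp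

lemma tendsto_dist_le:
  fixes x :: "nat \<Rightarrow> 'z::metric_space"
  assumes "b \<longlonglongrightarrow> 0" "\<And>n. dist (x n) l \<le> b n"
  shows "x \<longlonglongrightarrow> l"
proof (rule tendstoI)
  fix e :: real assume "0 < e"
  with assms(1) have "eventually (\<lambda>n. b n < e) sequentially" by (rule order_tendstoD)
  then show "eventually (\<lambda>n. dist (x n) l < e) sequentially"
    by eventually_elim (rule le_less_trans[OF assms(2)])
qed

lemma tendsto_add_fnormed:
  fixes x y :: "nat \<Rightarrow> 'z::fnormed_vector"
  assumes "x \<longlonglongrightarrow> a" "y \<longlonglongrightarrow> b"
  shows "(\<lambda>n. x n + y n) \<longlonglongrightarrow> a + b"
proof -
  have "(\<lambda>n. dist (x n) a + dist (y n) b) \<longlonglongrightarrow> 0"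
    using tendsto_add[OF assms[THEN iffD1[OF tendsto_dist_iff]]] by simp
  moreover have "dist (x n + y n) (a + b) \<le> dist (x n) a + dist (y n) b" for n
    using fnorm_triangle[of "x n - a" "y n - b"] by (simp add: dist_fnorm algebra_simps)
  ultimately show ?thesis
    by (rule tendsto_dist_le)
qed

lemma fnorm_scaleR_nat_le: "fnorm (real n *\<^sub>R x) \<le> real n * fnorm x"
  for x :: "'z::fnormed_vector"
proof (induction n)
  case (Suc n)
  then show ?case
    using fnorm_triangle[of "real n *\<^sub>R x" x] by (simp add: algebra_simps)
qed simp

lemma fnorm_scaleR_bound:
  fixes x :: "'z::fnormed_vector"
  assumes "\<bar>a\<bar> \<le> real n"
  shows "fnorm (a *\<^sub>R x) \<le> real n * fnorm x"
proof (cases "n = 0")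
  case False
  have "fnorm (a *\<^sub>R x) = fnorm ((a / real n) *\<^sub>R (real n *\<^sub>R x))"
    using False by simp
  also have "\<dots> \<le> fnorm (real n *\<^sub>R x)"
    by (rule fnorm_scaleR_le) (use assms False in \<open>simp add: field_simps\<close>)
  also have "\<dots> \<le> real n * fnorm x" by (rule fnorm_scaleR_nat_le)
  finally show ?thesis .
qed (use assms in simp)

lemma tendsto_scaleR_fnormed:
  fixes x :: "nat \<Rightarrow> 'z::fnormed_vector"
  assumes "x \<longlonglongrightarrow> b"
  shows "(\<lambda>n. a *\<^sub>R x n) \<longlonglongrightarrow> a *\<^sub>R b"
proof -
  obtain k where k: "\<bar>a\<bar> \<le> real k" using real_arch_simple by blast
  have "(\<lambda>n. real k * dist (x n) b) \<longlonglongrightarrow> 0"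
    using tendsto_mult_left[OF iffD1[OF tendsto_dist_iff assms], of "real k"] by simp
  moreover have "dist (a *\<^sub>R x n) (a *\<^sub>R b) \<le> real k * dist (x n) b" for n
    using fnorm_scaleR_bound[OF k, of "x n - b"] by (simp add: dist_fnorm algebra_simps)
  ultimately show ?thesis
    by (rule tendsto_dist_le)
qed

lemma L0_zero_mem: "L0_zero M \<in> L0 M"
  unfolding L0_zero_def
  by (rule L0_class_mem) (auto simp: bochner_measurable_def intro!: exI[of _ "\<lambda>n s. 0"])

lemma L0_add_mem:
  fixes F G :: "('s \<Rightarrow> 'z::fnormed_vector) set"
  assumes "F \<in> L0 M" "G \<in> L0 M"
  shows "L0_add M F G \<in> L0 M"
  unfolding L0_add_def
proof (rule L0_class_mem)
  obtain f where f: "\<forall>n. simple_function M (f n)" "AE s in M. (\<lambda>n. f n s) \<longlonglongrightarrow> L0_rep F s"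
    using bochner_measurable_rep[OF assms(1)] by (rule bochner_measurableE)
  obtain g where g: "\<forall>n. simple_function M (g n)" "AE s in M. (\<lambda>n. g n s) \<longlonglongrightarrow> L0_rep G s"
    using bochner_measurable_rep[OF assms(2)] by (rule bochner_measurableE)
  have "simple_function M (\<lambda>s. f n s + g n s)" for n
    by (rule simple_function_compose2[OF f(1)[rule_format] g(1)[rule_format]])
  moreover have "AE s in M. (\<lambda>n. f n s + g n s) \<longlonglongrightarrow> L0_rep F s + L0_rep G s"
    using f(2) g(2) by eventually_elim (rule tendsto_add_fnormed)
  ultimately show "bochner_measurable M (\<lambda>s. L0_rep F s + L0_rep G s)"
    unfolding bochner_measurable_def by (intro exI[of _ "\<lambda>n s. f n s + g n s"]) auto
qed

lemma L0_scaleR_mem: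
  fixes F :: "('s \<Rightarrow> 'z::fnormed_vector) set"
  assumes "F \<in> L0 M"
  shows "L0_scaleR M a F \<in> L0 M"
  unfolding L0_scaleR_def
proof (rule L0_class_mem)
  obtain f where f: "\<forall>n. simple_function M (f n)" "AE s in M. (\<lambda>n. f n s) \<longlonglongrightarrow> L0_rep F s"
    using bochner_measurable_rep[OF assms] by (rule bochner_measurableE)
  have "simple_function M (\<lambda>s. a *\<^sub>R f n s)" for n
    using simple_function_compose[OF f(1)[rule_format], of "(*\<^sub>R) a"] by (simp add: comp_def)
  moreover have "AE s in M. (\<lambda>n. a *\<^sub>R f n s) \<longlonglongrightarrow> a *\<^sub>R L0_rep F s"
    using f(2) by eventually_elim (rule tendsto_scaleR_fnormed)
  ultimately show "bochner_measurable M (\<lambda>s. a *\<^sub>R L0_rep F s)"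
    unfolding bochner_measurable_def by (intro exI[of _ "\<lambda>n s. a *\<^sub>R f n s"]) auto
qed

lemma outer_measure_of_le_AE:
  assumes "AE s in M. s \<in> A \<longrightarrow> s \<in> B" "A \<subseteq> space M" "B \<subseteq> space M"
  shows "outer_measure_of M A \<le> outer_measure_of M B"
proof -
  obtain E where E: "E \<in> sets M" "B \<subseteq> E" "outer_measure_of M B = emeasure M E"
    using outer_measure_of_attain[OF assms(3)] by blast
  obtain N where N: "{s \<in> space M. \<not> (s \<in> A \<longrightarrow> s \<in> B)} \<subseteq> N" "emeasure M N = 0" "N \<in> sets M"
    using assms(1) by (rule AE_E)
  have "outer_measure_of M A \<le> outer_measure_of M (E \<union> N)"
    by (rule outer_measure_of_mono) (use assms(2) E(2) N(1) in auto)
  also have "\<dots> = emeasure M (E \<union> N)" using E N by simp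
  also have "\<dots> = emeasure M E" using E N by (simp add: emeasure_Un_null_set null_setsI)
  finally show ?thesis using E(3) by simp
qed

lemma outer_measure_of_Un_le:
  assumes "A \<subseteq> space M" "B \<subseteq> space M"
  shows "outer_measure_of M (A \<union> B) \<le> outer_measure_of M A + outer_measure_of M B"
proof -
  obtain E where E: "E \<in> sets M" "A \<subseteq> E" "outer_measure_of M A = emeasure M E"
    using outer_measure_of_attain[OF assms(1)] by blast
  obtain F where F: "F \<in> sets M" "B \<subseteq> F" "outer_measure_of M B = emeasure M F"
    using outer_measure_of_attain[OF assms(2)] by blast
  have "outer_measure_of M (A \<union> B) \<le> outer_measure_of M (E \<union> F)"
    by (rule outer_measure_of_mono) (use E F in auto)
  also have "\<dots> \<le> emeasure M E + emeasure M F"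
    using E F by (simp add: emeasure_subadditive)
  finally show ?thesis using E(3) F(3) by simp
qed

lemma measure_fnorm_cong_AE:
  assumes "AE s in M. f s = g s"
  shows "measure_fnorm M f = measure_fnorm M g"
proof -
  have "outer_measure_of M {s \<in> space M. e \<le> fnorm (f s)} =
        outer_measure_of M {s \<in> space M. e \<le> fnorm (g s)}" for e
  proof (intro antisym outer_measure_of_le_AE)
    show "AE s in M. s \<in> {s \<in> space M. e \<le> fnorm (f s)} \<longrightarrow> s \<in> {s \<in> space M. e \<le> fnorm (g s)}"
      using assms by eventually_elim simp
    show "AE s in M. s \<in> {s \<in> space M. e \<le> fnorm (g s)} \<longrightarrow> s \<in> {s \<in> space M. e \<le> fnorm (f s)}"
      using assms by eventually_elim simp
  qed auto
  then show ?thesis by (simp add: measure_fnorm_def)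
qed

lemma L0_fnorm_class: "L0_fnorm M (L0_class M f) = measure_fnorm M f"
  unfolding L0_fnorm_def by (rule measure_fnorm_cong_AE[OF L0_rep_class])

lemma L0_dist_eq: "L0_dist M F G = measure_fnorm M (\<lambda>s. L0_rep F s - L0_rep G s)"
proof -
  have "AE s in M. L0_rep F s + L0_rep (L0_scaleR M (- 1) G) s = L0_rep F s - L0_rep G s"
    using L0_rep_class[of M "\<lambda>s. (- 1) *\<^sub>R L0_rep G s"]
    unfolding L0_scaleR_def by eventually_elim simp
  then show ?thesis
    unfolding L0_dist_def L0_add_def L0_fnorm_class by (rule measure_fnorm_cong_AE)
qed

lemma L0_dist_class:
  "L0_dist M (L0_class M f) (L0_class M g) = measure_fnorm M (\<lambda>s. f s - g s)"
  unfolding L0_dist_def L0_scaleR_class L0_add_class L0_fnorm_class by simp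

context finite_measure
begin

lemma measure_fnorm_set_nonempty:
  "{e. 0 < e \<and> outer_measure_of M {s \<in> space M. e \<le> fnorm (f s)} \<le> ennreal e} \<noteq> {}"
proof -
  let ?e = "measure M (space M) + 1"
  have "outer_measure_of M {s \<in> space M. ?e \<le> fnorm (f s)} \<le> outer_measure_of M (space M)"
    by (rule outer_measure_of_mono) auto
  also have "\<dots> \<le> ennreal ?e" by (simp add: emeasure_eq_measure)
  finally show ?thesis
    by (auto intro!: exI[of _ ?e] add_nonneg_pos)
qed

lemma measure_fnorm_nonneg: "0 \<le> measure_fnorm M f"
  unfolding measure_fnorm_def by (rule cInf_greatest[OF measure_fnorm_set_nonempty]) auto

lemma measure_fnorm_le:
  "0 < e \<Longrightarrow> outer_measure_of M {s \<in> space M. e \<le> fnorm (f s)} \<le> ennreal e \<Longrightarrow>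
    measure_fnorm M f \<le> e"
  unfolding measure_fnorm_def by (rule cInf_lower) (auto intro!: bdd_belowI[of _ 0])

lemma measure_fnorm_less_E:
  assumes "measure_fnorm M f < r"
  obtains e where "0 < e" "e < r" "outer_measure_of M {s \<in> space M. e \<le> fnorm (f s)} \<le> ennreal e"
proof -
  have "\<exists>e\<in>{e. 0 < e \<and> outer_measure_of M {s \<in> space M. e \<le> fnorm (f s)} \<le> ennreal e}. e < r"
    using assms unfolding measure_fnorm_def by (rule cInf_lessD[OF measure_fnorm_set_nonempty])
  then show thesis using that by blast
qed

lemma measure_fnorm_triangle:
  "measure_fnorm M (\<lambda>s. f s + g s) \<le> measure_fnorm M f + measure_fnorm M g"
proof (rule field_le_epsilon)
  fix d :: real assume "0 < d"
  obtain e1 where e1: "0 < e1" "e1 < measure_fnorm M f + d / 2"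
    "outer_measure_of M {s \<in> space M. e1 \<le> fnorm (f s)} \<le> ennreal e1"
    by (rule measure_fnorm_less_E[of f "measure_fnorm M f + d / 2"]) (use \<open>0 < d\<close> in auto)
  obtain e2 where e2: "0 < e2" "e2 < measure_fnorm M g + d / 2"
    "outer_measure_of M {s \<in> space M. e2 \<le> fnorm (g s)} \<le> ennreal e2"
    by (rule measure_fnorm_less_E[of g "measure_fnorm M g + d / 2"]) (use \<open>0 < d\<close> in auto)
  note e = e1 e2
  have "outer_measure_of M {s \<in> space M. e1 + e2 \<le> fnorm (f s + g s)} \<le>
        outer_measure_of M ({s \<in> space M. e1 \<le> fnorm (f s)} \<union> {s \<in> space M. e2 \<le> fnorm (g s)})"
  proof (rule outer_measure_of_mono, rule subsetI)
    fix s assume "s \<in> {s \<in> space M. e1 + e2 \<le> fnorm (f s + g s)}"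
    then show "s \<in> {s \<in> space M. e1 \<le> fnorm (f s)} \<union> {s \<in> space M. e2 \<le> fnorm (g s)}"
      using fnorm_triangle[of "f s" "g s"] by auto
  qed
  also have "\<dots> \<le> outer_measure_of M {s \<in> space M. e1 \<le> fnorm (f s)} +
                  outer_measure_of M {s \<in> space M. e2 \<le> fnorm (g s)}"
    by (rule outer_measure_of_Un_le) auto
  also have "\<dots> \<le> ennreal e1 + ennreal e2" by (intro add_mono e)
  also have "\<dots> = ennreal (e1 + e2)" using e by (simp add: ennreal_plus)
  finally have "measure_fnorm M (\<lambda>s. f s + g s) \<le> e1 + e2"
    using e by (intro measure_fnorm_le) auto
  then show "measure_fnorm M (\<lambda>s. f s + g s) \<le> measure_fnorm M f + measure_fnorm M g + d"
    using e by simp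
qed

lemma measure_fnorm_eq_0_iff: "measure_fnorm M f = 0 \<longleftrightarrow> (AE s in M. f s = 0)"
proof
  assume 0: "measure_fnorm M f = 0"
  have "AE s in M. fnorm (f s) < inverse (real (Suc n))" for n
  proof -
    let ?A = "{s \<in> space M. inverse (real (Suc n)) \<le> fnorm (f s)}"
    obtain E where E: "E \<in> sets M" "?A \<subseteq> E" "outer_measure_of M ?A = emeasure M E"
      using outer_measure_of_attain[of ?A M] by auto
    have "emeasure M E \<le> 0 + ennreal d" if "0 < d" for d
    proof -
      obtain e where e: "0 < e" "e < min d (inverse (real (Suc n)))"
        "outer_measure_of M {s \<in> space M. e \<le> fnorm (f s)} \<le> ennreal e"
        by (rule measure_fnorm_less_E[of f "min d (inverse (real (Suc n)))"])
           (use 0 \<open>0 < d\<close> in auto)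
      have "emeasure M E \<le> outer_measure_of M {s \<in> space M. e \<le> fnorm (f s)}"
        unfolding E(3)[symmetric] by (rule outer_measure_of_mono) (use e in auto)
      also have "\<dots> \<le> ennreal d" using e by (intro order_trans[OF e(3)] ennreal_leI) simp
      finally show ?thesis by simp
    qed
    then have "emeasure M E \<le> 0" by (rule ennreal_le_epsilon)
    then have "E \<in> null_sets M" using E(1) by (intro null_setsI) auto
    moreover have "{s \<in> space M. \<not> fnorm (f s) < inverse (real (Suc n))} \<subseteq> E"
      using E(2) unfolding not_less .
    ultimately show ?thesis by (rule AE_I')
  qed
  then have "AE s in M. \<forall>n. fnorm (f s) < inverse (real (Suc n))"
    unfolding AE_all_countable by (rule allI)
  then show "AE s in M. f s = 0"
  proof eventually_elim
    case (elim s)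
    have "\<not> 0 < fnorm (f s)"
    proof
      assume "0 < fnorm (f s)"
      then obtain n where "inverse (real (Suc n)) < fnorm (f s)"
        using reals_Archimedean by blast
      with spec[OF elim, of n] show False by (rule less_asym)
    qed
    then show ?case by (simp add: fnorm_eq_dist)
  qed
next
  assume "AE s in M. f s = 0"
  then have "measure_fnorm M f = measure_fnorm M (\<lambda>s. 0 :: 'b)" by (rule measure_fnorm_cong_AE)
  also have "\<dots> \<le> 0"
  proof (rule field_le_epsilon)
    fix e :: real assume "0 < e"
    then have "{s \<in> space M. e \<le> fnorm (0 :: 'b)} = {}" by auto
    then show "measure_fnorm M (\<lambda>s. 0 :: 'b) \<le> 0 + e"
      using \<open>0 < e\<close> by (auto intro!: measure_fnorm_le)
  qed
  finally show "measure_fnorm M f = 0" using measure_fnorm_nonneg[of f] by simp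
qed

lemma Metric_space_L0: "Metric_space (L0 M) (L0_dist M)"
proof
  fix F G :: "('a \<Rightarrow> 'b) set"
  show "0 \<le> L0_dist M F G" unfolding L0_dist_eq by (rule measure_fnorm_nonneg)
  have "fnorm (L0_rep F s - L0_rep G s) = fnorm (L0_rep G s - L0_rep F s)" for s
    using dist_commute by (simp add: dist_fnorm[symmetric])
  then show "L0_dist M F G = L0_dist M G F" by (simp add: L0_dist_eq measure_fnorm_def)
next
  fix F G :: "('a \<Rightarrow> 'b) set" assume FG: "F \<in> L0 M" "G \<in> L0 M"
  have "L0_dist M F G = 0 \<longleftrightarrow> L0_class M (L0_rep F) = L0_class M (L0_rep G)"
    by (simp add: L0_dist_eq measure_fnorm_eq_0_iff L0_class_eq_iff)
  with FG show "L0_dist M F G = 0 \<longleftrightarrow> F = G" by (simp add: L0_class_rep)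
next
  fix F G H :: "('a \<Rightarrow> 'b) set"
  show "L0_dist M F H \<le> L0_dist M F G + L0_dist M G H"
    using measure_fnorm_triangle[of "\<lambda>s. L0_rep F s - L0_rep G s" "\<lambda>s. L0_rep G s - L0_rep H s"]
    by (simp add: L0_dist_eq)
qed

end


section \<open>Vector measures and control measures\<close>

text \<open>
  Taking all \<open>A i\<close> empty shows that such an \<open>\<mm>\<close> vanishes on the empty set, so \<open>\<mm>\<close> is also finitely
  additive.
\<close>

definition countably_additive_L0 ::
  "'s measure \<Rightarrow> 'e set set \<Rightarrow> ('e set \<Rightarrow> ('s \<Rightarrow> 'z::fnormed_vector) set) \<Rightarrow> bool" where
  "countably_additive_L0 M \<E> \<mm> \<longleftrightarrow>
     (\<forall>A :: nat \<Rightarrow> 'e set. range A \<subseteq> \<E> \<longrightarrow> disjoint_family A \<longrightarrow>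
        limitin (L0_topology M) (L0_sum M (\<lambda>i. \<mm> (A i))) (\<mm> (\<Union>i. A i)) sequentially)"

definition control_measure ::
  "'s measure \<Rightarrow> 'e set \<Rightarrow> 'e set set \<Rightarrow> ('e set \<Rightarrow> ('s \<Rightarrow> 'z::fnormed_vector) set) \<Rightarrow>
   'e measure \<Rightarrow> bool" where
  "control_measure M \<Omega> \<E> \<mm> \<nu> \<longleftrightarrow>
     finite_measure \<nu> \<and> space \<nu> = \<Omega> \<and> sets \<nu> = \<E> \<and>
     (\<forall>A\<in>\<E>. emeasure \<nu> A = 0 \<longrightarrow> \<mm> A = L0_zero M)"

end

(*
Applying continuous linear functionals of Z reduces the problem to real-valued random measures X
(the functionals are applied one at a time, and a countable chain condition glues the resulting
measures). For such an X and a set A with X A ~= 0 one needs a finite measure nu <= Psi with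
nu A > 0, where Psi is a gauge that vanishes on X-null sets and along sequences decreasing to the
empty set. By Hahn-Banach this amounts to a lower bound for sum |c_j| Psi(B_j) over all
representations of the indicator of A as sum c_j 1_{B_j}. There are two cases.

If X is unbounded in measure on A, then in any finite partition of A some piece is again unbounded
at almost every relevant point, and the bound holds with Psi a multiple of
eta(B) = sup_{C <= B} E min(1,|X C|).

If X is bounded on A, random signs show that integrals of step functions bounded by 1 are bounded in
measure, Nikishin's theorem puts them in a bounded subset of L_{1/2}(G) for a large set G, and
Grothendieck's truncation argument bounds convex combinations of the squares |X B_j|^2. The bound
then holds for Psi the cube root of eta, by the Cauchy-Schwarz inequality.
*)
theory Submission
  imports Defs "HOL-Library.Function_Algebras"
begin

section \<open>Random signs and random subsets of a finite set\<close>

text \<open>The space of measurable functions under convergence in measure is not locally convex, so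
  duality is of no help in the range. The gauge \<open>eta\<close> alone cannot suffice either: a
  continuous submeasure need not dominate any nonzero measure (Talagrand). What \<open>eta\<close>
  has beyond a submeasure is the additivity of X: every subset sum of the values of X over a finite
  partition is again a value of X. Hence a bound that holds for all subset sums can be averaged over
  random subsets, and this yields bounds for the largest term, for the sum of squares and for sums
  with bounded coefficients.

  All random choices are finite: a subset of the index set is drawn, with uniform or product
  weights, independently of the points of M. A probability estimate at each point becomes a measure
  estimate by Fubini.

  Nikishin's theorem yields only weak L_1 bounds. The exponent 1/2 is one below 1 for which these
  become integrals, and Khintchine's inequality still holds there.

  Functionals chosen for different sets A need not be compatible: from each one only a measure is
  kept that charges A and vanishes on sets without non-null subsets.\<close>

lemma sum_Pow_insert:
  fixes f :: "'a set \<Rightarrow> 'b::comm_monoid_add"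
  assumes "finite J" "j \<notin> J"
  shows "sum f (Pow (insert j J)) = (\<Sum>R\<in>Pow J. f R + f (insert j R))"
proof -
  have inj: "inj_on (insert j) (Pow J)"
    using assms(2) by (auto simp: inj_on_def)
  have "sum f (Pow (insert j J)) = sum f (Pow J) + sum f (insert j ` Pow J)"
    unfolding Pow_insert using assms by (intro sum.union_disjoint) auto
  then show ?thesis
    by (simp add: sum.reindex[OF inj] sum.distrib)
qed

text \<open>Subsets are paired as \<open>Q\<close> and \<open>insert i Q\<close> with
  \<open>i\<close> outside \<open>Q\<close>. The two sums differ by \<open>v i\<close>, so at least
  one of them exceeds \<open>t\<close> in absolute value.\<close>

lemma subset_sums_half_large:
  fixes v :: "'i \<Rightarrow> real"
  assumes "finite I" "i \<in> I" "2 * t < \<bar>v i\<bar>"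
  shows "2 ^ card I / 2 \<le> (\<Sum>Q\<in>Pow I. of_bool (t < \<bar>sum v Q\<bar>) :: real)"
proof -
  define J where "J = I - {i}"
  have J: "finite J" "i \<notin> J" "I = insert i J"
    using assms by (auto simp: J_def)
  have "(2::real) ^ card I / 2 = (\<Sum>Q\<in>Pow J. 1)"
    using J by (simp add: card_Pow)
  also have "\<dots> \<le> (\<Sum>Q\<in>Pow J. of_bool (t < \<bar>sum v Q\<bar>) + of_bool (t < \<bar>sum v (insert i Q)\<bar>))"
  proof (rule sum_mono)
    fix Q assume "Q \<in> Pow J"
    then have "finite Q" "i \<notin> Q" using J finite_subset by auto
    then have "sum v (insert i Q) = v i + sum v Q" by simp
    then have "t < \<bar>sum v Q\<bar> \<or> t < \<bar>sum v (insert i Q)\<bar>"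
      using assms(3) by linarith
    then show "(1::real) \<le> of_bool (t < \<bar>sum v Q\<bar>) + of_bool (t < \<bar>sum v (insert i Q)\<bar>)"
      by auto
  qed
  also have "\<dots> = (\<Sum>Q\<in>Pow I. of_bool (t < \<bar>sum v Q\<bar>))"
    unfolding J(3) using sum_Pow_insert[OF J(1,2), of "\<lambda>Q. of_bool (t < \<bar>sum v Q\<bar>) :: real"] by simp
  finally show ?thesis .
qed

text \<open>\<open>w R\<close> is the probability that the random set equals \<open>R\<close> when
  each \<open>i\<close> is included independently with probability \<open>\<phi> i\<close>; the last
  identity is the variance of the random subset sum.\<close>

lemma bernoulli_weights:
  fixes \<phi> :: "'i \<Rightarrow> real"
  assumes "finite I" "\<And>i. i \<in> I \<Longrightarrow> 0 \<le> \<phi> i \<and> \<phi> i \<le> 1"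
  obtains w where "\<And>R. R \<in> Pow I \<Longrightarrow> 0 \<le> w R" "sum w (Pow I) = (1::real)"
    "\<And>y. (\<Sum>R\<in>Pow I. w R * (sum y R - (\<Sum>i\<in>I. \<phi> i * y i))\<^sup>2) = (\<Sum>i\<in>I. \<phi> i * (1 - \<phi> i) * (y i)\<^sup>2)"
proof -
  have "\<exists>w. (\<forall>R\<in>Pow I. 0 \<le> w R) \<and> sum w (Pow I) = (1::real) \<and>
    (\<forall>y. (\<Sum>R\<in>Pow I. w R * (sum y R - (\<Sum>i\<in>I. \<phi> i * y i))) = 0) \<and>
    (\<forall>y. (\<Sum>R\<in>Pow I. w R * (sum y R - (\<Sum>i\<in>I. \<phi> i * y i))\<^sup>2) = (\<Sum>i\<in>I. \<phi> i * (1 - \<phi> i) * (y i)\<^sup>2))"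
    using assms
  proof (induction I)
    case empty
    show ?case by (rule exI[of _ "\<lambda>_. 1"]) simp
  next
    case (insert j J)
    then obtain w where w: "\<And>R. R \<in> Pow J \<Longrightarrow> 0 \<le> w R" "sum w (Pow J) = (1::real)"
      "\<And>y. (\<Sum>R\<in>Pow J. w R * (sum y R - (\<Sum>i\<in>J. \<phi> i * y i))) = 0"
      "\<And>y. (\<Sum>R\<in>Pow J. w R * (sum y R - (\<Sum>i\<in>J. \<phi> i * y i))\<^sup>2) = (\<Sum>i\<in>J. \<phi> i * (1 - \<phi> i) * (y i)\<^sup>2)"
      by auto
    \<comment> \<open>The product weight for one more coordinate, according to whether
      \<open>j\<close> is drawn. The increment contributed by \<open>j\<close> has mean zero, so
      cross terms cancel in the second moment.\<close>
    define w' where "w' R = (if j \<in> R then \<phi> j * w (R - {j}) else (1 - \<phi> j) * w R)" for R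
    have fR: "finite R \<and> j \<notin> R" if "R \<in> Pow J" for R
      using that insert finite_subset by auto
    have w'1: "w' R = (1 - \<phi> j) * w R" "w' (insert j R) = \<phi> j * w R" if "R \<in> Pow J" for R
      using that fR by (auto simp: w'_def)
    have pos: "0 \<le> w' R" if "R \<in> Pow (insert j J)" for R
    proof (cases "j \<in> R")
      case True
      then have "R - {j} \<in> Pow J" using that by auto
      then show ?thesis using True insert.prems[of j] w(1) by (simp add: w'_def)
    next
      case False
      then have "R \<in> Pow J" using that by auto
      then show ?thesis using False insert.prems[of j] w(1) by (simp add: w'_def)
    qed
    have tot: "sum w' (Pow (insert j J)) = 1"
    proof -
      have "sum w' (Pow (insert j J)) = (\<Sum>R\<in>Pow J. w R)"
        unfolding sum_Pow_insert[OF insert(1,2)]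
        by (rule sum.cong) (auto simp: w'1 algebra_simps)
      then show ?thesis using w(2) by simp
    qed
    let ?D = "\<lambda>y R. sum y R - (\<Sum>i\<in>J. \<phi> i * y i)"
    have D: "sum y R - (\<Sum>i\<in>insert j J. \<phi> i * y i) = ?D y R - \<phi> j * y j"
      "sum y (insert j R) - (\<Sum>i\<in>insert j J. \<phi> i * y i) = ?D y R + (1 - \<phi> j) * y j"
      if "R \<in> Pow J" for R y
      using fR[OF that] insert(1,2) by (auto simp: algebra_simps)
    have m1: "(\<Sum>R\<in>Pow (insert j J). w' R * (sum y R - (\<Sum>i\<in>insert j J. \<phi> i * y i))) = 0" for y
    proof -
      have "(\<Sum>R\<in>Pow (insert j J). w' R * (sum y R - (\<Sum>i\<in>insert j J. \<phi> i * y i)))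
        = (\<Sum>R\<in>Pow J. w R * ?D y R)"
        unfolding sum_Pow_insert[OF insert(1,2)]
        by (rule sum.cong[OF refl], simp only: w'1 D) (simp add: algebra_simps)
      then show ?thesis using w(3) by simp
    qed
    have m2: "(\<Sum>R\<in>Pow (insert j J). w' R * (sum y R - (\<Sum>i\<in>insert j J. \<phi> i * y i))\<^sup>2)
       = (\<Sum>i\<in>insert j J. \<phi> i * (1 - \<phi> i) * (y i)\<^sup>2)" for y
    proof -
      have "(\<Sum>R\<in>Pow (insert j J). w' R * (sum y R - (\<Sum>i\<in>insert j J. \<phi> i * y i))\<^sup>2)
        = (\<Sum>R\<in>Pow J. w R * (?D y R)\<^sup>2 + \<phi> j * (1 - \<phi> j) * (y j)\<^sup>2 * w R)"
        unfolding sum_Pow_insert[OF insert(1,2)]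
        by (rule sum.cong[OF refl], simp only: w'1 D) (simp add: algebra_simps power2_eq_square)
      also have "\<dots> = (\<Sum>i\<in>J. \<phi> i * (1 - \<phi> i) * (y i)\<^sup>2) + \<phi> j * (1 - \<phi> j) * (y j)\<^sup>2"
        unfolding sum.distrib w(4) sum_distrib_left[symmetric] w(2) by simp
      finally show ?thesis using insert(1,2) by simp
    qed
    show ?case using pos tot m1 m2 by (intro exI[of _ w']) auto
  qed
  then show ?thesis using that by blast
qed

section \<open>Rademacher averages, with a uniformly chosen subset \<open>R\<close> of
  \<open>J\<close> as the sample point\<close>

definition rsign :: "'j set \<Rightarrow> 'j \<Rightarrow> real" where
  "rsign R j = (if j \<in> R then 1 else - 1)"

lemma rademacher_insert:
  fixes g :: "real \<Rightarrow> real"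
  assumes "finite J" "k \<notin> J"
  shows "(\<Sum>R\<in>Pow (insert k J). g (\<Sum>j\<in>insert k J. rsign R j * u j)) =
    (\<Sum>R\<in>Pow J. g ((\<Sum>j\<in>J. rsign R j * u j) - u k) + g ((\<Sum>j\<in>J. rsign R j * u j) + u k))"
  unfolding sum_Pow_insert[OF assms]
proof (rule sum.cong[OF refl])
  fix R assume "R \<in> Pow J"
  then have k: "k \<notin> R" using assms by auto
  have "(\<Sum>j\<in>J. rsign (insert k R) j * u j) = (\<Sum>j\<in>J. rsign R j * u j)"
    using assms by (intro sum.cong) (auto simp: rsign_def)
  then show "g (\<Sum>j\<in>insert k J. rsign R j * u j) + g (\<Sum>j\<in>insert k J. rsign (insert k R) j * u j) =
    g ((\<Sum>j\<in>J. rsign R j * u j) - u k) + g ((\<Sum>j\<in>J. rsign R j * u j) + u k)"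
    using assms k by (simp add: rsign_def algebra_simps)
qed

lemma rademacher_second_moment:
  assumes "finite J"
  shows "(\<Sum>R\<in>Pow J. (\<Sum>j\<in>J. rsign R j * u j)\<^sup>2) = 2 ^ card J * (\<Sum>j\<in>J. (u j)\<^sup>2)"
  using assms
proof (induction J)
  case (insert k J)
  have "(\<Sum>R\<in>Pow (insert k J). (\<Sum>j\<in>insert k J. rsign R j * u j)\<^sup>2) =
    (\<Sum>R\<in>Pow J. 2 * (\<Sum>j\<in>J. rsign R j * u j)\<^sup>2 + 2 * (u k)\<^sup>2)"
    unfolding rademacher_insert[OF insert(1,2), of "\<lambda>z. z\<^sup>2"]
    by (rule sum.cong) (auto simp: power2_eq_square algebra_simps)
  also have "\<dots> = 2 * (2 ^ card J * (\<Sum>j\<in>J. (u j)\<^sup>2)) + 2 ^ card J * (2 * (u k)\<^sup>2)"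
    unfolding sum.distrib sum_distrib_left[symmetric] insert.IH using insert(1) by (simp add: card_Pow)
  also have "\<dots> = 2 ^ card (insert k J) * (\<Sum>j\<in>insert k J. (u j)\<^sup>2)"
    using insert(1,2) by (simp add: algebra_simps)
  finally show ?case .
qed simp

lemma rademacher_fourth_moment:
  assumes "finite J"
  shows "(\<Sum>R\<in>Pow J. (\<Sum>j\<in>J. rsign R j * u j) ^ 4) \<le> 3 * 2 ^ card J * (\<Sum>j\<in>J. (u j)\<^sup>2)\<^sup>2"
  using assms
proof (induction J)
  case (insert k J)
  let ?Y = "\<lambda>R. \<Sum>j\<in>J. rsign R j * u j"
  have "(\<Sum>R\<in>Pow (insert k J). (\<Sum>j\<in>insert k J. rsign R j * u j) ^ 4) =
    (\<Sum>R\<in>Pow J. 2 * ?Y R ^ 4 + 12 * (u k)\<^sup>2 * (?Y R)\<^sup>2 + 2 * u k ^ 4)"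
    unfolding rademacher_insert[OF insert(1,2), of "\<lambda>z. z ^ 4"]
    by (rule sum.cong) (auto simp: power2_eq_square power4_eq_xxxx algebra_simps)
  also have "\<dots> = 2 * (\<Sum>R\<in>Pow J. ?Y R ^ 4) + 12 * (u k)\<^sup>2 * (2 ^ card J * (\<Sum>j\<in>J. (u j)\<^sup>2)) + 2 ^ card J * (2 * u k ^ 4)"
    unfolding sum.distrib sum_distrib_left[symmetric] rademacher_second_moment[OF insert(1)]
    using insert(1) by (simp add: card_Pow)
  \<comment> \<open>Raising the coefficient of \<open>u k ^ 4\<close> from 2 to 6 completes the
    square \<open>6 * (s + (u k)^2)^2\<close>, where \<open>s\<close> is the old sum of
    squares.\<close>
  also have "\<dots> \<le> 2 * (3 * 2 ^ card J * (\<Sum>j\<in>J. (u j)\<^sup>2)\<^sup>2) + 12 * (u k)\<^sup>2 * (2 ^ card J * (\<Sum>j\<in>J. (u j)\<^sup>2)) + 2 ^ card J * (6 * u k ^ 4)"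
    by (intro add_mono mult_left_mono insert.IH) auto
  also have "\<dots> = 3 * 2 ^ card (insert k J) * (\<Sum>j\<in>insert k J. (u j)\<^sup>2)\<^sup>2"
    using insert(1,2) by (simp add: algebra_simps power2_eq_square power4_eq_xxxx)
  finally show ?case .
qed simp

text \<open>Paley--Zygmund: the part of the second moment coming from \<open>Y^2 < s / 2\<close> is
  at most one half of it. By Cauchy--Schwarz the other part costs probability at least 1/4 times
  squared second moment over fourth moment, and that quotient is at least 1/3.\<close>

lemma rademacher_paley_zygmund:
  assumes "finite J"
  shows "2 ^ card J / 12 \<le>
    (\<Sum>R\<in>Pow J. of_bool ((\<Sum>j\<in>J. (u j)\<^sup>2) / 2 \<le> (\<Sum>j\<in>J. rsign R j * u j)\<^sup>2) :: real)"
proof -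
  let ?s = "\<Sum>j\<in>J. (u j)\<^sup>2" and ?Y = "\<lambda>R. \<Sum>j\<in>J. rsign R j * u j"
  define N where "N = (2::real) ^ card J"
  define c where "c = (\<Sum>R\<in>Pow J. of_bool (?s / 2 \<le> (?Y R)\<^sup>2) :: real)"
  have N: "0 < N" "(\<Sum>R\<in>Pow J. 1) = N" using assms by (simp_all add: N_def card_Pow)
  have s0: "0 \<le> ?s" by (simp add: sum_nonneg)
  show ?thesis
  proof (cases "?s = 0")
    case True
    then have "c = N" unfolding c_def N(2)[symmetric] by (intro sum.cong) auto
    then show ?thesis using N(1) unfolding c_def N_def by simp
  next
    case False
    with s0 have s: "0 < ?s" by simp
    let ?B = "\<Sum>R\<in>Pow J. of_bool (?s / 2 \<le> (?Y R)\<^sup>2) * (?Y R)\<^sup>2"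
    have "N * ?s = (\<Sum>R\<in>Pow J. (?Y R)\<^sup>2)"
      using rademacher_second_moment[OF assms, of u] by (simp add: N_def)
    also have "\<dots> \<le> (\<Sum>R\<in>Pow J. ?s / 2 + of_bool (?s / 2 \<le> (?Y R)\<^sup>2) * (?Y R)\<^sup>2)"
      by (rule sum_mono) (use s0 in auto)
    also have "\<dots> = N * ?s / 2 + ?B"
      unfolding sum.distrib using assms by (simp add: N_def card_Pow)
    finally have B: "N * ?s / 2 \<le> ?B" by simp
    have "(N * ?s / 2)\<^sup>2 \<le> ?B\<^sup>2"
      using B N(1) s0 by (intro power_mono) auto
    also have "\<dots> \<le> (\<Sum>R\<in>Pow J. (of_bool (?s / 2 \<le> (?Y R)\<^sup>2))\<^sup>2) * (\<Sum>R\<in>Pow J. ((?Y R)\<^sup>2)\<^sup>2)"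
      by (rule Cauchy_Schwarz_ineq_sum)
    also have "\<dots> = c * (\<Sum>R\<in>Pow J. ?Y R ^ 4)"
    proof -
      have "(of_bool b :: real)\<^sup>2 = of_bool b" for b by (cases b) auto
      then show ?thesis unfolding c_def by (simp flip: power_mult)
    qed
    also have "\<dots> \<le> c * (3 * N * ?s\<^sup>2)"
      unfolding N_def by (rule mult_left_mono[OF rademacher_fourth_moment[OF assms]])
        (auto simp: c_def intro: sum_nonneg)
    finally have "(N * ?s\<^sup>2) * (N / 12) \<le> (N * ?s\<^sup>2) * c"
      by (simp add: power2_eq_square field_simps)
    moreover have "0 < N * ?s\<^sup>2" using N(1) s by simp
    ultimately have "N / 12 \<le> c" by (simp only: mult_le_cancel_left_pos)
    then show ?thesis unfolding c_def N_def .
  qed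
qed

text \<open>The lower Khintchine inequality for exponent 1/2, by Markov's inequality on the
  Paley--Zygmund event.\<close>

lemma khintchine_sqrt:
  assumes "finite J"
  shows "2 ^ card J / 12 * sqrt (sqrt ((\<Sum>j\<in>J. (u j)\<^sup>2) / 2))
    \<le> (\<Sum>R\<in>Pow J. sqrt \<bar>\<Sum>j\<in>J. rsign R j * u j\<bar>)"
proof -
  let ?s = "\<Sum>j\<in>J. (u j)\<^sup>2" and ?Y = "\<lambda>R. \<Sum>j\<in>J. rsign R j * u j"
  have "2 ^ card J / 12 * sqrt (sqrt (?s / 2)) \<le>
    (\<Sum>R\<in>Pow J. of_bool (?s / 2 \<le> (?Y R)\<^sup>2)) * sqrt (sqrt (?s / 2))"
    by (rule mult_right_mono[OF rademacher_paley_zygmund[OF assms]]) (simp add: sum_nonneg)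
  also have "\<dots> \<le> (\<Sum>R\<in>Pow J. sqrt \<bar>?Y R\<bar>)"
    unfolding sum_distrib_right
  proof (rule sum_mono)
    fix R
    show "of_bool (?s / 2 \<le> (?Y R)\<^sup>2) * sqrt (sqrt (?s / 2)) \<le> sqrt \<bar>?Y R\<bar>"
    proof (cases "?s / 2 \<le> (?Y R)\<^sup>2")
      case True
      then have "sqrt (?s / 2) \<le> \<bar>?Y R\<bar>" using real_sqrt_le_mono[OF True] by simp
      then show ?thesis using True by simp
    qed simp
  qed
  finally show ?thesis .
qed

lemma sum_sqrt_le:
  fixes v :: "'k \<Rightarrow> real"
  assumes "\<And>k. k \<in> K \<Longrightarrow> 0 \<le> v k"
  shows "(\<Sum>k\<in>K. sqrt (v k)) \<le> sqrt (card K * (\<Sum>k\<in>K. v k))"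
proof (rule real_le_rsqrt)
  have "(\<Sum>k\<in>K. sqrt (v k))\<^sup>2 \<le> (\<Sum>k\<in>K. (sqrt (v k))\<^sup>2) * real (card K)"
    by (rule sum_squared_le_sum_of_squares)
  also have "(\<Sum>k\<in>K. (sqrt (v k))\<^sup>2) = (\<Sum>k\<in>K. v k)"
    using assms by (intro sum.cong) auto
  finally show "(\<Sum>k\<in>K. sqrt (v k))\<^sup>2 \<le> card K * (\<Sum>k\<in>K. v k)" by (simp add: mult.commute)
qed

lemma le_sum_uniform_weights:
  fixes g :: "'k \<Rightarrow> real"
  assumes "2 ^ n * c \<le> sum g K"
  shows "c \<le> (\<Sum>k\<in>K. 1 / 2 ^ n * g k)"
  using assms unfolding sum_distrib_left[symmetric] by (simp add: field_simps)

section \<open>From random subset sums to bounds in measure\<close>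

context finite_measure
begin

lemma measure_le_weighted_sum:
  fixes w :: "'k \<Rightarrow> real"
  assumes "finite K" "\<And>k. k \<in> K \<Longrightarrow> 0 \<le> w k"
    and E: "\<And>k. k \<in> K \<Longrightarrow> E k \<in> sets M"
    and H: "H \<in> sets M" "\<And>s. s \<in> H \<Longrightarrow> c \<le> (\<Sum>k\<in>K. w k * of_bool (s \<in> E k))"
  shows "c * measure M H \<le> (\<Sum>k\<in>K. w k * measure M (E k))"
proof -
  have "c * measure M H = (\<integral>s. c * indicator H s \<partial>M)"
    using H(1) by (simp add: sets.Int_space_eq2)
  also have "\<dots> \<le> (\<integral>s. (\<Sum>k\<in>K. w k * indicator (E k) s) \<partial>M)"
  proof (rule integral_mono)
    show "integrable M (\<lambda>s. c * indicator H s)"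
      using H(1) by (intro integrable_mult_right integrable_real_indicator) (auto simp: emeasure_eq_measure)
    show "integrable M (\<lambda>s. \<Sum>k\<in>K. w k * indicator (E k) s)"
      using E by (intro Bochner_Integration.integrable_sum integrable_mult_right integrable_real_indicator)
        (auto simp: emeasure_eq_measure)
    fix s
    show "c * indicator H s \<le> (\<Sum>k\<in>K. w k * indicator (E k) s)"
    proof (cases "s \<in> H")
      case True
      then show ?thesis using H(2)[OF True] by (simp add: indicator_def of_bool_def)
    next
      case False
      then show ?thesis using assms(2) by (auto intro!: sum_nonneg)
    qed
  qed
  also have "\<dots> = (\<Sum>k\<in>K. w k * measure M (E k))"
    using E
    by (subst Bochner_Integration.integral_sum)
       (auto intro!: integrable_mult_right integrable_real_indicator sum.cong
             simp: emeasure_eq_measure sets.Int_space_eq2)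
  finally show ?thesis .
qed

text \<open>The Fubini step behind the estimates of this part: if each point of \<open>H\<close>
  lies in the random set \<open>E k\<close> with probability at least \<open>c\<close>, then a
  common bound on the measures of the \<open>E k\<close> controls \<open>H\<close>.\<close>

lemma measure_le_of_average:
  fixes w :: "'k \<Rightarrow> real"
  assumes "finite K" "\<And>k. k \<in> K \<Longrightarrow> 0 \<le> w k" "sum w K = 1"
    and E: "\<And>k. k \<in> K \<Longrightarrow> E k \<in> sets M" "\<And>k. k \<in> K \<Longrightarrow> measure M (E k) \<le> \<delta>"
    and H: "H \<in> sets M" "\<And>s. s \<in> H \<Longrightarrow> c \<le> (\<Sum>k\<in>K. w k * of_bool (s \<in> E k))"
  shows "c * measure M H \<le> \<delta>"
proof -
  have "c * measure M H \<le> (\<Sum>k\<in>K. w k * measure M (E k))"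
    by (rule measure_le_weighted_sum[OF assms(1,2) E(1) H])
  also have "\<dots> \<le> (\<Sum>k\<in>K. w k * \<delta>)"
    using assms(2) E(2) by (intro sum_mono mult_left_mono) auto
  also have "\<dots> = \<delta>" using assms(3) by (simp flip: sum_distrib_right)
  finally show ?thesis .
qed

text \<open>Where some summand exceeds \<open>2 * t\<close>, a uniformly chosen subset sum exceeds
  \<open>t\<close> with probability at least one half, by
  \<open>subset_sums_half_large\<close>.\<close>

lemma measure_max_le_subset_sums:
  fixes v :: "'i \<Rightarrow> 'a \<Rightarrow> real"
  assumes I: "finite I" and v [measurable]: "\<And>i. i \<in> I \<Longrightarrow> v i \<in> borel_measurable M"
    and bound: "\<And>Q. Q \<subseteq> I \<Longrightarrow> measure M {s\<in>space M. t < \<bar>\<Sum>i\<in>Q. v i s\<bar>} \<le> \<delta>"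
  shows "measure M {s\<in>space M. \<exists>i\<in>I. 2 * t < \<bar>v i s\<bar>} \<le> 2 * \<delta>"
proof -
  have "1 / 2 * measure M {s\<in>space M. \<exists>i\<in>I. 2 * t < \<bar>v i s\<bar>} \<le> \<delta>"
  proof (rule measure_le_of_average[where K = "Pow I" and w = "\<lambda>_. 1 / 2 ^ card I"
        and E = "\<lambda>Q. {s\<in>space M. t < \<bar>\<Sum>i\<in>Q. v i s\<bar>}"])
    fix Q assume Q: "Q \<in> Pow I"
    then have [measurable]: "i \<in> Q \<Longrightarrow> v i \<in> borel_measurable M" for i using v by auto
    show "{s \<in> space M. t < \<bar>\<Sum>i\<in>Q. v i s\<bar>} \<in> sets M" by measurable
    show "measure M {s\<in>space M. t < \<bar>\<Sum>i\<in>Q. v i s\<bar>} \<le> \<delta>" using Q bound by auto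
  next
    show "{s \<in> space M. \<exists>i\<in>I. 2 * t < \<bar>v i s\<bar>} \<in> sets M"
      using I by measurable
    fix s assume "s \<in> {s \<in> space M. \<exists>i\<in>I. 2 * t < \<bar>v i s\<bar>}"
    then obtain i where i: "s \<in> space M" "i \<in> I" "2 * t < \<bar>v i s\<bar>" by auto
    from subset_sums_half_large[where v = "\<lambda>i. v i s", OF I i(2,3)] i(1)
    show "(1::real) / 2 \<le> (\<Sum>Q\<in>Pow I. 1 / 2 ^ card I * of_bool (s \<in> {s \<in> space M. t < \<bar>\<Sum>i\<in>Q. v i s\<bar>}))"
      by (intro le_sum_uniform_weights) simp
  qed (use I in \<open>auto simp: card_Pow\<close>)
  then show ?thesis by simp
qed

text \<open>A signed sum is the sum over \<open>Q\<close> minus the sum over \<open>I - Q\<close>,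
  so if it exceeds \<open>2 * K\<close> one of the two exceeds \<open>K\<close>. By Paley--Zygmund,
  squares summing to more than \<open>8 * K^2\<close> produce such a sign pattern with probability
  at least 1/12; two events for each pattern give 24.\<close>

lemma measure_sum_squares_le_subset_sums:
  fixes x :: "'i \<Rightarrow> 'a \<Rightarrow> real"
  assumes I: "finite I" and x [measurable]: "\<And>i. i \<in> I \<Longrightarrow> x i \<in> borel_measurable M"
    and K: "0 \<le> K"
    and bound: "\<And>Q. Q \<subseteq> I \<Longrightarrow> measure M {s\<in>space M. K < \<bar>\<Sum>i\<in>Q. x i s\<bar>} \<le> \<delta>"
  shows "measure M {s\<in>space M. 8 * K\<^sup>2 < (\<Sum>i\<in>I. (x i s)\<^sup>2)} \<le> 24 * \<delta>"
proof -
  let ?E = "\<lambda>Q. {s\<in>space M. K < \<bar>\<Sum>i\<in>Q. x i s\<bar>}"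
  have m: "?E Q \<in> sets M" if "Q \<subseteq> I" for Q
  proof -
    from that have [measurable]: "i \<in> Q \<Longrightarrow> x i \<in> borel_measurable M" for i using x by auto
    show ?thesis by measurable
  qed
  have "1 / 12 * measure M {s\<in>space M. 8 * K\<^sup>2 < (\<Sum>i\<in>I. (x i s)\<^sup>2)} \<le> 2 * \<delta>"
  proof (rule measure_le_of_average[where K = "Pow I" and w = "\<lambda>_. 1 / 2 ^ card I"
        and E = "\<lambda>Q. ?E Q \<union> ?E (I - Q)"])
    fix Q assume Q: "Q \<in> Pow I"
    then show "?E Q \<union> ?E (I - Q) \<in> sets M" by (intro sets.Un m) auto
    have "measure M (?E Q \<union> ?E (I - Q)) \<le> measure M (?E Q) + measure M (?E (I - Q))"
      using Q by (intro measure_Un_le m) auto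
    also have "\<dots> \<le> \<delta> + \<delta>"
      using Q by (intro add_mono bound) auto
    finally show "measure M (?E Q \<union> ?E (I - Q)) \<le> 2 * \<delta>" by simp
  next
    show "{s\<in>space M. 8 * K\<^sup>2 < (\<Sum>i\<in>I. (x i s)\<^sup>2)} \<in> sets M"
      by measurable
    fix s assume s: "s \<in> {s\<in>space M. 8 * K\<^sup>2 < (\<Sum>i\<in>I. (x i s)\<^sup>2)}"
    have "2 ^ card I / 12 \<le> (\<Sum>Q\<in>Pow I. of_bool ((\<Sum>i\<in>I. (x i s)\<^sup>2) / 2 \<le> (\<Sum>i\<in>I. rsign Q i * x i s)\<^sup>2) :: real)"
      by (rule rademacher_paley_zygmund[OF I])
    also have "\<dots> \<le> (\<Sum>Q\<in>Pow I. of_bool (s \<in> ?E Q \<union> ?E (I - Q)))"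
    proof (rule sum_mono)
      fix Q assume Q: "Q \<in> Pow I"
      have "(\<Sum>i\<in>I. rsign Q i * x i s) = (\<Sum>i\<in>Q. rsign Q i * x i s) + (\<Sum>i\<in>I - Q. rsign Q i * x i s)"
        using Q I sum.subset_diff[of Q I] by (simp add: add.commute)
      also have "\<dots> = (\<Sum>i\<in>Q. x i s) - (\<Sum>i\<in>I - Q. x i s)"
        by (simp add: rsign_def sum_negf)
      finally have eq: "(\<Sum>i\<in>I. rsign Q i * x i s) = (\<Sum>i\<in>Q. x i s) - (\<Sum>i\<in>I - Q. x i s)" .
      have "s \<in> ?E Q \<union> ?E (I - Q)" if "(\<Sum>i\<in>I. (x i s)\<^sup>2) / 2 \<le> (\<Sum>i\<in>I. rsign Q i * x i s)\<^sup>2"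
      proof -
        have "(2 * K)\<^sup>2 < (\<Sum>i\<in>I. rsign Q i * x i s)\<^sup>2"
          using that s by (simp add: power_mult_distrib)
        then have "2 * K < \<bar>\<Sum>i\<in>I. rsign Q i * x i s\<bar>"
          using K by (metis abs_ge_zero abs_of_nonneg power2_abs power_less_imp_less_base)
        then show ?thesis using s unfolding eq by auto
      qed
      then show "of_bool ((\<Sum>i\<in>I. (x i s)\<^sup>2) / 2 \<le> (\<Sum>i\<in>I. rsign Q i * x i s)\<^sup>2)
        \<le> (of_bool (s \<in> ?E Q \<union> ?E (I - Q)) :: real)"
        by (simp only: of_bool_def) auto
    qed
    finally show "(1::real) / 12 \<le> (\<Sum>Q\<in>Pow I. 1 / 2 ^ card I * of_bool (s \<in> ?E Q \<union> ?E (I - Q)))"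
      by (intro le_sum_uniform_weights) simp
  qed (use I in \<open>auto simp: card_Pow\<close>)
  then show ?thesis by simp
qed

text \<open>
  Including \<open>i\<close> in a random set \<open>R\<close> with probability \<open>\<phi> i\<close>, independently, gives subset sums with mean
  \<open>\<Sum>i\<in>I. \<phi> i * x i\<close> and variance at most \<open>(\<Sum>i\<in>I. (x i)\<^sup>2) / 4\<close>.
\<close>

lemma measure_convex_sum_le_subset_sums:
  fixes x :: "'i \<Rightarrow> 'a \<Rightarrow> real"
  assumes I: "finite I" and x [measurable]: "\<And>i. i \<in> I \<Longrightarrow> x i \<in> borel_measurable M"
    and K: "0 < K"
    and bound: "\<And>Q. Q \<subseteq> I \<Longrightarrow> measure M {s\<in>space M. K < \<bar>\<Sum>i\<in>Q. x i s\<bar>} \<le> \<delta>"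
    and \<phi>: "\<And>i. i \<in> I \<Longrightarrow> 0 \<le> \<phi> i \<and> \<phi> i \<le> 1"
  shows "measure M {s\<in>space M. 3 * K < \<bar>\<Sum>i\<in>I. \<phi> i * x i s\<bar>} \<le> 26 * \<delta>"
proof -
  obtain w where w: "\<And>R. R \<in> Pow I \<Longrightarrow> 0 \<le> w R" "sum w (Pow I) = (1::real)"
    "\<And>y. (\<Sum>R\<in>Pow I. w R * (sum y R - (\<Sum>i\<in>I. \<phi> i * y i))\<^sup>2) = (\<Sum>i\<in>I. \<phi> i * (1 - \<phi> i) * (y i)\<^sup>2)"
    using bernoulli_weights[OF I, of \<phi>] \<phi> by blast
  let ?E = "\<lambda>Q. {s\<in>space M. K < \<bar>\<Sum>i\<in>Q. x i s\<bar>}"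
  let ?A = "{s\<in>space M. 8 * K\<^sup>2 < (\<Sum>i\<in>I. (x i s)\<^sup>2)}"
  let ?B = "{s\<in>space M. 3 * K < \<bar>\<Sum>i\<in>I. \<phi> i * x i s\<bar> \<and> (\<Sum>i\<in>I. (x i s)\<^sup>2) \<le> 8 * K\<^sup>2}"
  have "1 / 2 * measure M ?B \<le> \<delta>"
  proof (rule measure_le_of_average[where K = "Pow I" and w = w and E = ?E])
    fix Q assume Q: "Q \<in> Pow I"
    then have [measurable]: "i \<in> Q \<Longrightarrow> x i \<in> borel_measurable M" for i using x by auto
    show "?E Q \<in> sets M" by measurable
    show "measure M (?E Q) \<le> \<delta>" using Q bound by auto
    show "0 \<le> w Q" using Q w(1) by auto
  next
    show "?B \<in> sets M" by measurable
    fix s assume s: "s \<in> ?B"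
    let ?d = "\<lambda>Q. sum (\<lambda>i. x i s) Q - (\<Sum>i\<in>I. \<phi> i * x i s)"
    have "(\<Sum>Q\<in>Pow I. w Q * (?d Q)\<^sup>2) = (\<Sum>i\<in>I. \<phi> i * (1 - \<phi> i) * (x i s)\<^sup>2)"
      using w(3)[of "\<lambda>i. x i s"] .
    also have "\<dots> \<le> (\<Sum>i\<in>I. 1 / 4 * (x i s)\<^sup>2)"
    proof (intro sum_mono mult_right_mono)
      fix i
      have "0 \<le> (\<phi> i - 1 / 2)\<^sup>2" by simp
      then show "\<phi> i * (1 - \<phi> i) \<le> 1 / 4" by (simp add: power2_eq_square algebra_simps)
    qed simp
    also have "\<dots> \<le> 2 * K\<^sup>2" using s by (simp flip: sum_distrib_left sum_divide_distrib)
    finally have d: "(\<Sum>Q\<in>Pow I. w Q * (?d Q)\<^sup>2) \<le> 2 * K\<^sup>2" .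
    \<comment> \<open>Chebyshev: on \<open>?B\<close> a subset sum of size at most \<open>K\<close>
      deviates from its mean, which exceeds \<open>3 * K\<close>, by at least \<open>2 * K\<close>.
      With variance at most \<open>2 * K^2\<close> this has probability at most one half.\<close>
    have pt: "w Q - w Q * (?d Q)\<^sup>2 / (4 * K\<^sup>2) \<le> w Q * of_bool (s \<in> ?E Q)" if "Q \<in> Pow I" for Q
    proof (cases "s \<in> ?E Q")
      case False
      then have "2 * K \<le> \<bar>?d Q\<bar>" using s by auto
      then have "(2 * K)\<^sup>2 \<le> (?d Q)\<^sup>2" using K abs_le_square_iff[of "2 * K" "?d Q"] by simp
      then have "1 \<le> (?d Q)\<^sup>2 / (4 * K\<^sup>2)" using K by (simp add: power_mult_distrib)
      then have "w Q * 1 \<le> w Q * ((?d Q)\<^sup>2 / (4 * K\<^sup>2))"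
        by (rule mult_left_mono) (use w(1) that in auto)
      then show ?thesis by (simp add: of_bool_def False del: mem_Collect_eq)
    next
      case True
      then show ?thesis using w(1)[OF that] by simp
    qed
    have "1 / 2 \<le> (\<Sum>Q\<in>Pow I. w Q) - (\<Sum>Q\<in>Pow I. w Q * (?d Q)\<^sup>2) / (4 * K\<^sup>2)"
      using d K w(2) by (simp add: field_simps)
    also have "\<dots> = (\<Sum>Q\<in>Pow I. w Q - w Q * (?d Q)\<^sup>2 / (4 * K\<^sup>2))"
      by (simp add: sum_subtractf sum_divide_distrib)
    also have "\<dots> \<le> (\<Sum>Q\<in>Pow I. w Q * of_bool (s \<in> ?E Q))"
      by (rule sum_mono[OF pt])
    finally show "1 / 2 \<le> (\<Sum>Q\<in>Pow I. w Q * of_bool (s \<in> ?E Q))" .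
  qed (use I w in auto)
  then have B: "measure M ?B \<le> 2 * \<delta>" by simp
  have A: "measure M ?A \<le> 24 * \<delta>"
    using measure_sum_squares_le_subset_sums[OF I x _ bound] K by simp
  have "measure M {s\<in>space M. 3 * K < \<bar>\<Sum>i\<in>I. \<phi> i * x i s\<bar>} \<le> measure M (?A \<union> ?B)"
    by (rule finite_measure_mono) (auto simp: not_less)
  also have "\<dots> \<le> measure M ?A + measure M ?B"
    by (rule measure_Un_le) measurable
  finally show ?thesis using A B by simp
qed

text \<open>Positive and negative parts of the coefficients are convex coefficients each, which
  doubles both constants.\<close>

lemma measure_bounded_sum_le_subset_sums:
  fixes x :: "'i \<Rightarrow> 'a \<Rightarrow> real"
  assumes I: "finite I" and x [measurable]: "\<And>i. i \<in> I \<Longrightarrow> x i \<in> borel_measurable M"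
    and K: "0 < K"
    and bound: "\<And>Q. Q \<subseteq> I \<Longrightarrow> measure M {s\<in>space M. K < \<bar>\<Sum>i\<in>Q. x i s\<bar>} \<le> \<delta>"
    and \<phi>: "\<And>i. i \<in> I \<Longrightarrow> \<bar>\<phi> i\<bar> \<le> 1"
  shows "measure M {s\<in>space M. 6 * K < \<bar>\<Sum>i\<in>I. \<phi> i * x i s\<bar>} \<le> 52 * \<delta>"
proof -
  let ?p = "\<lambda>i. max 0 (\<phi> i)" and ?n = "\<lambda>i. max 0 (- \<phi> i)"
  let ?A = "\<lambda>f. {s\<in>space M. 3 * K < \<bar>\<Sum>i\<in>I. f i * x i s\<bar>}"
  have b: "measure M (?A ?p) \<le> 26 * \<delta>" "measure M (?A ?n) \<le> 26 * \<delta>"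
    by (rule measure_convex_sum_le_subset_sums[OF I x K bound]; use \<phi> in fastforce)+
  have eq: "(\<Sum>i\<in>I. \<phi> i * x i s) = (\<Sum>i\<in>I. ?p i * x i s) - (\<Sum>i\<in>I. ?n i * x i s)" for s
    unfolding sum_subtractf[symmetric] by (rule sum.cong) (auto simp: max_def algebra_simps)
  have "measure M {s\<in>space M. 6 * K < \<bar>\<Sum>i\<in>I. \<phi> i * x i s\<bar>} \<le> measure M (?A ?p \<union> ?A ?n)"
  proof (rule finite_measure_mono)
    show "{s\<in>space M. 6 * K < \<bar>\<Sum>i\<in>I. \<phi> i * x i s\<bar>} \<subseteq> ?A ?p \<union> ?A ?n"
      unfolding eq by auto
  qed measurable
  also have "\<dots> \<le> measure M (?A ?p) + measure M (?A ?n)"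
    by (rule measure_Un_le) measurable
  finally show ?thesis using b by simp
qed

end

section \<open>Square functions\<close>

lemma sqrt_sum_le_sum_sqrt:
  assumes "finite I" "\<And>i. i \<in> I \<Longrightarrow> 0 \<le> (v i :: real)"
  shows "sqrt (sum v I) \<le> (\<Sum>i\<in>I. sqrt (v i))"
  using assms
proof (induction I)
  case (insert i I)
  then have "sqrt (sum v (insert i I)) \<le> sqrt (v i) + sqrt (sum v I)"
    by (simp add: sqrt_add_le_add_sqrt sum_nonneg)
  then show ?case using insert by simp
qed simp

lemma sqrt_abs_add_le: "sqrt \<bar>a + b\<bar> \<le> sqrt \<bar>a\<bar> + sqrt \<bar>b\<bar>"
proof -
  have "sqrt \<bar>a + b\<bar> \<le> sqrt (\<bar>a\<bar> + \<bar>b\<bar>)" by simp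
  also have "\<dots> \<le> sqrt \<bar>a\<bar> + sqrt \<bar>b\<bar>" by (rule sqrt_add_le_add_sqrt) auto
  finally show ?thesis .
qed

definition clip :: "real \<Rightarrow> real \<Rightarrow> real" where
  "clip L t = max (- L) (min L t)"

lemma abs_clip_le: "0 \<le> L \<Longrightarrow> \<bar>clip L t\<bar> \<le> L"
  by (auto simp: clip_def)

text \<open>Where clipping acts, \<open>\<bar>t\<bar> > L\<close> and hence
  \<open>\<bar>t\<bar> \<le> t^2 / L\<close>. The fourth power is what the Rademacher fourth moment
  controls.\<close>

lemma clip_remainder_le:
  assumes "0 < L"
  shows "(t - clip L t)\<^sup>2 \<le> t ^ 4 / L\<^sup>2"
proof -
  have "\<bar>t - clip L t\<bar> \<le> t\<^sup>2 / L"
  proof (cases "\<bar>t\<bar> \<le> L")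
    case True
    then show ?thesis using assms by (auto simp: clip_def)
  next
    case False
    then have "\<bar>t - clip L t\<bar> \<le> \<bar>t\<bar>" using assms by (auto simp: clip_def)
    also have "\<bar>t\<bar> * L \<le> \<bar>t\<bar> * \<bar>t\<bar>" using False by (intro mult_left_mono) auto
    then have "\<bar>t\<bar> \<le> t\<^sup>2 / L" using assms by (simp add: field_simps power2_eq_square)
    finally show ?thesis .
  qed
  then have "\<bar>t - clip L t\<bar>\<^sup>2 \<le> (t\<^sup>2 / L)\<^sup>2" by (intro power_mono) auto
  then show ?thesis by (simp add: power_divide flip: power_mult)
qed

text \<open>\<open>I\<close> stands for the atoms of a finite partition and \<open>x i\<close> for
  the measure of the atom \<open>i\<close>. The inner sum is then the integral of a step function
  with values \<open>f j i\<close>, and the whole is the square of the square function of these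
  integrals.\<close>

definition square_sum ::
  "'i set \<Rightarrow> ('i \<Rightarrow> 'a \<Rightarrow> real) \<Rightarrow> 'j set \<Rightarrow> ('j \<Rightarrow> 'i \<Rightarrow> real) \<Rightarrow> 'a \<Rightarrow> real" where
  "square_sum I x J f s = (\<Sum>j\<in>J. (\<Sum>i\<in>I. f j i * x i s)\<^sup>2)"

text \<open>
  Grothendieck's truncation argument. By Khintchine, the square function of \<open>f\<close> is the size of the
  random function \<open>\<phi> R = (\<Sum>j. rsign R j * f j)\<close>, which has bounded fourth moments at each point.
  Truncated at a high level it falls under the hypothesis, and the remainder is a small multiple of
  a family satisfying the same hypothesis as \<open>f\<close>, so that the supremum over all such families is
  bounded in terms of itself with a factor less than 1. It is finite because \<open>I\<close> is.
\<close>

lemma (in finite_measure) square_function_le: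
  fixes x :: "'i \<Rightarrow> 'a \<Rightarrow> real" and f :: "'j \<Rightarrow> 'i \<Rightarrow> real"
  assumes I: "finite I" and x [measurable]: "\<And>i. i \<in> I \<Longrightarrow> x i \<in> borel_measurable M"
    and int: "\<And>\<phi>. (\<And>i. i \<in> I \<Longrightarrow> \<bar>\<phi> i\<bar> \<le> 1) \<Longrightarrow> integrable M (\<lambda>s. sqrt \<bar>\<Sum>i\<in>I. \<phi> i * x i s\<bar>)"
    and C: "\<And>\<phi>. (\<And>i. i \<in> I \<Longrightarrow> \<bar>\<phi> i\<bar> \<le> 1) \<Longrightarrow> (\<integral>s. sqrt \<bar>\<Sum>i\<in>I. \<phi> i * x i s\<bar> \<partial>M) \<le> C"
    and J: "finite J" and f: "\<And>i. i \<in> I \<Longrightarrow> (\<Sum>j\<in>J. (f j i)\<^sup>2) \<le> 1"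
  shows "integrable M (\<lambda>s. sqrt (sqrt (square_sum I x J f s)))"
    and "(\<integral>s. sqrt (sqrt (square_sum I x J f s)) \<partial>M) \<le> 1800 * C"
proof -
  \<comment> \<open>A crude integrable majorant depending on \<open>card I\<close>. It serves
    integrability and the finiteness of the supremum below, and does not enter the final
    constant.\<close>
  define b where "b s = sqrt (sqrt (card I)) * (\<Sum>i\<in>I. sqrt \<bar>x i s\<bar>)" for s
  have "integrable M (\<lambda>s. sqrt \<bar>x k s\<bar>)" if "k \<in> I" for k
    using int[of "\<lambda>i. of_bool (i = k)"] I that by (simp add: of_bool_def sum.delta if_distrib if_distribR cong: if_cong)
  then have b_int: "integrable M b" unfolding b_def by auto
  have X0: "0 \<le> square_sum I x K g s" for K and g :: "'k \<Rightarrow> 'i \<Rightarrow> real" and s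
    unfolding square_sum_def by (simp add: sum_nonneg)
  have X_meas [measurable]: "square_sum I x K g \<in> borel_measurable M" for K and g :: "'k \<Rightarrow> 'i \<Rightarrow> real"
    unfolding square_sum_def by measurable
  have X_b: "sqrt (sqrt (square_sum I x K g s)) \<le> b s"
    if "\<And>i. i \<in> I \<Longrightarrow> (\<Sum>j\<in>K. (g j i)\<^sup>2) \<le> 1"
    for K and g :: "'k \<Rightarrow> 'i \<Rightarrow> real" and s
  proof -
    have "square_sum I x K g s \<le> (\<Sum>j\<in>K. (\<Sum>i\<in>I. (g j i)\<^sup>2) * (\<Sum>i\<in>I. (x i s)\<^sup>2))"
      unfolding square_sum_def by (intro sum_mono Cauchy_Schwarz_ineq_sum)
    also have "\<dots> = (\<Sum>i\<in>I. \<Sum>j\<in>K. (g j i)\<^sup>2) * (\<Sum>i\<in>I. (x i s)\<^sup>2)"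
      unfolding sum_distrib_right[symmetric] by (subst sum.swap) simp
    also have "\<dots> \<le> (\<Sum>i\<in>I. 1) * (\<Sum>i\<in>I. (x i s)\<^sup>2)"
      by (intro mult_right_mono sum_mono that sum_nonneg) auto
    finally have "sqrt (square_sum I x K g s) \<le> sqrt (card I) * L2_set (\<lambda>i. x i s) I"
      unfolding L2_set_def by (simp flip: real_sqrt_mult)
    also have "\<dots> \<le> sqrt (card I) * (\<Sum>i\<in>I. \<bar>x i s\<bar>)"
      by (intro mult_left_mono L2_set_le_sum_abs) auto
    finally have "sqrt (sqrt (square_sum I x K g s)) \<le> sqrt (sqrt (card I)) * sqrt (\<Sum>i\<in>I. \<bar>x i s\<bar>)"
      by (simp flip: real_sqrt_mult)
    also have "\<dots> \<le> b s"
      unfolding b_def by (intro mult_left_mono sqrt_sum_le_sum_sqrt I) auto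
    finally show ?thesis .
  qed
  have X_int: "integrable M (\<lambda>s. sqrt (sqrt (square_sum I x K g s)))"
    if "\<And>i. i \<in> I \<Longrightarrow> (\<Sum>j\<in>K. (g j i)\<^sup>2) \<le> 1"
    for K and g :: "'k \<Rightarrow> 'i \<Rightarrow> real"
    by (rule Bochner_Integration.integrable_bound[OF b_int])
       (use X_b[of g K] X0[of K g] that in \<open>auto intro!: AE_I2 intro: order_trans[OF _ abs_ge_self]\<close>)
  define V where "V = {\<integral>s. sqrt (sqrt (square_sum I x {..<n} g s)) \<partial>M | (n::nat) g.
      \<forall>i\<in>I. (\<Sum>j<n. (g j i)\<^sup>2) \<le> 1}"
  have V_bdd: "bdd_above V"
  proof (rule bdd_aboveI)
    fix v assume "v \<in> V"
    then show "v \<le> (\<integral>s. b s \<partial>M)"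
      unfolding V_def by (auto intro!: integral_mono X_int b_int X_b)
  qed
  have "(\<integral>s. sqrt (sqrt (square_sum I x {..<0::nat} (\<lambda>_ _. 0) s)) \<partial>M) \<in> V"
    unfolding V_def by (auto intro!: exI[of _ "0::nat"] exI[of _ "\<lambda>_ _. 0"])
  then have V_ne: "V \<noteq> {}" by auto
  have V_upper: "(\<integral>s. sqrt (sqrt (square_sum I x K g s)) \<partial>M) \<le> Sup V"
    if K: "finite K" "\<And>i. i \<in> I \<Longrightarrow> (\<Sum>j\<in>K. (g j i)\<^sup>2) \<le> 1"
    for K and g :: "'k \<Rightarrow> 'i \<Rightarrow> real"
  proof -
    obtain h where h: "bij_betw h {..<card K} K"
      using ex_bij_betw_nat_finite[OF K(1)] by (auto simp: lessThan_atLeast0)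
    have "square_sum I x K g s = square_sum I x {..<card K} (g \<circ> h) s" for s
      unfolding square_sum_def comp_def by (rule sum.reindex_bij_betw[OF h, symmetric])
    moreover have "(\<Sum>j<card K. ((g \<circ> h) j i)\<^sup>2) \<le> 1" if "i \<in> I" for i
      using K(2)[OF that]
      unfolding comp_def by (simp add: sum.reindex_bij_betw[OF h, of "\<lambda>j. (g j i)\<^sup>2"])
    ultimately show ?thesis
      by (intro cSup_upper[OF _ V_bdd])
        (auto simp: V_def intro!: exI[of _ "card K"] exI[of _ "g \<circ> h"])
  qed
  have step: "(\<integral>s. sqrt (sqrt (square_sum I x {..<n} f s)) \<partial>M) \<le> 900 * C + Sup V / 2"
    if f: "\<And>i. i \<in> I \<Longrightarrow> (\<Sum>j<n. (f j i)\<^sup>2) \<le> 1" for n :: nat and f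
  proof -
    define P where "P = Pow {..<n}"
    define N where "N = (2::real) ^ n"
    \<comment> \<open>A perfect square, large enough for the remainder to return with a factor below
      one half: \<open>15 * sqrt (sqrt 3) / sqrt L \<le> 7 / 20\<close>. Here 15 bounds Khintchine's
      12 times \<open>sqrt (sqrt 2)\<close>.\<close>
    define L where "L = (3600::real)"
    have N: "0 < N" "real (card P) = N" "finite P" "(\<Sum>R\<in>P. 1) = N" by (auto simp: N_def P_def card_Pow)
    have L: "0 < L" "sqrt L = 60"
      using real_sqrt_unique[of 60 3600] by (auto simp: L_def)
    define \<phi> where "\<phi> R i = (\<Sum>j<n. rsign R j * f j i)" for R i
    define \<psi> where "\<psi> R i = clip L (\<phi> R i)" for R i
    define \<rho> where "\<rho> R i = \<phi> R i - \<psi> R i" for R i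
    \<comment> \<open>The squares of the remainders sum to at most \<open>3 * N / L^2\<close> over
      all sign patterns, by the fourth moment bound; this scaling makes them an admissible family,
      indexed by the patterns \<open>R\<close>.\<close>
    define f' where "f' R i = L / sqrt (3 * N) * \<rho> R i" for R i
    have f'1: "(\<Sum>R\<in>P. (f' R i)\<^sup>2) \<le> 1" if i: "i \<in> I" for i
    proof -
      have "(\<Sum>R\<in>P. (f' R i)\<^sup>2) = L\<^sup>2 / (3 * N) * (\<Sum>R\<in>P. (\<rho> R i)\<^sup>2)"
        unfolding f'_def sum_distrib_left using N by (simp add: power_mult_distrib power_divide)
      also have "\<dots> \<le> L\<^sup>2 / (3 * N) * (\<Sum>R\<in>P. \<phi> R i ^ 4 / L\<^sup>2)"
        unfolding \<rho>_def \<psi>_def using N L by (intro mult_left_mono sum_mono clip_remainder_le) auto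
      also have "\<dots> = (\<Sum>R\<in>P. \<phi> R i ^ 4) / (3 * N)"
        using L(1) by (simp flip: sum_divide_distrib)
      also have "\<dots> \<le> (3 * N * (\<Sum>j<n. (f j i)\<^sup>2)\<^sup>2) / (3 * N)"
        using rademacher_fourth_moment[of "{..<n}" "\<lambda>j. f j i"] N(1)
        unfolding \<phi>_def P_def N_def by (intro divide_right_mono) auto
      also have "\<dots> = (\<Sum>j<n. (f j i)\<^sup>2)\<^sup>2" using N(1) by simp
      also have "\<dots> \<le> 1" using f[OF i] by (intro power_le_one) (auto simp: sum_nonneg)
      finally show ?thesis .
    qed
    define Y where "Y g s = (\<Sum>i\<in>I. g i * x i s)" for g s
    have pt: "sqrt (sqrt (square_sum I x {..<n} f s)) \<le>
        15 * (60 * ((1 / N) * (\<Sum>R\<in>P. sqrt \<bar>Y (\<lambda>i. \<psi> R i / L) s\<bar>)) + 7 / 300 * sqrt (sqrt (square_sum I x P f' s)))"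
      (is "_ \<le> 15 * (60 * (1 / N * ?U) + _)") for s
    proof -
      have Y\<phi>: "(\<Sum>j<n. rsign R j * (\<Sum>i\<in>I. f j i * x i s)) = Y (\<phi> R) s" for R
        unfolding Y_def \<phi>_def sum_distrib_left sum_distrib_right
        by (subst sum.swap) (simp add: mult.assoc)
      have "N / 12 * sqrt (sqrt (square_sum I x {..<n} f s / 2)) \<le> (\<Sum>R\<in>P. sqrt \<bar>Y (\<phi> R) s\<bar>)"
        using khintchine_sqrt[of "{..<n}" "\<lambda>j. \<Sum>i\<in>I. f j i * x i s"]
        unfolding Y\<phi> by (simp add: N_def P_def square_sum_def)
      also have "\<dots> \<le> (\<Sum>R\<in>P. sqrt \<bar>Y (\<psi> R) s\<bar> + sqrt \<bar>Y (\<rho> R) s\<bar>)"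
      proof (rule sum_mono)
        fix R
        have "Y (\<phi> R) s = Y (\<psi> R) s + Y (\<rho> R) s"
          unfolding Y_def \<rho>_def sum.distrib[symmetric] by (simp add: algebra_simps)
        then show "sqrt \<bar>Y (\<phi> R) s\<bar> \<le> sqrt \<bar>Y (\<psi> R) s\<bar> + sqrt \<bar>Y (\<rho> R) s\<bar>"
          using sqrt_abs_add_le by simp
      qed
      also have "\<dots> = 60 * ?U + (\<Sum>R\<in>P. sqrt \<bar>Y (\<rho> R) s\<bar>)"
      proof -
        have "Y (\<psi> R) s = L * Y (\<lambda>i. \<psi> R i / L) s" for R
          unfolding Y_def sum_distrib_left using L(1) by simp
        then have "sqrt \<bar>Y (\<psi> R) s\<bar> = 60 * sqrt \<bar>Y (\<lambda>i. \<psi> R i / L) s\<bar>" for R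
          using L(1,2) by (simp add: abs_mult real_sqrt_mult)
        then show ?thesis by (simp add: sum.distrib sum_distrib_left)
      qed
      \<comment> \<open>Cauchy--Schwarz twice: the average of square roots is at most the fourth
        root of the average of squares, which is the square function of \<open>f'\<close> up to
        scaling.\<close>
      also have "(\<Sum>R\<in>P. sqrt \<bar>Y (\<rho> R) s\<bar>) \<le> N * (7 / 300 * sqrt (sqrt (square_sum I x P f' s)))"
      proof -
        have "(\<Sum>R\<in>P. sqrt \<bar>Y (\<rho> R) s\<bar>) \<le> sqrt (card P * (\<Sum>R\<in>P. sqrt ((Y (\<rho> R) s)\<^sup>2)))"
          using sum_sqrt_le[of P "\<lambda>R. \<bar>Y (\<rho> R) s\<bar>"] by simp
        also have "\<dots> \<le> sqrt (card P * sqrt (card P * (\<Sum>R\<in>P. (Y (\<rho> R) s)\<^sup>2)))"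
          using sum_sqrt_le[of P "\<lambda>R. (Y (\<rho> R) s)\<^sup>2"]
          by (intro real_sqrt_le_mono mult_left_mono) auto
        also have "(\<Sum>R\<in>P. (Y (\<rho> R) s)\<^sup>2) = 3 * N / L\<^sup>2 * square_sum I x P f' s"
        proof -
          have "Y (\<rho> R) s = sqrt (3 * N) / L * Y (f' R) s" for R
            unfolding Y_def f'_def sum_distrib_left using L(1) N(1) by (simp add: field_simps)
          then have "(Y (\<rho> R) s)\<^sup>2 = 3 * N / L\<^sup>2 * (Y (f' R) s)\<^sup>2" for R
            using N(1) by (simp add: power_mult_distrib power_divide)
          then show ?thesis unfolding square_sum_def Y_def by (simp add: sum_distrib_left)
        qed
        also have "sqrt (card P * sqrt (card P * (3 * N / L\<^sup>2 * square_sum I x P f' s))) = N * (sqrt (sqrt 3) / 60 * sqrt (sqrt (square_sum I x P f' s)))"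
        proof -
          have "N * (3 * N / L\<^sup>2 * square_sum I x P f' s) = (N / L)\<^sup>2 * (3 * square_sum I x P f' s)"
            by (simp add: power2_eq_square)
          then have "sqrt (N * (3 * N / L\<^sup>2 * square_sum I x P f' s)) = N / L * (sqrt 3 * sqrt (square_sum I x P f' s))"
            using N(1) L(1) by (simp add: real_sqrt_mult)
          then have "N * sqrt (N * (3 * N / L\<^sup>2 * square_sum I x P f' s)) = N\<^sup>2 * (sqrt 3 * sqrt (square_sum I x P f' s) / L)"
            by (simp add: power2_eq_square)
          then show ?thesis
            unfolding N(2) using N(1) L by (simp add: real_sqrt_mult real_sqrt_divide)
        qed
        also have "\<dots> \<le> N * (7 / 300 * sqrt (sqrt (square_sum I x P f' s)))"
        proof -
          have "sqrt (sqrt 3) \<le> 7 / 5"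
            by (intro real_le_lsqrt) (auto simp: power2_eq_square)
          then show ?thesis using N(1) X0[of P f' s] by (intro mult_left_mono mult_right_mono) auto
        qed
        finally show ?thesis .
      qed
      finally have 1: "sqrt (sqrt (square_sum I x {..<n} f s / 2)) \<le>
          12 * (60 * (1 / N * ?U) + 7 / 300 * sqrt (sqrt (square_sum I x P f' s)))"
        using N(1) by (simp add: field_simps)
      have "sqrt (sqrt 2) \<le> 5 / 4"
        by (intro real_le_lsqrt) (auto simp: power2_eq_square)
      then have "sqrt (sqrt 2) * sqrt (sqrt (square_sum I x {..<n} f s / 2)) \<le> 5 / 4 * sqrt (sqrt (square_sum I x {..<n} f s / 2))"
        using X0[of "{..<n}" f s] by (intro mult_right_mono) auto
      moreover have "sqrt (sqrt 2) * sqrt (sqrt (square_sum I x {..<n} f s / 2)) = sqrt (sqrt (square_sum I x {..<n} f s))"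
        by (simp flip: real_sqrt_mult)
      ultimately show ?thesis using 1 by simp
    qed
    have \<psi>1: "\<bar>\<psi> R i / L\<bar> \<le> 1" for R i
      using abs_clip_le[of L "\<phi> R i"] L(1) by (simp add: \<psi>_def)
    have U_int: "integrable M (\<lambda>s. sqrt \<bar>Y (\<lambda>i. \<psi> R i / L) s\<bar>)" for R
      unfolding Y_def by (rule int[OF \<psi>1])
    have U_le: "(\<integral>s. sqrt \<bar>Y (\<lambda>i. \<psi> R i / L) s\<bar> \<partial>M) \<le> C" for R
      unfolding Y_def by (rule C[OF \<psi>1])
    have "(\<integral>s. sqrt (sqrt (square_sum I x {..<n} f s)) \<partial>M) \<le> (\<integral>s. 15 * (60 * ((1 / N) * (\<Sum>R\<in>P. sqrt \<bar>Y (\<lambda>i. \<psi> R i / L) s\<bar>)) + 7 / 300 * sqrt (sqrt (square_sum I x P f' s))) \<partial>M)"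
      by (intro integral_mono pt X_int f integrable_mult_right Bochner_Integration.integrable_add
          Bochner_Integration.integrable_sum U_int f'1) auto
    also have "\<dots> = 15 * (60 * ((1 / N) * (\<Sum>R\<in>P. \<integral>s. sqrt \<bar>Y (\<lambda>i. \<psi> R i / L) s\<bar> \<partial>M)) + 7 / 300 * (\<integral>s. sqrt (sqrt (square_sum I x P f' s)) \<partial>M))"
      using X_int[of f' P, OF f'1] U_int by simp
    also have "\<dots> \<le> 15 * (60 * ((1 / N) * (\<Sum>R\<in>P. C)) + 7 / 300 * Sup V)"
      using N(1,3) U_le V_upper[of P f', OF _ f'1]
      by (intro mult_left_mono add_mono sum_mono) auto
    also have "\<dots> = 900 * C + 7 / 20 * Sup V" using N(1,2) by simp
    finally have fin: "(\<integral>s. sqrt (sqrt (square_sum I x {..<n} f s)) \<partial>M) \<le> 900 * C + 7 / 20 * Sup V" .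
    have "0 \<le> Sup V"
      using V_upper[of "{} :: nat set" "\<lambda>_ _. 0"] by (simp add: square_sum_def)
    then show ?thesis using fin by linarith
  qed
  have "Sup V \<le> 900 * C + Sup V / 2"
    by (rule cSup_least[OF V_ne]) (use step in \<open>auto simp: V_def\<close>)
  then have SV: "Sup V \<le> 1800 * C" by simp
  show "integrable M (\<lambda>s. sqrt (sqrt (square_sum I x J f s)))"
    by (rule X_int[of f J, OF f])
  show "(\<integral>s. sqrt (sqrt (square_sum I x J f s)) \<partial>M) \<le> 1800 * C"
    using V_upper[of J f, OF J f] SV by linarith
qed

section \<open>A Hahn--Banach theorem\<close>

text \<open>The scalar multiplication is a parameter because Hahn--Banach is applied both to a type
  of class \<open>real_vector\<close> and to real functions with pointwise scaling.\<close>

definition sublinear_on :: "(real \<Rightarrow> 'v::ab_group_add \<Rightarrow> 'v) \<Rightarrow> 'v set \<Rightarrow> ('v \<Rightarrow> real) \<Rightarrow> bool" where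
  "sublinear_on sc S p \<longleftrightarrow> (\<forall>x\<in>S. \<forall>y\<in>S. p (x + y) \<le> p x + p y) \<and>
    (\<forall>c>0. \<forall>x\<in>S. p (sc c x) = c * p x)"

text \<open>\<open>R x t\<close> reads "x can be had at price t". Prices that add and scale with the
  vectors have a sublinear infimum. The shifted functionals, infima of chains, costs of step
  functions and Minkowski functionals are all of this form.\<close>

lemma sublinear_Inf:
  fixes scale :: "real \<Rightarrow> 'v::ab_group_add \<Rightarrow> 'v" (infixr \<open>\<odot>\<close> 75)
    and R :: "'v \<Rightarrow> real \<Rightarrow> bool"
  assumes V: "vector_space scale" "module.subspace scale S"
    and R: "\<forall>x\<in>S. (\<exists>t. R x t) \<and> (\<exists>m. \<forall>t. R x t \<longrightarrow> m \<le> t)"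
      "\<forall>x\<in>S. \<forall>y\<in>S. \<forall>t u. R x t \<longrightarrow> R y u \<longrightarrow> R (x + y) (t + u)"
      "\<forall>c>0. \<forall>x\<in>S. \<forall>t. R x t \<longrightarrow> R (c \<odot> x) (c * t)"
  shows "\<And>x t. x \<in> S \<Longrightarrow> R x t \<Longrightarrow> Inf {t. R x t} \<le> t"
    and "\<And>x m. x \<in> S \<Longrightarrow> (\<And>t. R x t \<Longrightarrow> m \<le> t) \<Longrightarrow> m \<le> Inf {t. R x t}"
    and "sublinear_on scale S (\<lambda>x. Inf {t. R x t})"
proof -
  interpret vector_space scale by (rule V)
  note S = subspace_add[OF V(2)] subspace_scale[OF V(2)]
  let ?p = "\<lambda>x. Inf {t. R x t}"
  show le: "?p x \<le> t" if "x \<in> S" "R x t" for x t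
    using that R(1) by (intro cInf_lower) (auto simp: bdd_below_def)
  show ge: "m \<le> ?p x" if "x \<in> S" "\<And>t. R x t \<Longrightarrow> m \<le> t" for x m
    using that R(1) by (intro cInf_greatest) auto
  have "?p (x + y) \<le> ?p x + ?p y" if xy: "x \<in> S" "y \<in> S" for x y
  proof -
    have "?p (x + y) - t \<le> u" if "R x t" "R y u" for t u
      using le[OF S(1)[OF xy]] R(2) xy that by fastforce
    then have "?p (x + y) - t \<le> ?p y" if "R x t" for t
      using that by (intro ge xy) auto
    then have "?p (x + y) - ?p y \<le> t" if "R x t" for t
      using that by (simp add: algebra_simps)
    then have "?p (x + y) - ?p y \<le> ?p x" by (rule ge[OF xy(1)])
    then show ?thesis by simp
  qed
  moreover have scale_le: "?p (c \<odot> x) \<le> c * ?p x" if c: "0 < c" and x: "x \<in> S" for c x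
  proof -
    have "?p (c \<odot> x) / c \<le> t" if "R x t" for t
      using le[OF S(2)[OF x], of c "c * t"] R(3) c x that by (simp add: field_simps)
    then have "?p (c \<odot> x) / c \<le> ?p x" by (rule ge[OF x])
    then show ?thesis using c by (simp add: field_simps)
  qed
  moreover have "c * ?p x \<le> ?p (c \<odot> x)" if c: "0 < c" and x: "x \<in> S" for c x
    using scale_le[of "1 / c" "c \<odot> x"] c S(2)[OF x] by (simp add: field_simps)
  ultimately show "sublinear_on scale S ?p"
    unfolding sublinear_on_def by (blast intro: antisym)
qed

text \<open>
  A minimal sublinear functional is additive: \<open>sh q b\<close> below is a sublinear functional under \<open>q\<close>
  whose value at \<open>- b\<close> is at most \<open>- q b\<close>, so minimality of \<open>q\<close> forces \<open>q (- b) = - q b\<close>.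
\<close>

lemma hahn_banach_sublinear:
  fixes scale :: "real \<Rightarrow> 'v::ab_group_add \<Rightarrow> 'v" (infixr \<open>\<odot>\<close> 75)
  assumes V: "vector_space scale" "module.subspace scale S"
    and p: "sublinear_on scale S p" and a: "a \<in> S"
  obtains \<phi> :: "'v \<Rightarrow> real" where
    "\<And>x y. x \<in> S \<Longrightarrow> y \<in> S \<Longrightarrow> \<phi> (x + y) = \<phi> x + \<phi> y"
    "\<And>x. x \<in> S \<Longrightarrow> \<phi> x \<le> p x" "\<phi> a = p a"
proof -
  interpret vector_space scale by (rule V)
  note S = subspace_0[OF V(2)] subspace_add[OF V(2)] subspace_scale[OF V(2)]
    and neg = subspace_neg[OF V(2)]
  let ?sublin = "sublinear_on scale S"
  have add: "q (x + y) \<le> q x + q y" if "?sublin q" "x \<in> S" "y \<in> S" for q x y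
    using that by (simp add: sublinear_on_def)
  have hom: "q (c \<odot> x) = c * q x" if "?sublin q" "x \<in> S" "0 < c" for q c x
    using that by (simp add: sublinear_on_def)
  have q0: "q 0 = 0" if "?sublin q" for q
    using hom[OF that S(1), of 2] by simp
  have qneg: "- q (- x) \<le> q x" if "?sublin q" "x \<in> S" for q x
    using add[OF that neg[OF that(2)]] q0[OF that(1)] by simp
  \<comment> \<open>\<open>sh q b x\<close> is the infimum of \<open>q (x + t b) - t * q b\<close>
    over \<open>t \<ge> 0\<close>. Taking \<open>t = 0\<close> shows that it lies below
    \<open>q\<close>, and \<open>t = 1\<close> at \<open>x = - b\<close> gives the value
    \<open>- q b\<close>.\<close>
  define SH where "SH q b x v \<longleftrightarrow> (\<exists>t\<ge>0. q (x + t \<odot> b) - t * q b \<le> v)" for q :: "'v \<Rightarrow> real" and b x v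
  define sh where "sh q b x = (if x \<in> S then Inf {v. SH q b x v} else 0)" for q b x
  have sub_cong: "?sublin q" if "?sublin q'" "\<And>x. x \<in> S \<Longrightarrow> q x = q' x" for q q'
    using that S(2,3) by (simp add: sublinear_on_def)
  have sh: "?sublin (sh q b)" "\<forall>x\<in>S. sh q b x \<le> q x" "sh q b (- b) \<le> - q b"
    if q: "?sublin q" and b: "b \<in> S" for q b
  proof -
    have bdd: "- q (- x) \<le> v" if x: "x \<in> S" and v: "SH q b x v" for x v
    proof -
      obtain t where t: "0 \<le> t" "q (x + t \<odot> b) - t * q b \<le> v" using v by (auto simp: SH_def)
      have "q (t \<odot> b) = t * q b" using t hom[OF q b] q0[OF q] by (cases "t = 0") auto
      then show ?thesis using add[OF q S(2)[OF x S(3)[OF b]] neg[OF x], of t] t by simp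
    qed
    have SH_add: "SH q b (x + y) (v + w)"
      if xy: "x \<in> S" "y \<in> S" and vw: "SH q b x v" "SH q b y w" for x y v w
    proof -
      obtain t u where tu: "0 \<le> t" "0 \<le> u" "q (x + t \<odot> b) - t * q b \<le> v" "q (y + u \<odot> b) - u * q b \<le> w"
        using vw by (auto simp: SH_def)
      have "q ((x + t \<odot> b) + (y + u \<odot> b)) \<le> q (x + t \<odot> b) + q (y + u \<odot> b)"
        using xy b S by (intro add[OF q]) auto
      moreover have "(x + t \<odot> b) + (y + u \<odot> b) = (x + y) + (t + u) \<odot> b"
        by (simp add: scale_left_distrib algebra_simps)
      ultimately show ?thesis
        unfolding SH_def using tu by (intro exI[of _ "t + u"]) (simp add: algebra_simps)
    qed
    have SH_scale: "SH q b (c \<odot> x) (c * v)" if c: "0 < c" "x \<in> S" and v: "SH q b x v" for c x v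
    proof -
      obtain t where t: "0 \<le> t" "q (x + t \<odot> b) - t * q b \<le> v" using v by (auto simp: SH_def)
      have "q (c \<odot> (x + t \<odot> b)) = c * q (x + t \<odot> b)" using c b S by (intro hom[OF q]) auto
      moreover have "c \<odot> (x + t \<odot> b) = c \<odot> x + (c * t) \<odot> b" by (simp add: scale_right_distrib)
      moreover have "c * (q (x + t \<odot> b) - t * q b) \<le> c * v" using t c by (intro mult_left_mono) auto
      ultimately show ?thesis
        unfolding SH_def using t c by (intro exI[of _ "c * t"]) (simp add: algebra_simps)
    qed
    have SH_ex: "SH q b x (q x)" for x unfolding SH_def by (intro exI[of _ 0]) simp
    have "\<forall>x\<in>S. (\<exists>v. SH q b x v) \<and> (\<exists>m. \<forall>v. SH q b x v \<longrightarrow> m \<le> v)" using SH_ex bdd by blast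
    note inf = sublinear_Inf[of scale S "SH q b", OF V this]
    show "?sublin (sh q b)"
      by (rule sub_cong[OF inf(3)]) (auto simp: sh_def intro: SH_add SH_scale)
    show "\<forall>x\<in>S. sh q b x \<le> q x"
      using inf(1)[OF _ _ _ SH_ex] SH_add SH_scale by (auto simp: sh_def)
    have "SH q b (- b) (- q b)" unfolding SH_def using q0[OF q] by (intro exI[of _ 1]) simp
    then show "sh q b (- b) \<le> - q b"
      using inf(1)[of "- b"] SH_add SH_scale neg[OF b] by (auto simp: sh_def)
  qed
  \<comment> \<open>Zorn's lemma is applied below \<open>sh p a\<close> instead of \<open>p\<close>:
    this forces the minimal functional to be at most \<open>- p a\<close> at \<open>- a\<close>,
    hence to attain \<open>p a\<close> at \<open>a\<close>. Fixing the value 0 outside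
    \<open>S\<close> makes the order antisymmetric.\<close>
  define Q where "Q = {q. ?sublin q \<and> (\<forall>x\<in>S. q x \<le> sh p a x) \<and> (\<forall>x. x \<notin> S \<longrightarrow> q x = 0)}"
  have "\<exists>m\<in>Q. \<forall>q\<in>Q. (\<forall>x\<in>S. q x \<le> m x) \<longrightarrow> q = m"
  proof (rule predicate_Zorn[where P = "\<lambda>m q. \<forall>x\<in>S. q x \<le> m x"])
    show "partial_order_on Q (relation_of (\<lambda>m q. \<forall>x\<in>S. q x \<le> m x) Q)"
    proof (rule partial_order_on_relation_ofI)
      fix q r assume "q \<in> Q" "r \<in> Q" "\<forall>x\<in>S. r x \<le> q x" "\<forall>x\<in>S. q x \<le> r x"
      then show "q = r"
        unfolding Q_def by (intro ext) (metis (mono_tags, lifting) mem_Collect_eq order_antisym)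
    qed (auto intro: order_trans)
  next
    fix C assume C: "C \<in> Chains (relation_of (\<lambda>m q. \<forall>x\<in>S. q x \<le> m x) Q)"
    have CQ: "C \<subseteq> Q" and comp: "\<And>q r. q \<in> C \<Longrightarrow> r \<in> C \<Longrightarrow> (\<forall>x\<in>S. r x \<le> q x) \<or> (\<forall>x\<in>S. q x \<le> r x)"
      using C by (auto simp: Chains_def relation_of_def)
    have CQ': "?sublin q" "\<And>x. x \<in> S \<Longrightarrow> q x \<le> sh p a x" if "q \<in> C" for q
      using that CQ by (auto simp: Q_def)
    show "\<exists>u\<in>Q. \<forall>q\<in>C. \<forall>x\<in>S. u x \<le> q x"
    proof (cases "C = {}")
      case True
      have "sh p a \<in> Q" using sh(1)[OF p a] by (auto simp: Q_def sh_def)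
      then show ?thesis using True by auto
    next
      case False
      \<comment> \<open>The pointwise infimum of the chain. It is subadditive because two members of
        a chain are comparable, so one of them serves both summands.\<close>
      define R where "R x v \<longleftrightarrow> (\<exists>q\<in>C. q x \<le> v)" for x v
      define u where "u x = (if x \<in> S then Inf {v. R x v} else 0)" for x
      have bdd: "- sh p a (- x) \<le> v" if "x \<in> S" "R x v" for x v
        using that qneg[OF CQ'(1), of _ x] CQ'(2)[OF _ neg[OF that(1)]] by (fastforce simp: R_def)
      have R_add: "R (x + y) (v + w)" if xy: "x \<in> S" "y \<in> S" and vw: "R x v" "R y w" for x y v w
      proof -
        obtain t where "t \<in> C" "t x \<le> v" "t y \<le> w"
          using comp vw xy unfolding R_def by (meson order_trans)
        then show ?thesis
          using add[OF CQ'(1) xy, of t] unfolding R_def by (meson add_mono order_trans)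
      qed
      have R_scale: "R (c \<odot> x) (c * v)" if cx: "0 < c" "x \<in> S" and v: "R x v" for c x v
      proof -
        obtain q where "q \<in> C" "q x \<le> v" using v by (auto simp: R_def)
        then show ?thesis
          using hom[OF CQ'(1) cx(2,1), of q] cx(1) unfolding R_def by (intro bexI[of _ q]) auto
      qed
      have "\<forall>x\<in>S. (\<exists>v. R x v) \<and> (\<exists>m. \<forall>v. R x v \<longrightarrow> m \<le> v)"
        using False bdd unfolding R_def by blast
      note inf = sublinear_Inf[of scale S R, OF V this]
      have le: "u x \<le> q x" if "x \<in> S" "q \<in> C" for x q
      proof -
        have "R x (q x)" using that(2) by (auto simp: R_def)
        then show ?thesis using inf(1)[OF _ _ that(1)] R_add R_scale that(1) by (auto simp: u_def)
      qed
      have "?sublin u" by (rule sub_cong[OF inf(3)]) (auto simp: u_def intro: R_add R_scale)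
      moreover have "\<forall>x\<in>S. u x \<le> sh p a x" using False le CQ'(2) by (meson equals0I order_trans)
      ultimately have "u \<in> Q" by (auto simp: Q_def u_def)
      then show ?thesis using le by auto
    qed
  qed
  then obtain m where m: "m \<in> Q" "\<And>q. q \<in> Q \<Longrightarrow> (\<forall>x\<in>S. q x \<le> m x) \<Longrightarrow> q = m"
    by auto
  have ms: "?sublin m" and mp: "\<And>x. x \<in> S \<Longrightarrow> m x \<le> sh p a x" using m(1) by (auto simp: Q_def)
  have mneg: "m (- b) \<le> - m b" if b: "b \<in> S" for b
  proof -
    have "sh m b \<in> Q"
      using sh(1,2)[OF ms b] mp by (fastforce simp: Q_def sh_def)
    then have "sh m b = m" using m(2) sh(2)[OF ms b] by auto
    then show ?thesis using sh(3)[OF ms b] by simp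
  qed
  show thesis
  proof
    fix x y assume xy: "x \<in> S" "y \<in> S"
    have "m ((x + y) + (- y)) \<le> m (x + y) + m (- y)"
      using xy S neg by (intro add[OF ms]) auto
    then have "m x \<le> m (x + y) - m y" using mneg[OF xy(2)] by simp
    moreover have "m (x + y) \<le> m x + m y" by (rule add[OF ms xy])
    ultimately show "m (x + y) = m x + m y" by simp
  next
    show le: "m x \<le> p x" if "x \<in> S" for x
      using mp[OF that] sh(2)[OF p a] that by fastforce
    have "- m a \<le> m (- a)" using qneg[OF ms neg[OF a]] by simp
    also have "\<dots> \<le> - p a" using mp[OF neg[OF a]] sh(3)[OF p a] by simp
    finally show "m a = p a" using le[OF a] by simp
  qed
qed

section \<open>Measures dominated by a gauge\<close>

text \<open>Lists record a representation and not only the function: the cost depends on the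
  representation, and the sets may overlap or repeat.\<close>

definition step_fun :: "(real \<times> 'e set) list \<Rightarrow> 'e \<Rightarrow> real" where
  "step_fun l e = (\<Sum>(c, B)\<leftarrow>l. c * indicator B e)"

definition step_cost :: "('e set \<Rightarrow> real) \<Rightarrow> (real \<times> 'e set) list \<Rightarrow> real" where
  "step_cost \<Psi> l = (\<Sum>(c, B)\<leftarrow>l. \<bar>c\<bar> * \<Psi> B)"

definition step_scale :: "real \<Rightarrow> (real \<times> 'e set) list \<Rightarrow> (real \<times> 'e set) list" where
  "step_scale c l = map (\<lambda>(d, B). (c * d, B)) l"

lemma step_fun_append: "step_fun (l @ l') e = step_fun l e + step_fun l' e"
  by (simp add: step_fun_def)

lemma step_cost_append: "step_cost \<Psi> (l @ l') = step_cost \<Psi> l + step_cost \<Psi> l'"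
  by (simp add: step_cost_def)

lemma step_fun_scale: "step_fun (step_scale c l) e = c * step_fun l e"
  by (induction l) (auto simp: step_fun_def step_scale_def algebra_simps)

lemma step_cost_scale: "step_cost \<Psi> (step_scale c l) = \<bar>c\<bar> * step_cost \<Psi> l"
  by (induction l) (auto simp: step_cost_def step_scale_def algebra_simps abs_mult)

lemma snd_step_scale [simp]: "snd ` set (step_scale c l) = snd ` set l"
  by (force simp: step_scale_def image_iff)

lemma step_cost_nonneg:
  "(\<And>B. B \<in> snd ` set l \<Longrightarrow> 0 \<le> \<Psi> B) \<Longrightarrow> 0 \<le> step_cost \<Psi> l"
  by (induction l) (auto simp: step_cost_def)

text \<open>Hahn--Banach for the sublinear functional that sends a step function to the infimum of
  the costs of its representations. It is at most \<open>\<Psi> B\<close> at the indicator of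
  \<open>B\<close>, and \<open>low\<close> says that it is at least \<open>a\<close> at the
  indicator of \<open>A\<close>, where the linear functional attains it.\<close>

lemma ex_additive_le_gauge:
  fixes \<Psi> :: "'e set \<Rightarrow> real"
  assumes nonneg: "\<And>B. B \<in> \<E> \<Longrightarrow> 0 \<le> \<Psi> B" and A: "A \<in> \<E>"
    and low: "\<And>l. snd ` set l \<subseteq> \<E> \<Longrightarrow> step_fun l = indicator A \<Longrightarrow> a \<le> step_cost \<Psi> l"
  obtains \<nu> :: "'e set \<Rightarrow> real" where
    "\<And>B C. B \<in> \<E> \<Longrightarrow> C \<in> \<E> \<Longrightarrow> B \<union> C \<in> \<E> \<Longrightarrow> B \<inter> C = {} \<Longrightarrow> \<nu> (B \<union> C) = \<nu> B + \<nu> C"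
    "\<And>B. B \<in> \<E> \<Longrightarrow> \<nu> B \<le> \<Psi> B" "a \<le> \<nu> A"
proof -
  define rep where "rep f l \<longleftrightarrow> snd ` set l \<subseteq> \<E> \<and> step_fun l = f" for f l
  define S where "S = {f. \<exists>l. rep f l}"
  define R where "R f t \<longleftrightarrow> (\<exists>l. rep f l \<and> t = step_cost \<Psi> l)" for f t
  define sc where "sc = (\<lambda>(c::real) f (e::'e). c * (f e :: real))"
  have V: "vector_space sc"
    unfolding sc_def by unfold_locales (auto simp: algebra_simps fun_eq_iff)
  interpret V: vector_space sc by (rule V)
  have rep_add: "rep (f + g) (l @ l')" if "rep f l" "rep g l'" for f g l l'
    using that unfolding rep_def by (simp only: set_append image_Un Un_subset_iff) (auto simp: step_fun_append)
  have rep_scale: "rep (sc c f) (step_scale c l)" if "rep f l" for c f l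
    using that unfolding rep_def snd_step_scale by (auto simp: step_fun_scale sc_def)
  have rep1: "rep (indicator B) [(1, B)]" if "B \<in> \<E>" for B
    using that by (auto simp: rep_def step_fun_def)
  have "rep 0 []" by (auto simp: rep_def step_fun_def)
  then have S: "V.subspace S"
    unfolding V.subspace_def S_def using rep_add rep_scale by blast
  have R: "\<forall>f\<in>S. (\<exists>t. R f t) \<and> (\<exists>m. \<forall>t. R f t \<longrightarrow> m \<le> t)"
    "\<forall>f\<in>S. \<forall>g\<in>S. \<forall>t u. R f t \<longrightarrow> R g u \<longrightarrow> R (f + g) (t + u)"
    "\<forall>c>0. \<forall>f\<in>S. \<forall>t. R f t \<longrightarrow> R (sc c f) (c * t)"
  proof -
    have "0 \<le> step_cost \<Psi> l" if "rep f l" for f l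
      using that nonneg unfolding rep_def by (intro step_cost_nonneg) blast
    then show "\<forall>f\<in>S. (\<exists>t. R f t) \<and> (\<exists>m. \<forall>t. R f t \<longrightarrow> m \<le> t)"
      unfolding S_def R_def by blast
    show "\<forall>f\<in>S. \<forall>g\<in>S. \<forall>t u. R f t \<longrightarrow> R g u \<longrightarrow> R (f + g) (t + u)"
      unfolding R_def using rep_add step_cost_append by metis
    have "c * step_cost \<Psi> l = step_cost \<Psi> (step_scale c l)" if "0 < c" for c l
      using that by (simp add: step_cost_scale)
    then show "\<forall>c>0. \<forall>f\<in>S. \<forall>t. R f t \<longrightarrow> R (sc c f) (c * t)"
      unfolding R_def using rep_scale by metis
  qed
  note p = sublinear_Inf[OF V S R]
  have inS: "indicator B \<in> S" if "B \<in> \<E>" for B using rep1[OF that] by (auto simp: S_def)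
  obtain \<phi> where \<phi>: "\<And>f g. f \<in> S \<Longrightarrow> g \<in> S \<Longrightarrow> \<phi> (f + g) = \<phi> f + \<phi> g"
    "\<And>f. f \<in> S \<Longrightarrow> \<phi> f \<le> Inf {t. R f t}" "\<phi> (indicator A) = Inf {t. R (indicator A) t}"
    using hahn_banach_sublinear[OF V S p(3) inS[OF A]] by blast
  show thesis
  proof
    fix B C assume *: "B \<in> \<E>" "C \<in> \<E>" "B \<union> C \<in> \<E>" "B \<inter> C = {}"
    then have "(indicator (B \<union> C) :: 'e \<Rightarrow> real) = indicator B + indicator C"
      by (auto simp: fun_eq_iff indicator_def)
    then show "\<phi> (indicator (B \<union> C)) = \<phi> (indicator B) + \<phi> (indicator C)"
      using \<phi>(1) inS * by simp
  next
    fix B assume B: "B \<in> \<E>"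
    have "\<Psi> B = step_cost \<Psi> [(1, B)]" by (simp add: step_cost_def)
    then have "R (indicator B) (\<Psi> B)" using rep1[OF B] unfolding R_def by blast
    then show "\<phi> (indicator B) \<le> \<Psi> B"
      using \<phi>(2) p(1) inS[OF B] by (meson order_trans)
  next
    show "a \<le> \<phi> (indicator A)"
      unfolding \<phi>(3) using low by (intro p(2)[OF inS[OF A]]) (auto simp: R_def rep_def)
  qed
qed

text \<open>The additive function from Hahn--Banach may take negative values, so it is replaced by
  its supremum over subsets, the positive variation. This stays below \<open>\<Psi>\<close> by
  monotonicity, and continuity of \<open>\<Psi>\<close> at the empty set then yields countable
  additivity.\<close>

lemma ex_measure_le_gauge:
  fixes \<Psi> :: "'e set \<Rightarrow> real"
  assumes sa: "sigma_algebra \<Omega> \<E>"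
    and nonneg: "\<And>B. B \<in> \<E> \<Longrightarrow> 0 \<le> \<Psi> B"
    and mono: "\<And>B C. B \<in> \<E> \<Longrightarrow> C \<in> \<E> \<Longrightarrow> B \<subseteq> C \<Longrightarrow> \<Psi> B \<le> \<Psi> C"
    and cont: "\<And>B. range B \<subseteq> \<E> \<Longrightarrow> decseq B \<Longrightarrow> (\<Inter>i. B i) = {} \<Longrightarrow> (\<lambda>i::nat. \<Psi> (B i)) \<longlonglongrightarrow> 0"
    and A: "A \<in> \<E>" and a: "0 < a"
    and low: "\<And>l. snd ` set l \<subseteq> \<E> \<Longrightarrow> step_fun l = indicator A \<Longrightarrow> a \<le> step_cost \<Psi> l"
  obtains \<nu> where "finite_measure \<nu>" "space \<nu> = \<Omega>" "sets \<nu> = \<E>" "0 < measure \<nu> A"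
    "\<And>B. B \<in> \<E> \<Longrightarrow> measure \<nu> B \<le> \<Psi> B"
proof -
  interpret sigma_algebra \<Omega> \<E> by (rule sa)
  obtain \<nu>0 where \<nu>0: "\<And>B C. B \<in> \<E> \<Longrightarrow> C \<in> \<E> \<Longrightarrow> B \<union> C \<in> \<E> \<Longrightarrow> B \<inter> C = {} \<Longrightarrow> \<nu>0 (B \<union> C) = \<nu>0 B + \<nu>0 C"
    "\<And>B. B \<in> \<E> \<Longrightarrow> \<nu>0 B \<le> \<Psi> B" "a \<le> \<nu>0 A"
    using ex_additive_le_gauge[OF nonneg A low] by blast
  have e: "\<nu>0 {} = 0" using \<nu>0(1)[of "{}" "{}"] by simp
  define \<mu> where "\<mu> B = (SUP C\<in>{C\<in>\<E>. C \<subseteq> B}. \<nu>0 C)" for B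
  have bdd: "bdd_above (\<nu>0 ` {C\<in>\<E>. C \<subseteq> B})" if "B \<in> \<E>" for B
    using \<nu>0(2) mono that by (intro bdd_aboveI2[where M = "\<Psi> B"]) (auto intro: order_trans)
  have upper: "\<nu>0 C \<le> \<mu> B" if "B \<in> \<E>" "C \<in> \<E>" "C \<subseteq> B" for B C
    unfolding \<mu>_def using that bdd[OF that(1)] by (intro cSUP_upper) auto
  have least: "\<mu> B \<le> b" if "B \<in> \<E>" "\<And>C. C \<in> \<E> \<Longrightarrow> C \<subseteq> B \<Longrightarrow> \<nu>0 C \<le> b" for B b
    unfolding \<mu>_def using that by (intro cSUP_least) auto
  have \<mu>_nonneg: "0 \<le> \<mu> B" if "B \<in> \<E>" for B using upper[of B "{}"] that e by simp
  have \<mu>_le: "\<mu> B \<le> \<Psi> B" if "B \<in> \<E>" for B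
    using that \<nu>0(2) mono by (intro least) (auto intro: order_trans)
  have \<mu>_add: "\<mu> (B \<union> C) = \<mu> B + \<mu> C" if BC: "B \<in> \<E>" "C \<in> \<E>" "B \<inter> C = {}" for B C
  proof (rule antisym)
    show "\<mu> (B \<union> C) \<le> \<mu> B + \<mu> C"
    proof (rule least)
      fix D assume D: "D \<in> \<E>" "D \<subseteq> B \<union> C"
      have "\<nu>0 ((D \<inter> B) \<union> (D \<inter> C)) = \<nu>0 (D \<inter> B) + \<nu>0 (D \<inter> C)"
        using D BC by (intro \<nu>0(1)) auto
      moreover have "(D \<inter> B) \<union> (D \<inter> C) = D" using D by auto
      moreover have "\<nu>0 (D \<inter> B) \<le> \<mu> B" "\<nu>0 (D \<inter> C) \<le> \<mu> C" using D BC by (auto intro!: upper)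
      ultimately show "\<nu>0 D \<le> \<mu> B + \<mu> C" by simp
    qed (use BC in auto)
    have "\<nu>0 B' \<le> \<mu> (B \<union> C) - \<nu>0 C'" if "B' \<in> \<E>" "B' \<subseteq> B" "C' \<in> \<E>" "C' \<subseteq> C" for B' C'
    proof -
      have "\<nu>0 (B' \<union> C') = \<nu>0 B' + \<nu>0 C'" using that BC by (intro \<nu>0(1)) auto
      moreover have "\<nu>0 (B' \<union> C') \<le> \<mu> (B \<union> C)" using that BC by (intro upper) auto
      ultimately show ?thesis by simp
    qed
    then have "\<mu> B \<le> \<mu> (B \<union> C) - \<nu>0 C'" if "C' \<in> \<E>" "C' \<subseteq> C" for C'
      using that BC by (intro least) auto
    then have "\<nu>0 C' \<le> \<mu> (B \<union> C) - \<mu> B" if "C' \<in> \<E>" "C' \<subseteq> C" for C'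
      using that by (fastforce simp: algebra_simps)
    then have "\<mu> C \<le> \<mu> (B \<union> C) - \<mu> B" using BC by (intro least) auto
    then show "\<mu> B + \<mu> C \<le> \<mu> (B \<union> C)" by simp
  qed
  define \<nu> where "\<nu> = measure_of \<Omega> \<E> (\<lambda>B. ennreal (\<mu> B))"
  have \<mu>0: "\<mu> {} = 0" using \<mu>_add[of "{}" "{}"] by simp
  have sets: "sets \<nu> = \<E>" and space: "space \<nu> = \<Omega>"
    unfolding \<nu>_def using space_closed by (auto simp: sets_measure_of_eq)
  have pos: "positive \<E> (\<lambda>B. ennreal (\<mu> B))" using \<mu>0 by (simp add: positive_def)
  have "countably_additive \<E> (\<lambda>B. ennreal (\<mu> B))"
  proof (rule empty_continuous_imp_countably_additive[OF pos])
    show "additive \<E> (\<lambda>B. ennreal (\<mu> B))"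
      by (auto simp: additive_def \<mu>_add \<mu>_nonneg ennreal_plus[symmetric] simp del: ennreal_plus)
    fix B :: "nat \<Rightarrow> 'e set" assume B: "range B \<subseteq> \<E>" "decseq B" "(\<Inter>i. B i) = {}"
    have "(\<lambda>i. \<mu> (B i)) \<longlonglongrightarrow> 0"
      by (rule tendsto_sandwich[OF _ _ tendsto_const cont[OF B]]) (use B(1) \<mu>_nonneg \<mu>_le in \<open>auto intro!: always_eventually simp: image_subset_iff\<close>)
    then show "(\<lambda>i. ennreal (\<mu> (B i))) \<longlonglongrightarrow> 0"
      using tendsto_ennrealI[of "\<lambda>i. \<mu> (B i)" 0] by simp
  qed simp
  then have em: "emeasure \<nu> B = ennreal (\<mu> B)" if "B \<in> \<E>" for B
    using emeasure_measure_of[OF \<nu>_def space_closed, of B] pos that by (simp add: sets)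
  have me: "measure \<nu> B = \<mu> B" if "B \<in> \<E>" for B
    using em[OF that] \<mu>_nonneg[OF that] by (simp add: measure_def)
  show thesis
  proof
    show "finite_measure \<nu>" by (intro finite_measureI) (simp add: em space)
    show "space \<nu> = \<Omega>" "sets \<nu> = \<E>" by fact+
    show "0 < measure \<nu> A" using me[OF A] upper[of A A] A \<nu>0(3) a by simp
    show "measure \<nu> B \<le> \<Psi> B" if "B \<in> \<E>" for B using me[OF that] \<mu>_le[OF that] by simp
  qed
qed

section \<open>Real-valued measures into the space of measurable functions\<close>

text \<open>An F-norm for convergence in measure. Being an integral, it is linked to the measures of
  level sets by Markov's inequality.\<close>

definition rho :: "'s measure \<Rightarrow> ('s \<Rightarrow> real) \<Rightarrow> real" where
  "rho M y = (\<integral>s. min 1 \<bar>y s\<bar> \<partial>M)"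

context finite_measure
begin

lemma integrable_min_abs [intro]:
  fixes y :: "'a \<Rightarrow> real"
  shows "y \<in> borel_measurable M \<Longrightarrow> integrable M (\<lambda>s. min 1 \<bar>y s\<bar>)"
  by (rule integrable_const_bound[where B = 1]) auto

lemma rho_nonneg [simp]: "0 \<le> rho M y"
  unfolding rho_def by (rule integral_nonneg_AE) auto

lemma rho_le_measure: "y \<in> borel_measurable M \<Longrightarrow> rho M y \<le> measure M (space M)"
  using integral_mono[of M "\<lambda>s. min 1 \<bar>y s\<bar>" "\<lambda>_. 1"] unfolding rho_def by auto

lemma rho_triangle:
  assumes [measurable]: "y \<in> borel_measurable M" "z \<in> borel_measurable M"
  shows "rho M (\<lambda>s. y s + z s) \<le> rho M y + rho M z"
proof -
  have "rho M (\<lambda>s. y s + z s) \<le> (\<integral>s. min 1 \<bar>y s\<bar> + min 1 \<bar>z s\<bar> \<partial>M)"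
    unfolding rho_def by (intro integral_mono Bochner_Integration.integrable_add integrable_min_abs) auto
  also have "\<dots> = rho M y + rho M z"
    unfolding rho_def by (intro Bochner_Integration.integral_add integrable_min_abs) auto
  finally show ?thesis .
qed

lemma rho_uminus: "rho M (\<lambda>s. - y s) = rho M y"
  by (simp add: rho_def)

lemma rho_triangle_diff:
  assumes [measurable]: "y \<in> borel_measurable M" "z \<in> borel_measurable M"
  shows "rho M (\<lambda>s. y s - z s) \<le> rho M y + rho M z"
  using rho_triangle[of y "\<lambda>s. - z s"] by (simp add: rho_uminus)

lemma rho_cong_AE:
  assumes "y \<in> borel_measurable M" "z \<in> borel_measurable M" "AE s in M. y s = z s"
  shows "rho M y = rho M z"
  unfolding rho_def using assms by (intro integral_cong_AE) auto

lemma rho_eq_0_imp_AE: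
  assumes "y \<in> borel_measurable M" "rho M y = 0"
  shows "AE s in M. y s = 0"
proof -
  have "AE s in M. min 1 \<bar>y s\<bar> = 0"
    using assms integral_nonneg_eq_0_iff_AE[OF integrable_min_abs[of y]] unfolding rho_def by auto
  then show ?thesis by eventually_elim (auto simp: min_def split: if_splits)
qed

lemma measure_ge_le_rho:
  assumes [measurable]: "y \<in> borel_measurable M"
  shows "min 1 t * measure M {s\<in>space M. t \<le> \<bar>y s\<bar>} \<le> rho M y"
proof -
  have "min 1 t * measure M {s\<in>space M. t \<le> \<bar>y s\<bar>} = (\<integral>s. min 1 t * indicator {s\<in>space M. t \<le> \<bar>y s\<bar>} s \<partial>M)"
    by simp
  also have "\<dots> \<le> rho M y"
    unfolding rho_def
    by (intro integral_mono integrable_mult_right integrable_real_indicator integrable_min_abs)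
       (auto simp: indicator_def emeasure_eq_measure)
  finally show ?thesis .
qed

end

text \<open>\<open>X B\<close> is a chosen measurable representative, so additivity holds only
  almost everywhere, with an exceptional null set that depends on the sets involved.\<close>

locale real_L0_measure = finite_measure M + dom: sigma_algebra \<Omega> \<E>
  for M :: "'s measure" and \<Omega> :: "'e set" and \<E> +
  fixes X :: "'e set \<Rightarrow> 's \<Rightarrow> real"
  assumes X_meas [measurable]: "\<And>B. B \<in> \<E> \<Longrightarrow> X B \<in> borel_measurable M"
    and X_sums: "\<And>A :: nat \<Rightarrow> 'e set. range A \<subseteq> \<E> \<Longrightarrow> disjoint_family A \<Longrightarrow>
      (\<lambda>n. rho M (\<lambda>s. (\<Sum>i<n. X (A i) s) - X (\<Union>i. A i) s)) \<longlonglongrightarrow> 0"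
begin

text \<open>\<open>X (A n)\<close> is the difference of two consecutive errors of the partial
  sums.\<close>

lemma X_disjoint_tendsto_0:
  fixes A :: "nat \<Rightarrow> 'e set"
  assumes A: "range A \<subseteq> \<E>" "disjoint_family A"
  shows "(\<lambda>n. rho M (X (A n))) \<longlonglongrightarrow> 0"
proof -
  have [measurable]: "X (A i) \<in> borel_measurable M" "X (\<Union>i. A i) \<in> borel_measurable M" for i
    using A(1) by (auto intro!: X_meas dom.countable_UN)
  let ?d = "\<lambda>n. rho M (\<lambda>s. (\<Sum>i<n. X (A i) s) - X (\<Union>i. A i) s)"
  have lim: "(\<lambda>n. ?d (Suc n) + ?d n) \<longlonglongrightarrow> 0"
    using tendsto_add[OF LIMSEQ_Suc[OF X_sums[OF A]] X_sums[OF A]] by simp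
  have "rho M (X (A n)) \<le> ?d (Suc n) + ?d n" for n
    using rho_triangle_diff[of "\<lambda>s. (\<Sum>i<Suc n. X (A i) s) - X (\<Union>i. A i) s" "\<lambda>s. (\<Sum>i<n. X (A i) s) - X (\<Union>i. A i) s"]
    by simp
  then show ?thesis
    by (intro metric_tendsto_imp_tendsto[OF lim] always_eventually) (auto simp: dist_real_def intro: order_trans[OF _ abs_ge_self])
qed

lemma X_empty: "AE s in M. X {} s = 0"
proof -
  have "(\<lambda>n::nat. rho M (X {})) \<longlonglongrightarrow> 0"
    using X_disjoint_tendsto_0[of "\<lambda>_. {}"] by (auto simp: disjoint_family_on_def)
  then have "rho M (X {}) = 0" by (simp add: LIMSEQ_const_iff)
  then show ?thesis by (intro rho_eq_0_imp_AE) auto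
qed

lemma X_Un:
  assumes "A \<in> \<E>" "B \<in> \<E>" "A \<inter> B = {}"
  shows "AE s in M. X (A \<union> B) s = X A s + X B s"
proof -
  define C :: "nat \<Rightarrow> 'e set" where "C i = (if i = 0 then A else if i = 1 then B else {})" for i
  have C: "C i \<in> \<E>" "disjoint_family C" "(\<Union>i. C i) = A \<union> B" for i
    using assms by (auto simp: C_def disjoint_family_on_def split: if_splits)
  have AB: "A \<union> B \<in> \<E>" using assms by auto
  note [measurable] = X_meas[OF assms(1)] X_meas[OF assms(2)] X_meas[OF AB] X_meas[OF C(1)]
  let ?r = "rho M (\<lambda>s. (X A s + X B s) - X (A \<union> B) s)"
  \<comment> \<open>From index 2 on the partial sums contain both \<open>A\<close> and
    \<open>B\<close>, and all further terms vanish almost everywhere.\<close>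
  have "rho M (\<lambda>s. (\<Sum>i<n + 2. X (C i) s) - X (A \<union> B) s) = ?r" for n
  proof (rule rho_cong_AE)
    show "AE s in M. (\<Sum>i<n + 2. X (C i) s) - X (A \<union> B) s = (X A s + X B s) - X (A \<union> B) s"
      using X_empty
    proof eventually_elim
      case (elim s)
      have "(\<Sum>i<n + 2. X (C i) s) = X A s + X B s"
        by (induction n) (auto simp: elim numeral_2_eq_2 C_def)
      then show ?case by simp
    qed
  qed measurable
  then have "(\<lambda>n::nat. ?r) \<longlonglongrightarrow> 0"
    using LIMSEQ_ignore_initial_segment[OF X_sums[OF _ C(2)], of 2] C(1) unfolding C(3) by (simp add: image_subset_iff)
  then have "?r = 0" by (simp add: LIMSEQ_const_iff)
  then have "AE s in M. (X A s + X B s) - X (A \<union> B) s = 0"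
    by (intro rho_eq_0_imp_AE) measurable
  then show ?thesis by eventually_elim simp
qed

lemma X_finite_Union:
  assumes "finite I" "disjoint_family_on A I" "\<And>i. i \<in> I \<Longrightarrow> A i \<in> \<E>"
  shows "AE s in M. X (\<Union>i\<in>I. A i) s = (\<Sum>i\<in>I. X (A i) s)"
  using assms
proof (induction I)
  case empty
  then show ?case using X_empty by simp
next
  case (insert i I)
  have IH: "AE s in M. X (\<Union>i\<in>I. A i) s = (\<Sum>i\<in>I. X (A i) s)"
    by (rule insert.IH[OF disjoint_family_on_mono[OF subset_insertI insert.prems(1)] insert.prems(2)]) simp
  have dj: "A i \<inter> (\<Union>i\<in>I. A i) = {}"
    using insert.prems(1) insert.hyps(2) by (auto simp: disjoint_family_on_def)
  have "AE s in M. X (A i \<union> (\<Union>i\<in>I. A i)) s = X (A i) s + X (\<Union>i\<in>I. A i) s"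
    by (rule X_Un[OF _ _ dj]) (use insert.prems(2) insert.hyps(1) in \<open>auto intro!: dom.finite_UN\<close>)
  with IH show ?case
    unfolding UN_insert sum.insert[OF insert.hyps] by eventually_elim simp
qed

lemma X_decseq_tendsto_0:
  assumes B: "range B \<subseteq> \<E>" "decseq B" "(\<Inter>i. B i) = {}"
  shows "(\<lambda>n::nat. rho M (X (B n))) \<longlonglongrightarrow> 0"
proof -
  define A where "A i = B i - B (Suc i)" for i
  have BE: "B i \<in> \<E>" for i using B(1) by (rule range_subsetD)
  have AE: "A i \<in> \<E>" for i unfolding A_def by (intro dom.Diff BE)
  have mono: "B j \<subseteq> B i" if "i \<le> j" for i j using B(2) that by (rule decseqD)
  have dA: "disjoint_family A"
    unfolding disjoint_family_on_def
  proof (intro ballI impI)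
    fix m n :: nat assume "m \<noteq> n"
    then show "A m \<inter> A n = {}"
      using mono[of "Suc m" n] mono[of "Suc n" m] by (cases "m < n") (auto simp: A_def not_less)
  qed
  have U: "(\<Union>i<n. A i) \<union> B n = B 0" for n
  proof (induction n)
    case (Suc n)
    then show ?case using mono[of n "Suc n"] by (auto simp: A_def lessThan_Suc)
  qed simp
  have disj: "(\<Union>i<n. A i) \<inter> B n = {}" for n
  proof -
    have "A i \<inter> B n = {}" if "i < n" for i
      using mono[of "Suc i" n] that by (auto simp: A_def)
    then show ?thesis by blast
  qed
  have UA: "(\<Union>i. A i) = B 0"
  proof
    show "(\<Union>i. A i) \<subseteq> B 0" using mono[of 0] by (auto simp: A_def)
    show "B 0 \<subseteq> (\<Union>i. A i)"
    proof
      fix e assume e: "e \<in> B 0"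
      obtain n where "e \<notin> B n" using B(3) by auto
      then show "e \<in> (\<Union>i. A i)" using U[of n] e by auto
    qed
  qed
  have [measurable]: "X (A i) \<in> borel_measurable M" "X (B i) \<in> borel_measurable M" for i
    by (intro X_meas AE BE)+
  have "rho M (\<lambda>s. (\<Sum>i<n. X (A i) s) - X (B 0) s) = rho M (X (B n))" for n
  proof -
    have 1: "AE s in M. X (\<Union>i<n. A i) s = (\<Sum>i<n. X (A i) s)"
      by (rule X_finite_Union) (use dA AE in \<open>auto simp: disjoint_family_on_def\<close>)
    have 2: "AE s in M. X (B 0) s = X (\<Union>i<n. A i) s + X (B n) s"
      using X_Un[OF _ BE disj, of n] U[of n] AE by auto
    have "AE s in M. (\<Sum>i<n. X (A i) s) - X (B 0) s = - X (B n) s"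
      using 1 2 by eventually_elim simp
    then have "rho M (\<lambda>s. (\<Sum>i<n. X (A i) s) - X (B 0) s) = rho M (\<lambda>s. - X (B n) s)"
      by (intro rho_cong_AE) auto
    then show ?thesis by (simp add: rho_uminus)
  qed
  then show ?thesis using X_sums[of A] AE dA UA by (auto simp: image_subset_iff)
qed

text \<open>A semivariation of \<open>X\<close>: the supremum over subsets makes it monotone, which
  \<open>rho M (X B)\<close> itself need not be.\<close>

definition eta :: "'e set \<Rightarrow> real" where
  "eta B = (SUP C\<in>{C\<in>\<E>. C \<subseteq> B}. rho M (X C))"

lemma rho_le_eta:
  assumes "C \<in> \<E>" "C \<subseteq> B"
  shows "rho M (X C) \<le> eta B"
  unfolding eta_def
  by (rule cSUP_upper) (use assms in \<open>auto intro!: bdd_aboveI2[where M = "measure M (space M)"] rho_le_measure\<close>)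

lemma eta_le:
  assumes "\<And>C. C \<in> \<E> \<Longrightarrow> C \<subseteq> B \<Longrightarrow> rho M (X C) \<le> b"
  shows "eta B \<le> b"
  unfolding eta_def by (rule cSUP_least) (use assms in auto)

lemma eta_nonneg: "0 \<le> eta B"
  by (rule order_trans[OF rho_nonneg rho_le_eta[of "{}"]]) auto

lemma eta_mono: "B \<subseteq> C \<Longrightarrow> eta B \<le> eta C"
  by (intro eta_le rho_le_eta) auto

text \<open>A gliding hump. If \<open>eta (B n)\<close> stays above \<open>e\<close>, some
  \<open>C\<close> inside \<open>B n\<close> has size above \<open>e / 2\<close>; cutting off a tail
  \<open>C \<inter> B k\<close> of size below \<open>e / 4\<close> leaves more than
  \<open>e / 4\<close> in \<open>B n - B k\<close>. Iterating gives disjoint sets on which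
  \<open>X\<close> does not tend to 0.\<close>

lemma eta_decseq_tendsto_0:
  assumes B: "range B \<subseteq> \<E>" "decseq B" "(\<Inter>i. B i) = {}"
  shows "(\<lambda>n::nat. eta (B n)) \<longlonglongrightarrow> 0"
proof -
  have BE: "B i \<in> \<E>" for i using B(1) by (rule range_subsetD)
  have mono: "B j \<subseteq> B i" if "i \<le> j" for i j using B(2) that by (rule decseqD)
  have "\<exists>n. eta (B n) < e" if e: "0 < e" for e
  proof (rule ccontr)
    assume "\<not> (\<exists>n. eta (B n) < e)"
    then have big: "e \<le> eta (B n)" for n by (auto simp: not_less)
    have ex: "\<exists>k D. n < k \<and> D \<in> \<E> \<and> D \<subseteq> B n - B k \<and> e / 4 < rho M (X D)" for n
    proof -
      have "\<exists>C\<in>\<E>. C \<subseteq> B n \<and> e / 2 < rho M (X C)"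
        using eta_le[of "B n" "e / 2"] big[of n] e by force
      then obtain C where C: "C \<in> \<E>" "C \<subseteq> B n" "e / 2 < rho M (X C)" by auto
      have "(\<lambda>k. rho M (X (C \<inter> B k))) \<longlonglongrightarrow> 0"
      proof (rule X_decseq_tendsto_0)
        show "range (\<lambda>k. C \<inter> B k) \<subseteq> \<E>" using C(1) BE by auto
        show "decseq (\<lambda>k. C \<inter> B k)" using B(2) by (fastforce simp: decseq_def)
        show "(\<Inter>k. C \<inter> B k) = {}" using B(3) by auto
      qed
      then have "\<forall>\<^sub>F k in sequentially. rho M (X (C \<inter> B k)) < e / 4"
        using e by (intro order_tendstoD) auto
      then have "\<forall>\<^sub>F k in sequentially. rho M (X (C \<inter> B k)) < e / 4 \<and> n < k"
        by (intro eventually_conj eventually_gt_at_top)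
      then obtain k where k: "rho M (X (C \<inter> B k)) < e / 4" "n < k"
        using eventually_happens'[OF sequentially_bot] by blast
      have E: "C \<inter> B k \<in> \<E>" "C - B k \<in> \<E>" using C BE by auto
      have "AE s in M. X ((C \<inter> B k) \<union> (C - B k)) s = X (C \<inter> B k) s + X (C - B k) s"
        using E by (intro X_Un) auto
      moreover have "(C \<inter> B k) \<union> (C - B k) = C" by auto
      ultimately have "rho M (X C) = rho M (\<lambda>s. X (C \<inter> B k) s + X (C - B k) s)"
        using E C by (intro rho_cong_AE) auto
      also have "\<dots> \<le> rho M (X (C \<inter> B k)) + rho M (X (C - B k))"
        using E by (intro rho_triangle) auto
      finally have "e / 4 < rho M (X (C - B k))" using k C by simp
      then show ?thesis using k E C by (intro exI[of _ k] exI[of _ "C - B k"]) auto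
    qed
    then obtain K D where KD: "\<And>n. n < K n" "\<And>n. D n \<in> \<E>" "\<And>n. D n \<subseteq> B n - B (K n)" "\<And>n. e / 4 < rho M (X (D n))"
      by metis
    define t where "t = rec_nat 0 (\<lambda>_. K)"
    have t: "t (Suc i) = K (t i)" for i by (simp add: t_def)
    have tm: "t (Suc i) \<le> t j" if "i < j" for i j
      using lift_Suc_mono_le[of t "Suc i" j] KD(1) that by (simp add: t less_imp_le)
    have "disjoint_family (\<lambda>i. D (t i))"
      unfolding disjoint_family_on_def
    proof (intro ballI impI)
      fix i j :: nat
      have *: "D (t i) \<inter> D (t j) = {}" if "i < j" for i j
        using KD(3)[of "t i"] KD(3)[of "t j"] mono[OF tm[OF that]] by (auto simp: t)
      assume "i \<noteq> j"
      then show "D (t i) \<inter> D (t j) = {}" using *[of i j] *[of j i] by (cases "i < j") auto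
    qed
    then have "(\<lambda>i. rho M (X (D (t i)))) \<longlonglongrightarrow> 0"
      using KD(2) by (intro X_disjoint_tendsto_0) auto
    then have "\<forall>\<^sub>F i in sequentially. rho M (X (D (t i))) < e / 4"
      using e by (intro order_tendstoD) auto
    then show False
      using KD(4) eventually_happens'[OF sequentially_bot] by (meson order_less_asym)
  qed
  then show ?thesis
  proof (intro LIMSEQ_I)
    fix e :: real assume "\<And>e. 0 < e \<Longrightarrow> \<exists>n. eta (B n) < e" "0 < e"
    then obtain n where n: "eta (B n) < e" by auto
    have "norm (eta (B m) - 0) < e" if "n \<le> m" for m
      using eta_mono[OF mono[OF that]] n eta_nonneg[of "B m"] by simp
    then show "\<exists>n. \<forall>m\<ge>n. norm (eta (B m) - 0) < e" by auto
  qed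
qed

end

text \<open>A maximal disjoint subfamily is countable: infinitely many members with \<open>f\<close>
  above a fixed positive bound would form a disjoint sequence along which \<open>f\<close> does not
  tend to 0.\<close>

lemma disjoint_exhaustion:
  fixes f :: "'a set \<Rightarrow> real"
  assumes pos: "\<And>D. D \<in> \<G> \<Longrightarrow> 0 < f D"
    and vanish: "\<And>s :: nat \<Rightarrow> 'a set. range s \<subseteq> \<G> \<Longrightarrow> disjoint_family s \<Longrightarrow> (\<lambda>n. f (s n)) \<longlonglongrightarrow> 0"
  obtains \<D> where "\<D> \<subseteq> \<G>" "disjoint \<D>" "countable \<D>" "\<And>D. D \<in> \<G> \<Longrightarrow> D \<inter> \<Union>\<D> = {} \<Longrightarrow> D = {}"
proof -
  have "\<exists>\<D>\<in>{\<D>. \<D> \<subseteq> \<G> \<and> disjoint \<D>}. \<forall>\<D>'\<in>{\<D>. \<D> \<subseteq> \<G> \<and> disjoint \<D>}. \<D> \<subseteq> \<D>' \<longrightarrow> \<D>' = \<D>"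
  proof (rule subset_Zorn')
    fix \<C> assume C: "subset.chain {\<D>. \<D> \<subseteq> \<G> \<and> disjoint \<D>} \<C>"
    have "disjoint (\<Union>\<C>)"
      unfolding disjoint_def
    proof (intro ballI impI)
      fix D D' assume D: "D \<in> \<Union>\<C>" "D' \<in> \<Union>\<C>" "D \<noteq> D'"
      then obtain \<X> \<Y> where "D \<in> \<X>" "\<X> \<in> \<C>" "D' \<in> \<Y>" "\<Y> \<in> \<C>" by auto
      then obtain \<Z> where "\<Z> \<in> \<C>" "D \<in> \<Z>" "D' \<in> \<Z>"
        using C unfolding subset.chain_def by blast
      then show "D \<inter> D' = {}" using C D(3) unfolding subset.chain_def disjoint_def by blast
    qed
    then show "\<Union>\<C> \<in> {\<D>. \<D> \<subseteq> \<G> \<and> disjoint \<D>}"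
      using C unfolding subset.chain_def by blast
  qed
  then obtain \<D> where D: "\<D> \<subseteq> \<G>" "disjoint \<D>"
    and max: "\<And>\<D>'. \<D>' \<subseteq> \<G> \<Longrightarrow> disjoint \<D>' \<Longrightarrow> \<D> \<subseteq> \<D>' \<Longrightarrow> \<D>' = \<D>" by auto
  have fin: "finite {X\<in>\<D>. 1 / real (Suc n) < f X}" (is "finite ?F") for n
  proof (rule ccontr)
    assume "infinite ?F"
    then obtain s :: "nat \<Rightarrow> 'a set" where s: "inj s" "range s \<subseteq> ?F"
      using infinite_countable_subset by blast
    have "disjoint_family s"
      unfolding disjoint_family_on_def
    proof (intro ballI impI)
      fix i j :: nat assume "i \<noteq> j"
      then have "s i \<noteq> s j" using s(1) by (auto dest: injD)
      moreover have "s i \<in> \<D>" "s j \<in> \<D>" using s(2) by auto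
      ultimately show "s i \<inter> s j = {}" using D(2) by (auto dest: disjointD)
    qed
    then have "(\<lambda>n. f (s n)) \<longlonglongrightarrow> 0" using s(2) D(1) by (intro vanish) auto
    then have "\<forall>\<^sub>F i in sequentially. f (s i) < 1 / real (Suc n)"
      by (intro order_tendstoD) auto
    then obtain i where "f (s i) < 1 / real (Suc n)"
      using eventually_happens'[OF sequentially_bot] by blast
    moreover have "s i \<in> ?F" using s(2) by auto
    ultimately show False by simp
  qed
  have DU: "\<D> = (\<Union>n. {X\<in>\<D>. 1 / real (Suc n) < f X})"
  proof -
    have "\<exists>n. 1 / real (Suc n) < f X" if "X \<in> \<D>" for X
      using reals_Archimedean[of "f X"] pos[of X] that D(1) by (auto simp: inverse_eq_divide)
    then show ?thesis by auto
  qed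
  have "countable \<D>"
    by (subst DU) (intro countable_UN countable_finite[OF fin] countableI_type)
  moreover have "X = {}" if X: "X \<in> \<G>" "X \<inter> \<Union>\<D> = {}" for X
  proof -
    have "insert X \<D> = \<D>"
      using X D by (intro max) (auto simp: disjoint_def)
    then show ?thesis using X(2) by auto
  qed
  ultimately show thesis using that D by blast
qed

lemma (in finite_measure) measure_disjoint_tendsto_0:
  assumes "range A \<subseteq> sets M" "disjoint_family A"
  shows "(\<lambda>n. measure M (A n)) \<longlonglongrightarrow> 0"
  using finite_measure_UNION[OF assms] by (intro summable_LIMSEQ_zero) (auto simp: sums_iff)

section \<open>Integrals of step functions and the atoms of finite families\<close>

definition step_int :: "('e set \<Rightarrow> 's \<Rightarrow> real) \<Rightarrow> (real \<times> 'e set) list \<Rightarrow> 's \<Rightarrow> real" where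
  "step_int X l s = (\<Sum>(c, B)\<leftarrow>l. c * X B s)"

lemma step_int_append: "step_int X (l @ l') s = step_int X l s + step_int X l' s"
  by (simp add: step_int_def)

lemma step_int_scale: "step_int X (step_scale c l) s = c * step_int X l s"
  by (induction l) (auto simp: step_int_def step_scale_def algebra_simps)

lemma step_int_nth: "step_int X l s = (\<Sum>j<length l. fst (l ! j) * X (snd (l ! j)) s)"
  unfolding step_int_def sum_list_sum_nth by (simp add: case_prod_beta lessThan_atLeast0)

lemma step_fun_nth: "step_fun l e = (\<Sum>j<length l. fst (l ! j) * indicator (snd (l ! j)) e)"
  unfolding step_fun_def sum_list_sum_nth by (simp add: case_prod_beta lessThan_atLeast0)

lemma step_cost_nth: "step_cost \<Psi> l = (\<Sum>j<length l. \<bar>fst (l ! j)\<bar> * \<Psi> (snd (l ! j)))"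
  unfolding step_cost_def sum_list_sum_nth by (simp add: case_prod_beta lessThan_atLeast0)

text \<open>The cell of points of \<open>D\<close> whose pattern of membership in the sets
  \<open>B j\<close> is \<open>R\<close>. Empty cells are indexed too and have to be set aside
  whenever a coefficient is read off from a point of the cell.\<close>

definition atom :: "'e set \<Rightarrow> ('j \<Rightarrow> 'e set) \<Rightarrow> 'j set \<Rightarrow> 'j set \<Rightarrow> 'e set" where
  "atom D B J R = {e\<in>D. \<forall>j\<in>J. e \<in> B j \<longleftrightarrow> j \<in> R}"

lemma disjoint_atom: "\<R> \<subseteq> Pow J \<Longrightarrow> disjoint_family_on (atom D B J) \<R>"
  unfolding disjoint_family_on_def atom_def by blast

lemma UN_atom: "(\<Union>R\<in>Pow J. atom D B J R) = D"
proof (intro subset_antisym subsetI)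
  fix e assume "e \<in> D"
  then have "e \<in> atom D B J {j\<in>J. e \<in> B j}" by (auto simp: atom_def)
  then show "e \<in> (\<Union>R\<in>Pow J. atom D B J R)" by (rule UN_I[rotated]) auto
qed (auto simp: atom_def)

lemma UN_atom_mem:
  assumes "j \<in> J" "B j \<subseteq> D"
  shows "(\<Union>R\<in>{R\<in>Pow J. j \<in> R}. atom D B J R) = B j"
proof (intro subset_antisym subsetI)
  fix e assume "e \<in> B j"
  then have "e \<in> atom D B J {j\<in>J. e \<in> B j}" "j \<in> {j\<in>J. e \<in> B j}"
    using assms by (auto simp: atom_def)
  then show "e \<in> (\<Union>R\<in>{R\<in>Pow J. j \<in> R}. atom D B J R)" by (intro UN_I) auto
qed (use assms in \<open>auto simp: atom_def\<close>)

lemma step_fun_atom: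
  assumes "R \<subseteq> {..<length l}" "e \<in> atom D (\<lambda>j. snd (l ! j)) {..<length l} R"
  shows "step_fun l e = (\<Sum>j\<in>R. fst (l ! j))"
proof -
  have "step_fun l e = (\<Sum>j<length l. if j \<in> R then fst (l ! j) else 0)"
    unfolding step_fun_nth using assms(2) by (intro sum.cong) (auto simp: atom_def)
  also have "\<dots> = (\<Sum>j\<in>R. fst (l ! j))"
    using assms(1) by (simp add: sum.If_cases Int_absorb1)
  finally show ?thesis .
qed

context real_L0_measure
begin

lemma step_int_meas:
  "snd ` set l \<subseteq> \<E> \<Longrightarrow> step_int X l \<in> borel_measurable M"
proof (induction l)
  case (Cons a l)
  then have [measurable]: "X (snd a) \<in> borel_measurable M" "step_int X l \<in> borel_measurable M"
    by auto
  have "step_int X (a # l) = (\<lambda>s. fst a * X (snd a) s + step_int X l s)"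
    by (simp add: fun_eq_iff step_int_def case_prod_beta)
  then show ?case by simp
qed (simp add: step_int_def[abs_def])

lemma atom_in_dom:
  assumes "D \<in> \<E>" "finite J" "\<And>j. j \<in> J \<Longrightarrow> B j \<in> \<E>"
  shows "atom D B J R \<in> \<E>"
  using assms(2,3)
proof (induction J)
  case empty
  then show ?case using assms(1) by (simp add: atom_def)
next
  case (insert j J)
  have "atom D B (insert j J) R = (if j \<in> R then atom D B J R \<inter> B j else atom D B J R - B j)"
    by (auto simp: atom_def)
  then show ?case using insert by (auto intro!: dom.Int dom.Diff)
qed

lemma X_sum_atoms:
  assumes "D \<in> \<E>" "finite J" "\<And>j. j \<in> J \<Longrightarrow> B j \<in> \<E>" "\<R> \<subseteq> Pow J"
  shows "AE s in M. X (\<Union>R\<in>\<R>. atom D B J R) s = (\<Sum>R\<in>\<R>. X (atom D B J R) s)"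
proof (rule X_finite_Union)
  show "finite \<R>" using assms(2,4) by (auto intro: finite_subset)
  show "disjoint_family_on (atom D B J) \<R>" by (rule disjoint_atom[OF assms(4)])
  show "atom D B J R \<in> \<E>" for R by (rule atom_in_dom[OF assms(1-3)])
qed

lemma step_int_atoms:
  assumes D: "D \<in> \<E>" and l: "snd ` set l \<subseteq> \<E>" "\<And>B. B \<in> snd ` set l \<Longrightarrow> B \<subseteq> D"
  defines "B \<equiv> \<lambda>j. snd (l ! j)" and "J \<equiv> {..<length l}"
  shows "AE s in M. step_int X l s = (\<Sum>R\<in>Pow J. (\<Sum>j\<in>R. fst (l ! j)) * X (atom D B J R) s)"
proof -
  have B: "B j \<in> \<E>" "B j \<subseteq> D" if "j \<in> J" for j
    using l that by (auto simp: B_def J_def)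
  have "AE s in M. X (B j) s = (\<Sum>R\<in>{R\<in>Pow J. j \<in> R}. X (atom D B J R) s)" if "j \<in> J" for j
  proof -
    have "finite J" by (simp add: J_def)
    then show ?thesis
      using X_sum_atoms[OF D, of J B "{R\<in>Pow J. j \<in> R}"] B(1)
      unfolding UN_atom_mem[of j J B D, OF that B(2)[OF that]] by blast
  qed
  then have "AE s in M. \<forall>j\<in>J. X (B j) s = (\<Sum>R\<in>{R\<in>Pow J. j \<in> R}. X (atom D B J R) s)"
    by (intro AE_finite_allI) (auto simp: J_def)
  then show ?thesis
  proof eventually_elim
    case (elim s)
    have "step_int X l s = (\<Sum>j\<in>J. fst (l ! j) * X (B j) s)"
      by (simp add: step_int_nth J_def B_def)
    also have "\<dots> = (\<Sum>j\<in>J. \<Sum>R\<in>{R\<in>Pow J. j \<in> R}. fst (l ! j) * X (atom D B J R) s)"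
      using elim by (simp add: sum_distrib_left)
    also have "\<dots> = (\<Sum>R\<in>Pow J. \<Sum>j\<in>{j\<in>J. j \<in> R}. fst (l ! j) * X (atom D B J R) s)"
      by (rule sum.swap_restrict) (auto simp: J_def)
    also have "\<dots> = (\<Sum>R\<in>Pow J. (\<Sum>j\<in>R. fst (l ! j)) * X (atom D B J R) s)"
      unfolding sum_distrib_right by (intro sum.cong) auto
    finally show ?case .
  qed
qed

lemma X_empty_set: "B = {} \<Longrightarrow> AE s in M. X B s = 0"
  using X_empty by simp

text \<open>On a nonempty atom the total coefficient is a value of the step function, hence 0; on an
  empty atom \<open>X\<close> vanishes almost everywhere. So the integral depends on the function
  alone, up to null sets.\<close>

lemma step_int_eq_0_AE:
  assumes l: "snd ` set l \<subseteq> \<E>" "step_fun l = (\<lambda>_. 0)"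
  shows "AE s in M. step_int X l s = 0"
proof -
  define J where "J = {..<length l}"
  let ?A = "atom \<Omega> (\<lambda>j. snd (l ! j)) J"
  have "AE s in M. (\<Sum>j\<in>R. fst (l ! j)) * X (?A R) s = 0" if R: "R \<in> Pow J" for R
  proof (cases "?A R = {}")
    case True
    show ?thesis using X_empty_set[OF True] by eventually_elim simp
  next
    case False
    then obtain e where "e \<in> ?A R" by auto
    then have "(\<Sum>j\<in>R. fst (l ! j)) = 0"
      using step_fun_atom[of R l e \<Omega>] R l(2) by (auto simp: J_def)
    then show ?thesis by simp
  qed
  then have "AE s in M. \<forall>R\<in>Pow J. (\<Sum>j\<in>R. fst (l ! j)) * X (?A R) s = 0"
    by (intro AE_finite_allI) (auto simp: J_def)
  moreover have "AE s in M. step_int X l s = (\<Sum>R\<in>Pow J. (\<Sum>j\<in>R. fst (l ! j)) * X (?A R) s)"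
    unfolding J_def using l(1) dom.space_closed by (intro step_int_atoms) auto
  ultimately show ?thesis by eventually_elim (simp only: sum.neutral)
qed

lemma step_int_cong_AE:
  assumes "snd ` set l \<subseteq> \<E>" "snd ` set l' \<subseteq> \<E>" "step_fun l = step_fun l'"
  shows "AE s in M. step_int X l s = step_int X l' s"
proof -
  have "AE s in M. step_int X (l @ step_scale (- 1) l') s = 0"
  proof (rule step_int_eq_0_AE)
    show "snd ` set (l @ step_scale (- 1) l') \<subseteq> \<E>"
      using assms(1,2) by (simp add: image_Un)
    show "step_fun (l @ step_scale (- 1) l') = (\<lambda>_. 0)"
      using assms(3) by (simp add: fun_eq_iff step_fun_append step_fun_scale)
  qed
  then show ?thesis by eventually_elim (simp add: step_int_append step_int_scale)
qed

text \<open>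
  If \<open>X\<close> is unbounded on \<open>A\<close> then, for every finite partition of \<open>A\<close>, some piece inherits the
  unboundedness at almost every point where it is visible, and a set of random subset sums detects
  such a piece with probability at least one half.
\<close>

lemma unbounded_gauge:
  assumes A: "A \<in> \<E>"
    and unb: "\<And>K. \<exists>C\<in>\<E>. C \<subseteq> A \<and> a < measure M {s\<in>space M. K < \<bar>X C s\<bar>}"
    and l: "snd ` set l \<subseteq> \<E>" "step_fun l = indicator A"
  shows "a \<le> step_cost (\<lambda>B. 2 * eta B) l"
proof -
  define J where "J = {..<length l}"
  define B where "B j = snd (l ! j)" for j
  define At where "At = atom A B J"
  have J: "finite J" "\<And>j. j \<in> J \<Longrightarrow> B j \<in> \<E>" using l(1) by (auto simp: J_def B_def)
  \<comment> \<open>There are \<open>2 ^ length l\<close> membership patterns, so where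
    \<open>X C\<close> exceeds this threshold some piece \<open>v R\<close> exceeds 2.\<close>
  obtain C where C: "C \<in> \<E>" "C \<subseteq> A" "a < measure M {s\<in>space M. 2 * 2 ^ length l < \<bar>X C s\<bar>}"
    using unb by blast
  define v where "v R = X (C \<inter> At R)" for R
  have AtE: "At R \<in> \<E>" for R unfolding At_def by (rule atom_in_dom[OF A J])
  have CE: "C \<inter> At R \<in> \<E>" for R using C(1) AtE by auto
  have [measurable]: "v R \<in> borel_measurable M" "X C \<in> borel_measurable M" for R
    unfolding v_def using CE C(1) by (auto intro: X_meas)
  have sumv: "AE s in M. X (C \<inter> (\<Union>R\<in>\<R>. At R)) s = (\<Sum>R\<in>\<R>. v R s)" if "\<R> \<subseteq> Pow J" for \<R>
  proof -
    have "finite \<R>" using that J(1) by (auto intro: finite_subset)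
    moreover have "disjoint_family_on (\<lambda>R. C \<inter> At R) \<R>"
      using disjoint_atom[OF that, of A B] by (auto simp: disjoint_family_on_def At_def)
    moreover have "C \<inter> (\<Union>R\<in>\<R>. At R) = (\<Union>R\<in>\<R>. C \<inter> At R)" by auto
    ultimately show ?thesis
      unfolding v_def using X_finite_Union[of \<R> "\<lambda>R. C \<inter> At R"] CE by simp
  qed
  define H where "H = {s\<in>space M. \<exists>R\<in>{R\<in>Pow J. At R \<noteq> {}}. 2 < \<bar>v R s\<bar>}"
  define Hj where "Hj j = {s\<in>space M. \<exists>R\<in>{R\<in>Pow J. j \<in> R}. 2 * 1 < \<bar>v R s\<bar>}" for j
  have fin: "finite {R\<in>Pow J. P R}" for P using J(1) by auto
  have Hm [measurable]: "H \<in> sets M" "Hj j \<in> sets M" for j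
    unfolding H_def Hj_def using fin by measurable
  have "a \<le> measure M {s\<in>space M. 2 * 2 ^ length l < \<bar>X C s\<bar>}" using C(3) by simp
  also have "\<dots> \<le> measure M H"
  proof (rule finite_measure_mono_AE)
    have "AE s in M. \<forall>R\<in>{R\<in>Pow J. At R = {}}. v R s = 0"
      unfolding v_def using fin by (intro AE_finite_allI X_empty_set) auto
    moreover have "AE s in M. X C s = (\<Sum>R\<in>Pow J. v R s)"
      using sumv[of "Pow J"] C(2) UN_atom[of A B J] unfolding At_def by (simp add: Int_absorb2)
    ultimately show "AE s in M. s \<in> {s\<in>space M. 2 * 2 ^ length l < \<bar>X C s\<bar>} \<longrightarrow> s \<in> H"
    proof eventually_elim
      case (elim s)
      show ?case
      proof
        assume s: "s \<in> {s\<in>space M. 2 * 2 ^ length l < \<bar>X C s\<bar>}"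
        have "\<exists>R\<in>Pow J. 2 < \<bar>v R s\<bar>"
        proof (rule ccontr)
          assume "\<not> ?thesis"
          then have "\<bar>\<Sum>R\<in>Pow J. v R s\<bar> \<le> (\<Sum>R\<in>Pow J. 2)"
            by (intro order_trans[OF sum_abs] sum_mono) (auto simp: not_less)
          also have "\<dots> = 2 * 2 ^ length l" using J(1) by (simp add: card_Pow J_def)
          finally show False using s elim by simp
        qed
        then obtain R where R: "R \<in> Pow J" "2 < \<bar>v R s\<bar>" by auto
        then have "At R \<noteq> {}" using elim(1) by auto
        then show "s \<in> H" using R s unfolding H_def by auto
      qed
    qed
  qed measurable
  also have "\<dots> = 1 * measure M H" by simp
  \<comment> \<open>If the atom \<open>R\<close> is large at \<open>s\<close>, the coefficients over
    \<open>R\<close> sum to 1, so their absolute values sum to at least 1, and each \<open>j\<close>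
    in \<open>R\<close> puts \<open>s\<close> into \<open>Hj j\<close>.\<close>
  also have "\<dots> \<le> (\<Sum>j\<in>J. \<bar>fst (l ! j)\<bar> * measure M (Hj j))"
  proof (rule measure_le_weighted_sum[OF J(1)])
    fix s assume "s \<in> H"
    then obtain R e where R: "s \<in> space M" "R \<in> Pow J" "2 < \<bar>v R s\<bar>" "e \<in> At R" by (auto simp: H_def)
    then have "e \<in> A" by (auto simp: At_def atom_def)
    then have "1 = \<bar>step_fun l e\<bar>" using l(2) by simp
    also have "step_fun l e = (\<Sum>j\<in>R. fst (l ! j))"
      using R unfolding At_def B_def J_def by (intro step_fun_atom) auto
    also have "\<bar>\<dots>\<bar> \<le> (\<Sum>j\<in>R. \<bar>fst (l ! j)\<bar>)" by (rule sum_abs)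
    also have "\<dots> \<le> (\<Sum>j\<in>R. \<bar>fst (l ! j)\<bar> * of_bool (s \<in> Hj j))"
      using R by (intro sum_mono) (auto simp: Hj_def)
    also have "\<dots> \<le> (\<Sum>j\<in>J. \<bar>fst (l ! j)\<bar> * of_bool (s \<in> Hj j))"
      using R J(1) by (intro sum_mono2) auto
    finally show "1 \<le> (\<Sum>j\<in>J. \<bar>fst (l ! j)\<bar> * of_bool (s \<in> Hj j))" .
  qed (use Hm in auto)
  \<comment> \<open>All pieces entering \<open>Hj j\<close> lie in \<open>B j\<close>, and their
    subset sums are values of \<open>X\<close> on subsets of \<open>B j\<close>; hence
    \<open>eta (B j)\<close> bounds them and the maximum costs a factor 2.\<close>
  also have "\<dots> \<le> (\<Sum>j\<in>J. \<bar>fst (l ! j)\<bar> * (2 * eta (B j)))"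
  proof (intro sum_mono mult_left_mono)
    fix j assume j: "j \<in> J"
    show "measure M (Hj j) \<le> 2 * eta (B j)"
      unfolding Hj_def
    proof (rule measure_max_le_subset_sums[OF fin])
      fix Q assume Q: "Q \<subseteq> {R\<in>Pow J. j \<in> R}"
      then have QJ: "Q \<subseteq> Pow J" by auto
      let ?D = "C \<inter> (\<Union>R\<in>Q. At R)"
      have D: "?D \<in> \<E>" "?D \<subseteq> B j"
      proof -
        have "finite Q" using QJ J(1) by (auto intro: finite_subset)
        then show "?D \<in> \<E>" using C(1) AtE by (intro dom.Int dom.finite_UN) auto
        show "?D \<subseteq> B j" using Q j by (auto simp: At_def atom_def)
      qed
      note [measurable] = X_meas[OF D(1)]
      have "measure M {s\<in>space M. 1 < \<bar>\<Sum>R\<in>Q. v R s\<bar>} \<le> measure M {s\<in>space M. 1 \<le> \<bar>X ?D s\<bar>}"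
      proof (rule finite_measure_mono_AE)
        show "AE s in M. s \<in> {s\<in>space M. 1 < \<bar>\<Sum>R\<in>Q. v R s\<bar>} \<longrightarrow> s \<in> {s\<in>space M. 1 \<le> \<bar>X ?D s\<bar>}"
          using sumv[OF QJ] by eventually_elim auto
      qed measurable
      also have "\<dots> \<le> rho M (X ?D)" using measure_ge_le_rho[of "X ?D" 1] D by simp
      also have "\<dots> \<le> eta (B j)" using D by (rule rho_le_eta)
      finally show "measure M {s\<in>space M. 1 < \<bar>\<Sum>R\<in>Q. v R s\<bar>} \<le> eta (B j)" .
    qed simp
  qed simp
  also have "\<dots> = step_cost (\<lambda>B. 2 * eta B) l" by (simp add: step_cost_nth J_def B_def)
  finally show ?thesis .
qed

end

section \<open>Bounded measures\<close>

lemma ex_power4_bracket: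
  fixes t :: real
  assumes "1 \<le> t"
  obtains k where "4 ^ k \<le> t" "t < 4 ^ Suc k"
proof -
  obtain n where n: "t < 4 ^ n" using real_arch_pow[of 4 t] by auto
  define m where "m = (LEAST n. t < 4 ^ n)"
  have m: "t < 4 ^ m" unfolding m_def using n by (rule LeastI[of "\<lambda>n. t < 4 ^ n"])
  then obtain k where k: "m = Suc k" using assms by (cases m) auto
  then have "\<not> t < 4 ^ k" unfolding m_def using not_less_Least[of k "\<lambda>n. t < 4 ^ n"] by simp
  then show thesis using that[of k] m k by simp
qed

lemma ennreal_le_suminf: "f k \<le> (\<Sum>k. f k :: ennreal)"
  using sum_le_suminf[of f "{k}"] by simp

section \<open>Weak-type bounds and Nikishin's theorem\<close>

context finite_measure
begin

text \<open>Slicing at the levels \<open>4 ^ k\<close>: between consecutive levels the square root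
  is at most \<open>2 ^ Suc k\<close>, while the level set has measure at most
  \<open>C / 4 ^ k\<close>. The resulting geometric series sums to \<open>4 * C\<close>.\<close>

lemma integrable_sqrt_of_weak_type:
  fixes y :: "'a \<Rightarrow> real"
  assumes [measurable]: "y \<in> borel_measurable M" and C: "0 \<le> C"
    and weak: "\<And>t. 0 < t \<Longrightarrow> t * measure M {s\<in>space M. t \<le> \<bar>y s\<bar>} \<le> C"
  shows "integrable M (\<lambda>s. sqrt \<bar>y s\<bar>)"
    and "(\<integral>s. sqrt \<bar>y s\<bar> \<partial>M) \<le> measure M (space M) + 4 * C"
proof -
  define A where "A k = {s\<in>space M. 4 ^ k \<le> \<bar>y s\<bar>}" for k :: nat
  have [measurable]: "A k \<in> sets M" for k unfolding A_def by measurable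
  have pt: "ennreal (sqrt \<bar>y s\<bar>) \<le> 1 + (\<Sum>k. ennreal (2 ^ Suc k) * indicator (A k) s)"
    if s: "s \<in> space M" for s
  proof (cases "\<bar>y s\<bar> < 1")
    case True
    then have "sqrt \<bar>y s\<bar> \<le> 1" by simp
    then have "ennreal (sqrt \<bar>y s\<bar>) \<le> 1" using ennreal_leI by fastforce
    then show ?thesis by (rule order_trans) simp
  next
    case False
    then obtain k where k: "4 ^ k \<le> \<bar>y s\<bar>" "\<bar>y s\<bar> < 4 ^ Suc k"
      using ex_power4_bracket[of "\<bar>y s\<bar>"] by (auto simp: not_less)
    have "(2 ^ Suc k)\<^sup>2 = (4 :: real) ^ Suc k"
      by (simp add: power2_eq_square flip: power_mult_distrib)
    then have "sqrt \<bar>y s\<bar> \<le> 2 ^ Suc k"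
      using k(2) by (intro real_le_lsqrt) simp_all
    then have "ennreal (sqrt \<bar>y s\<bar>) \<le> ennreal (2 ^ Suc k) * indicator (A k) s"
      using s k(1) by (auto simp: A_def intro!: ennreal_leI simp del: power_Suc)
    also have "\<dots> \<le> (\<Sum>k. ennreal (2 ^ Suc k) * indicator (A k) s)"
      by (rule ennreal_le_suminf)
    also have "\<dots> \<le> 1 + \<dots>" by simp
    finally show ?thesis .
  qed
  have "(\<integral>\<^sup>+s. ennreal (sqrt \<bar>y s\<bar>) \<partial>M) \<le> (\<integral>\<^sup>+s. 1 + (\<Sum>k. ennreal (2 ^ Suc k) * indicator (A k) s) \<partial>M)"
    by (rule nn_integral_mono[OF pt])
  also have "\<dots> = emeasure M (space M) + (\<Sum>k. ennreal (2 ^ Suc k) * emeasure M (A k))"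
    by (subst nn_integral_add) (auto simp: nn_integral_suminf nn_integral_cmult_indicator)
  also have "\<dots> \<le> ennreal (measure M (space M)) + (\<Sum>k. ennreal (2 * C * (1 / 2) ^ k))"
  proof (intro add_mono suminf_le)
    fix k
    have "4 ^ k * measure M (A k) \<le> C" unfolding A_def by (rule weak) simp
    then have "measure M (A k) \<le> C / 4 ^ k" by (simp add: field_simps)
    then have "2 ^ Suc k * measure M (A k) \<le> 2 ^ Suc k * (C / 4 ^ k)" by (rule mult_left_mono) simp
    also have "\<dots> = 2 * C * (1 / 2) ^ k"
    proof -
      have "(4 :: real) ^ k = 2 ^ k * 2 ^ k" by (simp flip: power_mult_distrib)
      then show ?thesis by (simp add: power_divide)
    qed
    finally show "ennreal (2 ^ Suc k) * emeasure M (A k) \<le> ennreal (2 * C * (1 / 2) ^ k)"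
      by (simp add: emeasure_eq_measure ennreal_mult[symmetric] ennreal_leI)
  qed (auto simp: emeasure_eq_measure)
  also have "(\<Sum>k. ennreal (2 * C * (1 / 2) ^ k)) = ennreal (4 * C)"
    using geometric_sums[of "1 / 2 :: real"] C
    by (intro suminf_ennreal_eq) (auto dest: sums_mult[of _ _ "2 * C"])
  also have "ennreal (measure M (space M)) + ennreal (4 * C) = ennreal (measure M (space M) + 4 * C)"
    using C by simp
  finally have fin: "(\<integral>\<^sup>+s. ennreal (sqrt \<bar>y s\<bar>) \<partial>M) \<le> ennreal (measure M (space M) + 4 * C)" .
  then show "integrable M (\<lambda>s. sqrt \<bar>y s\<bar>)"
    by (intro integrableI_nonneg) (auto intro: le_less_trans)
  show "(\<integral>s. sqrt \<bar>y s\<bar> \<partial>M) \<le> measure M (space M) + 4 * C"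
    using fin C by (intro integral_real_bounded) auto
qed

text \<open>
  Nikishin's exhaustion argument: sets \<open>E\<close> carrying a \<open>y\<close> with \<open>\<bar>y\<bar>\<close> larger than \<open>C / \<mu> E\<close> can be
  disjointified, and the average of the corresponding functions with weights proportional to
  \<open>\<mu> E\<close> is large, with probability one half for random subset sums, on their union.
\<close>

lemma nikishin:
  fixes T :: "('a \<Rightarrow> real) set"
  assumes meas: "\<And>y. y \<in> T \<Longrightarrow> y \<in> borel_measurable M" and K: "0 \<le> K"
    and conv: "\<And>(\<D> :: 'a set set) c h. finite \<D> \<Longrightarrow> (\<And>E. E \<in> \<D> \<Longrightarrow> h E \<in> T) \<Longrightarrow> (\<And>E. E \<in> \<D> \<Longrightarrow> 0 \<le> c E) \<Longrightarrow>
      sum c \<D> \<le> 1 \<Longrightarrow> (\<lambda>s. \<Sum>E\<in>\<D>. c E * h E s) \<in> T"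
    and bound: "\<And>y. y \<in> T \<Longrightarrow> measure M {s\<in>space M. K < \<bar>y s\<bar>} \<le> \<delta>"
  obtains G C where "G \<in> sets M" "measure M (space M - G) \<le> 2 * \<delta>" "0 \<le> C"
    "\<And>y t. y \<in> T \<Longrightarrow> 0 < t \<Longrightarrow> t * measure M {s\<in>G. t \<le> \<bar>y s\<bar>} \<le> C"
proof -
  define m where "m = measure M (space M) + 1"
  have m: "0 < m" unfolding m_def by (rule add_nonneg_pos) auto
  \<comment> \<open>Chosen so that, with weights \<open>c E = measure M E / m\<close>, the
    inequality defining \<open>\<G>\<close> makes \<open>\<bar>c E * h E s\<bar>\<close> exceed
    \<open>2 * K\<close> on \<open>E\<close>. The summand 1 in \<open>m\<close> keeps it
    positive.\<close>
  define C where "C = (2 * K + 1) * m"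
  have C: "0 \<le> C" using K m by (simp add: C_def)
  define \<G> where "\<G> = {E\<in>sets M. 0 < measure M E \<and> (\<exists>y\<in>T. \<forall>s\<in>E. C < measure M E * \<bar>y s\<bar>)}"
  obtain \<D> where D: "\<D> \<subseteq> \<G>" "disjoint \<D>" "countable \<D>" "\<And>E. E \<in> \<G> \<Longrightarrow> E \<inter> \<Union>\<D> = {} \<Longrightarrow> E = {}"
  proof (rule disjoint_exhaustion[of \<G> "measure M"])
    show "0 < measure M E" if "E \<in> \<G>" for E using that by (simp add: \<G>_def)
    show "(\<lambda>n. measure M (s n)) \<longlonglongrightarrow> 0" if "range s \<subseteq> \<G>" "disjoint_family s" for s :: "nat \<Rightarrow> 'a set"
      using that by (intro measure_disjoint_tendsto_0) (auto simp: \<G>_def)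
  qed (rule that)
  have Dm: "\<D> \<subseteq> sets M" using D(1) by (auto simp: \<G>_def)
  have fin: "measure M (\<Union>\<F>) \<le> 2 * \<delta>" if F: "finite \<F>" "\<F> \<subseteq> \<D>" for \<F>
  proof -
    have "\<forall>E\<in>\<F>. \<exists>y\<in>T. \<forall>s\<in>E. C < measure M E * \<bar>y s\<bar>" using F D(1) by (auto simp: \<G>_def)
    then obtain h where h: "\<And>E. E \<in> \<F> \<Longrightarrow> h E \<in> T" "\<And>E s. E \<in> \<F> \<Longrightarrow> s \<in> E \<Longrightarrow> C < measure M E * \<bar>h E s\<bar>"
      by metis
    define c where "c E = measure M E / m" for E
    have Fm: "\<F> \<subseteq> sets M" using F Dm by auto
    have "(\<Sum>E\<in>\<F>. measure M E) = measure M (\<Union>\<F>)"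
    proof -
      have "disjoint_family_on (\<lambda>E. E) \<F>"
        using D(2) F(2) by (auto simp: disjoint_family_on_def disjoint_def)
      then show ?thesis using finite_measure_finite_Union[OF F(1), of "\<lambda>E. E"] Fm by auto
    qed
    also have "\<dots> \<le> m" using bounded_measure[of "\<Union>\<F>"] by (simp add: m_def)
    finally have c1: "sum c \<F> \<le> 1" using m unfolding c_def sum_divide_distrib[symmetric] by simp
    have "measure M {s\<in>space M. \<exists>E\<in>\<F>. 2 * K < \<bar>c E * h E s\<bar>} \<le> 2 * \<delta>"
    proof (rule measure_max_le_subset_sums[OF F(1)])
      show "(\<lambda>s. c E * h E s) \<in> borel_measurable M" if "E \<in> \<F>" for E
        using meas[OF h(1)[OF that]] by measurable
      fix Q assume Q: "Q \<subseteq> \<F>"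
      have "(\<lambda>s. \<Sum>E\<in>Q. c E * h E s) \<in> T"
      proof (rule conv[where \<D> = Q and c = c and h = h])
        have "sum c Q \<le> sum c \<F>" using Q F(1) m by (intro sum_mono2) (auto simp: c_def)
        then show "sum c Q \<le> 1" using c1 by simp
        show "0 \<le> c E" for E using m by (simp add: c_def)
      qed (use Q F(1) h(1) finite_subset in auto)
      then show "measure M {s\<in>space M. K < \<bar>\<Sum>E\<in>Q. c E * h E s\<bar>} \<le> \<delta>" by (rule bound)
    qed
    moreover have "measure M (\<Union>\<F>) \<le> measure M {s\<in>space M. \<exists>E\<in>\<F>. 2 * K < \<bar>c E * h E s\<bar>}"
    proof (rule finite_measure_mono)
      show "\<Union>\<F> \<subseteq> {s\<in>space M. \<exists>E\<in>\<F>. 2 * K < \<bar>c E * h E s\<bar>}"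
      proof
        fix s assume "s \<in> \<Union>\<F>"
        then obtain E where E: "E \<in> \<F>" "s \<in> E" by auto
        have "C < measure M E * \<bar>h E s\<bar>" using h(2) E by auto
        then have "2 * K + 1 < measure M E * \<bar>h E s\<bar> / m" using m by (simp add: C_def field_simps)
        then have "2 * K < \<bar>c E * h E s\<bar>" using m by (simp add: c_def abs_mult)
        then show "s \<in> {s\<in>space M. \<exists>E\<in>\<F>. 2 * K < \<bar>c E * h E s\<bar>}"
          using E Fm sets.sets_into_space by blast
      qed
      have [measurable]: "E \<in> \<F> \<Longrightarrow> h E \<in> borel_measurable M" for E using meas h(1) by auto
      show "{s\<in>space M. \<exists>E\<in>\<F>. 2 * K < \<bar>c E * h E s\<bar>} \<in> sets M"
        using F(1) by measurable
    qed
    ultimately show ?thesis by simp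
  qed
  have UD: "\<Union>\<D> \<in> sets M" using D(3) Dm by (intro sets.countable_Union) auto
  have "measure M (\<Union>\<D>) \<le> 2 * \<delta>"
  proof (cases "\<D> = {}")
    case True
    then show ?thesis using fin[of "{}"] by simp
  next
    case False
    define U where "U n = \<Union>(from_nat_into \<D> ` {..n})" for n
    have sub: "from_nat_into \<D> ` {..n} \<subseteq> \<D>" for n using from_nat_into[OF False] by auto
    have "(\<lambda>n. measure M (U n)) \<longlonglongrightarrow> measure M (\<Union>n. U n)"
    proof (rule finite_Lim_measure_incseq)
      show "range U \<subseteq> sets M" unfolding U_def using sub Dm by (auto intro!: sets.finite_Union)
      show "incseq U" unfolding U_def incseq_def by (auto intro!: Union_mono image_mono)
    qed
    moreover have "(\<Union>n. U n) = \<Union>\<D>"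
      using range_from_nat_into[OF False D(3)] unfolding U_def by (auto; blast)
    moreover have "measure M (U n) \<le> 2 * \<delta>" for n unfolding U_def using sub by (intro fin) auto
    ultimately show ?thesis by (intro LIMSEQ_le_const2) auto
  qed
  moreover have "space M - (space M - \<Union>\<D>) = \<Union>\<D>" using Dm sets.sets_into_space by auto
  ultimately have G: "measure M (space M - (space M - \<Union>\<D>)) \<le> 2 * \<delta>" by simp
  show thesis
  proof (rule that[OF _ G C])
    show "space M - \<Union>\<D> \<in> sets M" using UD by auto
    fix y t assume y: "y \<in> T" and t: "0 < (t::real)"
    let ?E = "{s\<in>space M - \<Union>\<D>. t \<le> \<bar>y s\<bar>}"
    note [measurable] = meas[OF y] UD
    \<comment> \<open>A level set violating the bound would itself belong to \<open>\<G>\<close>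
      while being disjoint from \<open>\<Union>\<D>\<close>, against maximality.\<close>
    show "t * measure M ?E \<le> C"
    proof (rule ccontr)
      assume "\<not> t * measure M ?E \<le> C"
      then have big: "C < measure M ?E * t" by (simp add: mult.commute)
      then have pos: "0 < measure M ?E" using C t by (smt (verit) zero_less_mult_pos2)
      have "C < measure M ?E * \<bar>y s\<bar>" if "s \<in> ?E" for s
      proof -
        have "measure M ?E * t \<le> measure M ?E * \<bar>y s\<bar>" using that by (intro mult_left_mono) auto
        then show ?thesis using big by simp
      qed
      moreover have "?E \<in> sets M" by measurable
      ultimately have "?E \<in> \<G>" using pos y unfolding \<G>_def by blast
      then have "?E = {}" by (rule D(4)) auto
      then have "measure M ?E = 0" by (simp only: measure_empty)
      then show False using pos by simp
    qed
  qed
qed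

end

section \<open>Integrals of bounded step functions against a bounded measure\<close>

context real_L0_measure
begin

text \<open>Boundedness of the set of values \<open>X C\<close>, for \<open>C\<close> inside
  \<open>A\<close>, in the topological vector space of measurable functions under convergence in
  measure.\<close>

definition bounded_on :: "'e set \<Rightarrow> bool" where
  "bounded_on A \<longleftrightarrow> (\<forall>\<delta>>0. \<exists>K. \<forall>C\<in>\<E>. C \<subseteq> A \<longrightarrow> measure M {s\<in>space M. K < \<bar>X C s\<bar>} \<le> \<delta>)"

definition unit_steps :: "'e set \<Rightarrow> (real \<times> 'e set) list set" where
  "unit_steps A = {l. snd ` set l \<subseteq> {B\<in>\<E>. B \<subseteq> A} \<and> (\<forall>e. \<bar>step_fun l e\<bar> \<le> 1)}"

text \<open>Over the atoms the integral becomes a sum with coefficients in \<open>[-1, 1]\<close>,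
  and the subset sums of the values on atoms are values of \<open>X\<close>, so the random subset
  estimate applies. Its constants 52 and 6 appear here.\<close>

lemma unit_steps_bounded:
  assumes A: "A \<in> \<E>" and b: "bounded_on A" and \<delta>: "0 < \<delta>"
  obtains K where "0 < K" "\<And>l. l \<in> unit_steps A \<Longrightarrow> measure M {s\<in>space M. K < \<bar>step_int X l s\<bar>} \<le> \<delta>"
proof -
  obtain K0 where K0: "\<And>C. C \<in> \<E> \<Longrightarrow> C \<subseteq> A \<Longrightarrow> measure M {s\<in>space M. K0 < \<bar>X C s\<bar>} \<le> \<delta> / 52"
    using b \<delta> unfolding bounded_on_def by (metis divide_pos_pos zero_less_numeral)
  define K where "K = max K0 1"
  have K: "0 < K" "measure M {s\<in>space M. K < \<bar>X C s\<bar>} \<le> \<delta> / 52" if "C \<in> \<E>" "C \<subseteq> A" for C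
  proof -
    note [measurable] = X_meas[OF that(1)]
    have "measure M {s\<in>space M. K < \<bar>X C s\<bar>} \<le> measure M {s\<in>space M. K0 < \<bar>X C s\<bar>}"
      by (rule finite_measure_mono) (auto simp: K_def)
    then show "measure M {s\<in>space M. K < \<bar>X C s\<bar>} \<le> \<delta> / 52" using K0[OF that] by simp
  qed (simp add: K_def)
  have K1: "0 < K" by (simp add: K_def)
  have "measure M {s\<in>space M. 6 * K < \<bar>step_int X l s\<bar>} \<le> \<delta>" if l: "l \<in> unit_steps A" for l
  proof -
    define J where "J = {..<length l}"
    define At where "At = atom A (\<lambda>j. snd (l ! j)) J"
    define \<phi> where "\<phi> R = (\<Sum>j\<in>R. fst (l ! j))" for R
    \<comment> \<open>On nonempty atoms the coefficient \<open>\<phi> R\<close> is a value of the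
      step function and so is at most 1 in absolute value.\<close>
    define I where "I = {R\<in>Pow J. At R \<noteq> {}}"
    have lE: "snd ` set l \<subseteq> \<E>" "\<And>B. B \<in> snd ` set l \<Longrightarrow> B \<subseteq> A"
      using l unfolding unit_steps_def by blast+
    have BE: "snd (l ! j) \<in> \<E>" if "j \<in> J" for j
      using lE(1) that by (auto simp: J_def)
    have AtE: "At R \<in> \<E>" for R
      unfolding At_def by (rule atom_in_dom[OF A _ BE]) (auto simp: J_def)
    have I: "finite I" "I \<subseteq> Pow J" by (auto simp: I_def J_def)
    note [measurable] = X_meas[OF AtE] step_int_meas[OF lE(1)]
    have "measure M {s\<in>space M. 6 * K < \<bar>\<Sum>R\<in>I. \<phi> R * X (At R) s\<bar>} \<le> 52 * (\<delta> / 52)"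
    proof (rule measure_bounded_sum_le_subset_sums[OF I(1) _ K1])
      fix Q assume Q: "Q \<subseteq> I"
      then have QJ: "Q \<subseteq> Pow J" using I(2) by auto
      let ?D = "\<Union>R\<in>Q. At R"
      have fQ: "finite Q" using Q I(1) finite_subset by auto
      have D: "?D \<in> \<E>" using fQ AtE by (intro dom.finite_UN) auto
      have DA: "?D \<subseteq> A" by (auto simp: At_def atom_def)
      note [measurable] = X_meas[OF D]
      have "AE s in M. X ?D s = (\<Sum>R\<in>Q. X (At R) s)"
        unfolding At_def by (rule X_sum_atoms[OF A _ BE QJ]) (auto simp: J_def)
      then have "measure M {s\<in>space M. K < \<bar>\<Sum>R\<in>Q. X (At R) s\<bar>} = measure M {s\<in>space M. K < \<bar>X ?D s\<bar>}"
        by (intro finite_measure_eq_AE) (auto elim: eventually_mono)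
      then show "measure M {s\<in>space M. K < \<bar>\<Sum>R\<in>Q. X (At R) s\<bar>} \<le> \<delta> / 52"
        using K(2)[OF D DA] by simp
    next
      fix R assume "R \<in> I"
      then obtain e where e: "R \<subseteq> J" "e \<in> At R" by (auto simp: I_def)
      then have "step_fun l e = \<phi> R"
        unfolding At_def J_def \<phi>_def by (rule step_fun_atom)
      then show "\<bar>\<phi> R\<bar> \<le> 1" using l unfolding unit_steps_def by (metis (mono_tags, lifting) mem_Collect_eq)
    qed measurable
    moreover have "AE s in M. step_int X l s = (\<Sum>R\<in>I. \<phi> R * X (At R) s)"
    proof -
      have "AE s in M. \<forall>R\<in>Pow J - I. X (At R) s = 0"
        by (intro AE_finite_allI X_empty_set) (auto simp: I_def J_def)
      moreover have "AE s in M. step_int X l s = (\<Sum>R\<in>Pow J. \<phi> R * X (At R) s)"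
        unfolding At_def J_def \<phi>_def by (rule step_int_atoms[OF A lE])
      ultimately show ?thesis
      proof eventually_elim
        case (elim s)
        have "(\<Sum>R\<in>Pow J. \<phi> R * X (At R) s) = (\<Sum>R\<in>I. \<phi> R * X (At R) s)"
          using elim(1) by (intro sum.mono_neutral_right) (auto simp: I_def J_def)
        then show ?case using elim(2) by simp
      qed
    qed
    then have "measure M {s\<in>space M. 6 * K < \<bar>step_int X l s\<bar>} = measure M {s\<in>space M. 6 * K < \<bar>\<Sum>R\<in>I. \<phi> R * X (At R) s\<bar>}"
      by (intro finite_measure_eq_AE) (auto elim: eventually_mono)
    ultimately show ?thesis by simp
  qed
  then show thesis using K1 by (intro that[of "6 * K"]) auto
qed

text \<open>Supplies the convexity hypothesis of \<open>nikishin\<close> for the integrals of unit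
  step functions.\<close>

lemma unit_steps_convex:
  assumes "finite \<D>" "\<And>E. E \<in> \<D> \<Longrightarrow> h E \<in> step_int X ` unit_steps A"
    "\<And>E. E \<in> \<D> \<Longrightarrow> 0 \<le> c E" "sum c \<D> \<le> 1"
  shows "(\<lambda>s. \<Sum>E\<in>\<D>. c E * h E s) \<in> step_int X ` unit_steps A"
proof -
  have "\<forall>E\<in>\<D>. \<exists>l. l \<in> unit_steps A \<and> h E = step_int X l" using assms(2) by blast
  then obtain g where g: "\<And>E. E \<in> \<D> \<Longrightarrow> g E \<in> unit_steps A" "\<And>E. E \<in> \<D> \<Longrightarrow> h E = step_int X (g E)"
    by metis
  have "\<exists>l. snd ` set l \<subseteq> {B\<in>\<E>. B \<subseteq> A} \<and> (\<forall>e. step_fun l e = (\<Sum>E\<in>\<D>. c E * step_fun (g E) e)) \<and>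
    (\<forall>s. step_int X l s = (\<Sum>E\<in>\<D>. c E * step_int X (g E) s))"
    using assms(1) g(1)
  proof (induction \<D>)
    case empty
    show ?case by (rule exI[of _ "[]"]) (simp add: step_fun_def step_int_def)
  next
    case (insert E \<D>)
    then obtain l where l: "snd ` set l \<subseteq> {B\<in>\<E>. B \<subseteq> A}" "\<And>e. step_fun l e = (\<Sum>E\<in>\<D>. c E * step_fun (g E) e)"
      "\<And>s. step_int X l s = (\<Sum>E\<in>\<D>. c E * step_int X (g E) s)" by blast
    have "snd ` set (g E) \<subseteq> {B\<in>\<E>. B \<subseteq> A}" using insert(4)[of E] unfolding unit_steps_def by blast
    then have "snd ` set (step_scale (c E) (g E) @ l) \<subseteq> {B\<in>\<E>. B \<subseteq> A}"
      using l(1) unfolding set_append image_Un snd_step_scale by blast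
    then show ?case using insert(1,2) l(2,3)
      by (intro exI[of _ "step_scale (c E) (g E) @ l"])
        (simp add: step_fun_append step_fun_scale step_int_append step_int_scale)
  qed
  then obtain l where l: "snd ` set l \<subseteq> {B\<in>\<E>. B \<subseteq> A}" "\<And>e. step_fun l e = (\<Sum>E\<in>\<D>. c E * step_fun (g E) e)"
    "\<And>s. step_int X l s = (\<Sum>E\<in>\<D>. c E * step_int X (g E) s)" by blast
  have "\<bar>step_fun l e\<bar> \<le> 1" for e
  proof -
    have "\<bar>step_fun l e\<bar> \<le> (\<Sum>E\<in>\<D>. c E * \<bar>step_fun (g E) e\<bar>)"
      unfolding l(2) using assms(3) by (intro order_trans[OF sum_abs]) (simp add: abs_mult)
    also have "\<dots> \<le> (\<Sum>E\<in>\<D>. c E * 1)"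
      using g(1) assms(3) by (intro sum_mono mult_left_mono) (auto simp: unit_steps_def)
    finally show ?thesis using assms(4) by simp
  qed
  then have "l \<in> unit_steps A" using l(1) unfolding unit_steps_def by blast
  moreover have "(\<lambda>s. \<Sum>E\<in>\<D>. c E * h E s) = step_int X l"
    using g(2) l(3) by (simp add: fun_eq_iff)
  ultimately show ?thesis by blast
qed

end

lemma (in real_L0_measure) atom_list_in_unit_steps:
  assumes A: "A \<in> \<E>" and J: "finite J" "\<And>j. j \<in> J \<Longrightarrow> B j \<in> \<E>"
    and \<phi>: "\<And>R. R \<in> Pow J \<Longrightarrow> \<bar>\<phi> R\<bar> \<le> 1"
  obtains l where "l \<in> unit_steps A"
    "\<And>s. step_int X l s = (\<Sum>R\<in>Pow J. \<phi> R * X (atom A B J R) s)"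
proof -
  obtain Rs where Rs: "set Rs = Pow J" "distinct Rs"
    using finite_distinct_list[of "Pow J"] J(1) by auto
  define l where "l = map (\<lambda>R. (\<phi> R, atom A B J R)) Rs"
  have int: "step_int X l s = (\<Sum>R\<in>Pow J. \<phi> R * X (atom A B J R) s)" for s
    using Rs by (simp add: l_def step_int_def comp_def sum_list_distinct_conv_sum_set)
  have sf: "step_fun l e = (\<Sum>R\<in>Pow J. \<phi> R * indicator (atom A B J R) e)" for e
    using Rs by (simp add: l_def step_fun_def comp_def sum_list_distinct_conv_sum_set)
  have "\<bar>step_fun l e\<bar> \<le> 1" for e
  proof -
    define R0 where "R0 = {j\<in>J. e \<in> B j}"
    have "(\<phi> R * indicator (atom A B J R) e :: real) = (if R = R0 then \<phi> R0 * indicator A e else 0)"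
      if "R \<in> Pow J" for R
      using that by (auto simp: R0_def atom_def indicator_def)
    then have "step_fun l e = (\<Sum>R\<in>Pow J. if R = R0 then \<phi> R0 * indicator A e else 0)"
      unfolding sf by (intro sum.cong) auto
    also have "\<dots> = \<phi> R0 * indicator A e"
      using J(1) by (simp add: R0_def)
    finally show ?thesis
      using \<phi>[of R0] by (auto simp: R0_def indicator_def)
  qed
  moreover have "snd ` set l \<subseteq> {B\<in>\<E>. B \<subseteq> A}"
    using atom_in_dom[OF A J] by (auto simp: l_def atom_def)
  ultimately have "l \<in> unit_steps A" by (simp add: unit_steps_def)
  then show thesis using int that by blast
qed

text \<open>Terms with \<open>\<bar>x j\<bar> \<le> \<psi> j\<close> contribute at most
  \<open>sum a J\<close>. The others are split by Cauchy--Schwarz into a square function and a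
  weighted count of the exceptional events.\<close>

lemma weighted_sum_le_sqrt:
  fixes a x \<psi> :: "'j \<Rightarrow> real"
  assumes "\<And>j. j \<in> J \<Longrightarrow> 0 \<le> a j" "\<And>j. j \<in> J \<Longrightarrow> 0 < \<psi> j" "sum a J \<le> 1"
  shows "(\<Sum>j\<in>J. a j * \<bar>x j\<bar> / \<psi> j) \<le>
    1 + sqrt (\<Sum>j\<in>J. a j * (x j)\<^sup>2) * sqrt (\<Sum>j\<in>J. a j / (\<psi> j)\<^sup>2 * of_bool (\<psi> j < \<bar>x j\<bar>))"
proof -
  let ?b = "\<lambda>j. of_bool (\<psi> j < \<bar>x j\<bar>) :: real"
  have "(\<Sum>j\<in>J. a j * \<bar>x j\<bar> / \<psi> j) \<le> (\<Sum>j\<in>J. a j + (sqrt (a j) * \<bar>x j\<bar>) * (sqrt (a j) / \<psi> j * ?b j))"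
  proof (rule sum_mono)
    fix j assume j: "j \<in> J"
    have sq: "sqrt (a j) * sqrt (a j) = a j" using assms(1)[OF j] by simp
    have "(sqrt (a j) * \<bar>x j\<bar>) * (sqrt (a j) / \<psi> j * ?b j) = (sqrt (a j) * sqrt (a j)) * \<bar>x j\<bar> / \<psi> j * ?b j"
      by simp
    also have "\<dots> = a j * \<bar>x j\<bar> / \<psi> j * ?b j" unfolding sq ..
    finally have eq: "(sqrt (a j) * \<bar>x j\<bar>) * (sqrt (a j) / \<psi> j * ?b j) = a j * \<bar>x j\<bar> / \<psi> j * ?b j" .
    show "a j * \<bar>x j\<bar> / \<psi> j \<le> a j + (sqrt (a j) * \<bar>x j\<bar>) * (sqrt (a j) / \<psi> j * ?b j)"
    proof (cases "\<psi> j < \<bar>x j\<bar>")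
      case True
      then show ?thesis unfolding eq using assms(1)[OF j] by simp
    next
      case False
      then have "a j * \<bar>x j\<bar> \<le> a j * \<psi> j" using assms(1)[OF j] by (intro mult_left_mono) auto
      then show ?thesis unfolding eq using False assms(2)[OF j] by (simp add: field_simps)
    qed
  qed
  also have "\<dots> = sum a J + (\<Sum>j\<in>J. (sqrt (a j) * \<bar>x j\<bar>) * (sqrt (a j) / \<psi> j * ?b j))"
    by (rule sum.distrib)
  also have "\<dots> \<le> 1 + sqrt (\<Sum>j\<in>J. (sqrt (a j) * \<bar>x j\<bar>)\<^sup>2) * sqrt (\<Sum>j\<in>J. (sqrt (a j) / \<psi> j * ?b j)\<^sup>2)"
  proof (intro add_mono assms(3))
    have "(\<Sum>j\<in>J. (sqrt (a j) * \<bar>x j\<bar>) * (sqrt (a j) / \<psi> j * ?b j))\<^sup>2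
      \<le> (\<Sum>j\<in>J. (sqrt (a j) * \<bar>x j\<bar>)\<^sup>2) * (\<Sum>j\<in>J. (sqrt (a j) / \<psi> j * ?b j)\<^sup>2)"
      by (rule Cauchy_Schwarz_ineq_sum)
    then show "(\<Sum>j\<in>J. (sqrt (a j) * \<bar>x j\<bar>) * (sqrt (a j) / \<psi> j * ?b j))
      \<le> sqrt (\<Sum>j\<in>J. (sqrt (a j) * \<bar>x j\<bar>)\<^sup>2) * sqrt (\<Sum>j\<in>J. (sqrt (a j) / \<psi> j * ?b j)\<^sup>2)"
      unfolding real_sqrt_mult[symmetric] by (rule real_le_rsqrt)
  qed
  also have "(\<Sum>j\<in>J. (sqrt (a j) * \<bar>x j\<bar>)\<^sup>2) = (\<Sum>j\<in>J. a j * (x j)\<^sup>2)"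
    using assms(1) by (intro sum.cong) (auto simp: power_mult_distrib)
  also have "(\<Sum>j\<in>J. (sqrt (a j) / \<psi> j * ?b j)\<^sup>2) = (\<Sum>j\<in>J. a j / (\<psi> j)\<^sup>2 * ?b j)"
    using assms(1) by (intro sum.cong) (auto simp: power_mult_distrib power_divide)
  finally show ?thesis .
qed

text \<open>After fourth roots the product of \<open>X\<close> and \<open>W\<close> is separated by
  the inequality of means into \<open>sqrt (sqrt X)\<close>, which the square function estimate
  integrates, and a bound that is linear in \<open>W\<close>.\<close>

lemma sqrt_sqrt_le_of_bound:
  assumes q: "q \<le> \<kappa> * (1 + sqrt X * sqrt W)" and nn: "0 \<le> \<kappa>" "0 \<le> X" "0 \<le> W"
  shows "sqrt (sqrt q) \<le> sqrt (sqrt \<kappa>) * (1 + (sqrt (sqrt X) + (1 + W)) / 2)"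
proof -
  have "sqrt (sqrt q) \<le> sqrt (sqrt (\<kappa> * (1 + sqrt X * sqrt W)))"
    using q by simp
  also have "\<dots> = sqrt (sqrt \<kappa>) * sqrt (sqrt (1 + sqrt X * sqrt W))"
    by (simp add: real_sqrt_mult)
  also have "\<dots> \<le> sqrt (sqrt \<kappa>) * (1 + sqrt (sqrt (sqrt X * sqrt W)))"
  proof (rule mult_left_mono)
    have "sqrt (1 + sqrt X * sqrt W) \<le> 1 + sqrt (sqrt X * sqrt W)"
      using sqrt_add_le_add_sqrt[of 1 "sqrt X * sqrt W"] nn by simp
    then have "sqrt (sqrt (1 + sqrt X * sqrt W)) \<le> sqrt (1 + sqrt (sqrt X * sqrt W))"
      by simp
    also have "\<dots> \<le> 1 + sqrt (sqrt (sqrt X * sqrt W))"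
      using sqrt_add_le_add_sqrt[of 1 "sqrt (sqrt X * sqrt W)"] nn by simp
    finally show "sqrt (sqrt (1 + sqrt X * sqrt W)) \<le> 1 + sqrt (sqrt (sqrt X * sqrt W))" .
  qed (use nn in simp)
  also have "sqrt (sqrt (sqrt X * sqrt W)) = sqrt (sqrt (sqrt X) * sqrt (sqrt W))"
    by (simp add: real_sqrt_mult)
  also have "\<dots> \<le> (sqrt (sqrt X) + sqrt (sqrt W)) / 2"
    using nn by (intro arith_geo_mean_sqrt) auto
  also have "sqrt (sqrt W) \<le> 1 + W"
    using arith_geo_mean_sqrt[of 1 W] arith_geo_mean_sqrt[of 1 "sqrt W"] nn by simp
  finally show ?thesis using nn by (simp add: mult_left_mono)
qed

context real_L0_measure
begin

text \<open>
  The cube root makes \<open>\<bar>X B\<bar> > gauge3 B\<close> an event of measure \<open>O((gauge3 B)\<^sup>2)\<close>, as needed to apply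
  the Cauchy--Schwarz inequality against the square function.
\<close>

definition gauge3 :: "'e set \<Rightarrow> real" where
  "gauge3 B = root 3 (eta B)"

lemma gauge3_pow: "gauge3 B ^ 3 = eta B"
  unfolding gauge3_def using eta_nonneg by simp

lemma gauge3_nonneg: "0 \<le> gauge3 B"
  unfolding gauge3_def using eta_nonneg by simp

text \<open>For gauge at most 1, Markov's inequality bounds gauge times measure by the cube of the
  gauge; for larger gauge the total mass suffices.\<close>

lemma measure_gt_gauge3_le:
  assumes B: "B \<in> \<E>" and pos: "0 < gauge3 B"
  shows "measure M {s\<in>space M. gauge3 B < \<bar>X B s\<bar>} / (gauge3 B)\<^sup>2 \<le> 1 + measure M (space M)"
proof -
  let ?p = "gauge3 B" and ?m = "measure M {s\<in>space M. gauge3 B < \<bar>X B s\<bar>}"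
  note [measurable] = X_meas[OF B]
  have "?m \<le> measure M {s\<in>space M. ?p \<le> \<bar>X B s\<bar>}" by (rule finite_measure_mono) auto
  then have "min 1 ?p * ?m \<le> min 1 ?p * measure M {s\<in>space M. ?p \<le> \<bar>X B s\<bar>}"
    using pos by (intro mult_left_mono) auto
  also have "\<dots> \<le> rho M (X B)" by (rule measure_ge_le_rho) measurable
  also have "\<dots> \<le> ?p ^ 3" unfolding gauge3_pow using B by (intro rho_le_eta) auto
  finally have le: "min 1 ?p * ?m \<le> ?p ^ 3" .
  show ?thesis
  proof (cases "?p \<le> 1")
    case True
    then have "?p * ?m \<le> ?p * ?p\<^sup>2" using le by (simp add: power3_eq_cube power2_eq_square)
    then have "?m \<le> ?p\<^sup>2" using pos by simp
    then have "?m / ?p\<^sup>2 \<le> 1" using pos by simp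
    then show ?thesis using measure_nonneg[of M "space M"] by linarith
  next
    case False
    then have "1 \<le> ?p\<^sup>2" by simp
    then have "?m / ?p\<^sup>2 \<le> ?m / 1" by (intro divide_left_mono) auto
    also have "\<dots> \<le> measure M (space M)" using bounded_measure by simp
    finally show ?thesis by simp
  qed
qed

text \<open>If a representation has cost \<open>\<kappa>\<close>, then
  \<open>\<bar>X A\<bar>\<close> is at most \<open>\<kappa>\<close> times an average of the
  quotients \<open>\<bar>X (B j)\<bar> / gauge3 (B j)\<close>. On a large set the fourth root of
  this average has an integral bounded independently of the representation, so
  \<open>\<kappa>\<close> cannot be small while \<open>X A\<close> is not null.\<close>

lemma bounded_gauge_subsets:
  assumes A: "A \<in> \<E>" and b: "bounded_on A" and ne: "\<not> (AE s in M. X A s = 0)"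
  obtains a where "0 < a"
    "\<And>l. snd ` set l \<subseteq> {B\<in>\<E>. B \<subseteq> A} \<Longrightarrow> step_fun l = indicator A \<Longrightarrow> a \<le> step_cost gauge3 l"
proof -
  note [measurable] = X_meas[OF A]
  define T where "T = measure M (space M)"
  define m0 where "m0 = measure M {s\<in>space M. X A s \<noteq> 0}"
  have m0: "0 < m0"
  proof (rule ccontr)
    assume "\<not> 0 < m0"
    then have "m0 = 0" unfolding m0_def using measure_nonneg[of M "{s\<in>space M. X A s \<noteq> 0}"] by linarith
    then have "emeasure M {s\<in>space M. X A s \<noteq> 0} = 0" by (simp add: emeasure_eq_measure m0_def)
    then have "AE s in M. X A s = 0" by (subst AE_iff_measurable[OF _ refl]) auto
    then show False using ne by simp
  qed
  \<comment> \<open>With the level \<open>m0 / 4\<close>, Nikishin's exceptional set has measure at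
    most \<open>m0 / 2\<close>, so \<open>X A\<close> is still nonzero on a non-null part of
    \<open>G\<close>.\<close>
  obtain K where K: "0 < K" "\<And>l. l \<in> unit_steps A \<Longrightarrow> measure M {s\<in>space M. K < \<bar>step_int X l s\<bar>} \<le> m0 / 4"
    using unit_steps_bounded[OF A b, of "m0 / 4"] m0 by auto
  have um: "step_int X l \<in> borel_measurable M" if "l \<in> unit_steps A" for l
    using that unfolding unit_steps_def by (intro step_int_meas) blast
  obtain G C where G: "G \<in> sets M" "measure M (space M - G) \<le> 2 * (m0 / 4)" "0 \<le> C"
    "\<And>y t. y \<in> step_int X ` unit_steps A \<Longrightarrow> 0 < t \<Longrightarrow> t * measure M {s\<in>G. t \<le> \<bar>y s\<bar>} \<le> C"
  proof (rule nikishin[of "step_int X ` unit_steps A" K "m0 / 4"])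
    show "(\<lambda>s. \<Sum>E\<in>\<D>. c E * h E s) \<in> step_int X ` unit_steps A"
      if "finite \<D>" "\<And>E. E \<in> \<D> \<Longrightarrow> h E \<in> step_int X ` unit_steps A"
        "\<And>E. E \<in> \<D> \<Longrightarrow> 0 \<le> c E" "sum c \<D> \<le> 1" for \<D> :: "'s set set" and c h
      by (rule unit_steps_convex[OF that])
  qed (use K um that in auto)
  define N where "N = restrict_space M G"
  interpret N: finite_measure N
    unfolding N_def by (rule finite_measure_restrict_space) (use G in \<open>auto intro: finite_measure_axioms\<close>)
  have spN: "space N = G" using G(1) by (simp add: N_def)
  have Gs: "G \<subseteq> space M" using G(1) by (rule sets.sets_into_space)
  have Nmeas: "y \<in> borel_measurable N" if "y \<in> borel_measurable M" for y :: "'s \<Rightarrow> real"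
    unfolding N_def using that by (rule measurable_restrict_space1)
  have NAE: "AE s in N. P s" if "AE s in M. P s" for P
    unfolding N_def using that G(1) by (subst AE_restrict_space_iff) (auto elim: eventually_mono)
  have Nm: "measure N E = measure M E" if "E \<subseteq> G" for E
    unfolding N_def using that G(1) by (intro measure_restrict_space) auto
  have Nm_le: "measure N {s\<in>space N. P s} \<le> measure M {s\<in>space M. P s}"
    if [measurable]: "Measurable.pred M P" for P
  proof -
    have "measure N {s\<in>space N. P s} = measure M {s\<in>G. P s}" by (subst Nm) (auto simp: spN)
    also have "\<dots> \<le> measure M {s\<in>space M. P s}"
      using Gs by (intro finite_measure_mono) auto
    finally show ?thesis .
  qed
  have NT: "measure N (space N) \<le> T"
    unfolding T_def spN Nm[OF order_refl] by (rule bounded_measure)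
  define C1 where "C1 = T + 4 * C"
  have sq: "integrable N (\<lambda>s. sqrt \<bar>step_int X l s\<bar>)" "(\<integral>s. sqrt \<bar>step_int X l s\<bar> \<partial>N) \<le> C1"
    if l: "l \<in> unit_steps A" for l
  proof -
    have "t * measure N {s\<in>space N. t \<le> \<bar>step_int X l s\<bar>} \<le> C" if "0 < t" for t
      using G(4)[of "step_int X l" t] l that by (subst Nm) (auto simp: spN)
    note * = N.integrable_sqrt_of_weak_type[OF Nmeas[OF um[OF l]] G(3) this]
    show "integrable N (\<lambda>s. sqrt \<bar>step_int X l s\<bar>)" by (rule *(1))
    show "(\<integral>s. sqrt \<bar>step_int X l s\<bar> \<partial>N) \<le> C1" using *(2) NT unfolding C1_def by linarith
  qed
  have XA_int: "integrable N (\<lambda>s. sqrt \<bar>X A s\<bar>)"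
    using sq(1)[of "[(1, A)]"] A by (simp add: unit_steps_def step_fun_def step_int_def indicator_def)
  have XA4_int: "integrable N (\<lambda>s. sqrt (sqrt \<bar>X A s\<bar>))"
  proof (rule Bochner_Integration.integrable_bound)
    show "integrable N (\<lambda>s. 1 + sqrt \<bar>X A s\<bar>)" using XA_int by auto
    show "(\<lambda>s. sqrt (sqrt \<bar>X A s\<bar>)) \<in> borel_measurable N"
      by (intro Nmeas) measurable
    have "sqrt z \<le> 1 + z" if "0 \<le> z" for z :: real
      using arith_geo_mean_sqrt[of 1 z] that by simp
    then have "sqrt (sqrt \<bar>X A s\<bar>) \<le> 1 + sqrt \<bar>X A s\<bar>" for s by simp
    then show "AE s in N. norm (sqrt (sqrt \<bar>X A s\<bar>)) \<le> norm (1 + sqrt \<bar>X A s\<bar>)"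
      by (intro AE_I2) auto
  qed
  define I0 where "I0 = (\<integral>s. sqrt (sqrt \<bar>X A s\<bar>) \<partial>N)"
  have I0: "0 < I0"
  proof (rule ccontr)
    assume "\<not> 0 < I0"
    moreover have "0 \<le> I0" unfolding I0_def by (rule integral_nonneg_AE) auto
    ultimately have "I0 = 0" by simp
    then have "AE s in N. sqrt (sqrt \<bar>X A s\<bar>) = 0"
      using integral_nonneg_eq_0_iff_AE[OF XA4_int] unfolding I0_def by auto
    then have "AE s in M. s \<in> G \<longrightarrow> X A s = 0"
      unfolding N_def using G(1) by (subst (asm) AE_restrict_space_iff) (auto elim!: eventually_mono)
    then have "m0 \<le> measure M (space M - G)"
      unfolding m0_def using G(1) by (intro finite_measure_mono_AE) (auto elim!: eventually_mono)
    then show False using G(2) m0 by simp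
  qed
  \<comment> \<open>The integral of the final pointwise majorant without the factor
    \<open>sqrt (sqrt \<kappa>)\<close>: \<open>T\<close> bounds the mass, \<open>1800 * C1\<close>
    the square function and \<open>1 + T\<close> the exceptional events.\<close>
  define D where "D = T + (1800 * C1 + (T + (1 + T))) / 2"
  have T0: "0 \<le> T" by (simp add: T_def)
  have D: "0 < D" unfolding D_def C1_def using G(3) T0 by (auto intro!: add_nonneg_pos)
  have main: "(I0 / D) ^ 4 \<le> step_cost gauge3 l"
    if l: "snd ` set l \<subseteq> {B\<in>\<E>. B \<subseteq> A}" "step_fun l = indicator A" for l
  proof -
    define J0 where "J0 = {..<length l}"
    define B where "B j = snd (l ! j)" for j
    define c where "c j = fst (l ! j)" for j
    \<comment> \<open>Sets of gauge zero are dropped before dividing by the gauge; \<open>X\<close>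
      vanishes on them almost everywhere.\<close>
    define J where "J = {j\<in>J0. 0 < gauge3 (B j)}"
    define \<kappa> where "\<kappa> = (\<Sum>j\<in>J. \<bar>c j\<bar> * gauge3 (B j))"
    have fJ: "finite J0" "finite J" by (auto simp: J0_def J_def)
    have B: "B j \<in> \<E>" "B j \<subseteq> A" if "j \<in> J0" for j
    proof -
      have "snd (l ! j) \<in> snd ` set l" using that by (auto simp: J0_def)
      then show "B j \<in> \<E>" "B j \<subseteq> A" using l(1) unfolding B_def by blast+
    qed
    have [measurable]: "j \<in> J \<Longrightarrow> X (B j) \<in> borel_measurable M" for j
      using B by (auto simp: J_def intro!: X_meas)
    have cost: "step_cost gauge3 l = \<kappa>"
      unfolding step_cost_nth \<kappa>_def B_def[symmetric] c_def[symmetric] J0_def[symmetric]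
      using gauge3_nonneg
      by (intro sum.mono_neutral_right) (auto simp: fJ J_def not_less intro: antisym)
    have lE: "snd ` set l \<subseteq> \<E>" using l(1) by blast
    have "AE s in M. step_int X [(1, A)] s = step_int X l s"
      by (rule step_int_cong_AE) (use A lE l(2) in \<open>auto simp: fun_eq_iff step_fun_def\<close>)
    moreover have "AE s in M. \<forall>j\<in>J0 - J. X (B j) s = 0"
    proof (rule AE_finite_allI)
      fix j assume j: "j \<in> J0 - J"
      then have "gauge3 (B j) = 0" using gauge3_nonneg[of "B j"] by (simp add: J_def)
      then have "rho M (X (B j)) \<le> 0" using gauge3_pow[of "B j"] rho_le_eta[of "B j" "B j"] B j by auto
      then have "rho M (X (B j)) = 0" using rho_nonneg[of "X (B j)"] by linarith
      then show "AE s in M. X (B j) s = 0" using B j by (intro rho_eq_0_imp_AE X_meas) auto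
    qed (use fJ in auto)
    ultimately have XA: "AE s in M. X A s = (\<Sum>j\<in>J. c j * X (B j) s)"
    proof eventually_elim
      case (elim s)
      have "X A s = (\<Sum>j\<in>J0. c j * X (B j) s)"
        using elim(1) by (simp add: step_int_nth[of X l] J0_def c_def B_def) (simp add: step_int_def)
      also have "\<dots> = (\<Sum>j\<in>J. c j * X (B j) s)"
        using elim(2) by (intro sum.mono_neutral_right) (auto simp: fJ J_def)
      finally show ?case .
    qed
    have \<kappa>0: "0 \<le> \<kappa>" unfolding \<kappa>_def by (intro sum_nonneg) (auto simp: gauge3_nonneg)
    have \<kappa>: "0 < \<kappa>"
    proof (rule ccontr)
      assume "\<not> 0 < \<kappa>"
      then have "\<kappa> = 0" using \<kappa>0 by simp
      then have "c j = 0" if "j \<in> J" for j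
        using that unfolding \<kappa>_def by (subst (asm) sum_nonneg_eq_0_iff) (auto simp: fJ J_def)
      then have "AE s in M. X A s = 0" using XA by (auto elim!: eventually_mono)
      then show False using ne by simp
    qed
    \<comment> \<open>Probability weights: the share of each piece in the cost.\<close>
    define a where "a j = \<bar>c j\<bar> * gauge3 (B j) / \<kappa>" for j
    have a: "0 \<le> a j" for j using \<kappa> by (simp add: a_def gauge3_nonneg)
    have a1: "sum a J = 1" using \<kappa> unfolding a_def sum_divide_distrib[symmetric] \<kappa>_def by simp
    define At where "At = atom A B J0"
    have AtE: "At R \<in> \<E>" for R unfolding At_def by (rule atom_in_dom[OF A fJ(1) B(1)])
    \<comment> \<open>The indicator of \<open>B j\<close> in terms of atoms, scaled by
      \<open>sqrt (a j)\<close>. The squares sum to at most \<open>sum a J = 1\<close> on each atom,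
      and the square sum becomes the weighted sum of the \<open>(X (B j))^2\<close>.\<close>
    define f where "f j R = sqrt (a j) * of_bool (j \<in> R)" for j and R :: "nat set"
    define Xs where "Xs = square_sum (Pow J0) (\<lambda>R. X (At R)) J f"
    have Nx: "X (At R) \<in> borel_measurable N" for R by (intro Nmeas X_meas AtE)
    have Nsq: "integrable N (\<lambda>s. sqrt \<bar>\<Sum>R\<in>Pow J0. \<phi> R * X (At R) s\<bar>)"
      "(\<integral>s. sqrt \<bar>\<Sum>R\<in>Pow J0. \<phi> R * X (At R) s\<bar> \<partial>N) \<le> C1"
      if \<phi>: "\<And>R. R \<in> Pow J0 \<Longrightarrow> \<bar>\<phi> R\<bar> \<le> 1" for \<phi>
    proof -
      obtain l' where l': "l' \<in> unit_steps A" "\<And>s. step_int X l' s = (\<Sum>R\<in>Pow J0. \<phi> R * X (At R) s)"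
        using atom_list_in_unit_steps[of A J0 B \<phi>, OF A fJ(1) B(1) \<phi>] unfolding At_def by blast
      show "integrable N (\<lambda>s. sqrt \<bar>\<Sum>R\<in>Pow J0. \<phi> R * X (At R) s\<bar>)"
        "(\<integral>s. sqrt \<bar>\<Sum>R\<in>Pow J0. \<phi> R * X (At R) s\<bar> \<partial>N) \<le> C1"
        using sq[OF l'(1)] unfolding l'(2) .
    qed
    have f1: "(\<Sum>j\<in>J. (f j R)\<^sup>2) \<le> 1" for R
    proof -
      have "(\<Sum>j\<in>J. (f j R)\<^sup>2) \<le> (\<Sum>j\<in>J. a j)"
        using a by (intro sum_mono) (auto simp: f_def)
      then show ?thesis using a1 by simp
    qed
    have fP: "finite (Pow J0)" using fJ(1) by simp
    have Xs_int: "integrable N (\<lambda>s. sqrt (sqrt (Xs s)))" "(\<integral>s. sqrt (sqrt (Xs s)) \<partial>N) \<le> 1800 * C1"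
      unfolding Xs_def
      by (rule N.square_function_le[OF fP Nx Nsq fJ(2) f1]; assumption)+
    have Xs_eq: "AE s in M. Xs s = (\<Sum>j\<in>J. a j * (X (B j) s)\<^sup>2)"
    proof -
      have "AE s in M. X (B j) s = (\<Sum>R\<in>{R\<in>Pow J0. j \<in> R}. X (At R) s)" if "j \<in> J" for j
      proof -
        have j: "j \<in> J0" using that by (simp add: J_def)
        show ?thesis
          using X_sum_atoms[OF A fJ(1), of B "{R\<in>Pow J0. j \<in> R}"] B(1)
          unfolding UN_atom_mem[of j J0 B A, OF j B(2)[OF j]] At_def by blast
      qed
      then have "AE s in M. \<forall>j\<in>J. X (B j) s = (\<Sum>R\<in>{R\<in>Pow J0. j \<in> R}. X (At R) s)"
        using fJ by (intro AE_finite_allI) auto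
      then show ?thesis
      proof eventually_elim
        case (elim s)
        have "(\<Sum>R\<in>Pow J0. f j R * X (At R) s)\<^sup>2 = a j * (X (B j) s)\<^sup>2" if j: "j \<in> J" for j
        proof -
          have "(\<Sum>R\<in>Pow J0. f j R * X (At R) s) = (\<Sum>R\<in>Pow J0. if j \<in> R then sqrt (a j) * X (At R) s else 0)"
            by (intro sum.cong) (auto simp: f_def)
          also have "\<dots> = (\<Sum>R\<in>{R\<in>Pow J0. j \<in> R}. sqrt (a j) * X (At R) s)"
            using fJ(1) by (intro sum.inter_filter[symmetric]) auto
          also have "\<dots> = sqrt (a j) * X (B j) s"
            using elim j by (simp add: sum_distrib_left)
          finally show ?thesis using a by (simp add: power_mult_distrib)
        qed
        then show ?case unfolding Xs_def square_sum_def by (intro sum.cong) auto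
      qed
    qed
    \<comment> \<open>Its integral stays bounded because the event for \<open>j\<close> has measure
      at most \<open>(1 + T)\<close> times the squared gauge, which cancels the denominator.\<close>
    define W where "W s = (\<Sum>j\<in>J. a j / (gauge3 (B j))\<^sup>2 * of_bool (gauge3 (B j) < \<bar>X (B j) s\<bar>))" for s
    have W0: "0 \<le> W s" for s unfolding W_def using a by (intro sum_nonneg) auto
    have pb: "Measurable.pred M (\<lambda>s. gauge3 (B j) < \<bar>X (B j) s\<bar>)" if "j \<in> J" for j
      using that by measurable
    have Wj: "integrable N (\<lambda>s. of_bool (gauge3 (B j) < \<bar>X (B j) s\<bar>) :: real)"
      "(\<integral>s. of_bool (gauge3 (B j) < \<bar>X (B j) s\<bar>) \<partial>N) \<le> measure M {s\<in>space M. gauge3 (B j) < \<bar>X (B j) s\<bar>}"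
      if j: "j \<in> J" for j
    proof -
      let ?E = "{s\<in>space N. gauge3 (B j) < \<bar>X (B j) s\<bar>}"
      have [measurable]: "X (B j) \<in> borel_measurable N" using j by (intro Nmeas) measurable
      have i: "integrable N (indicator ?E :: 's \<Rightarrow> real)"
        by (intro integrable_real_indicator) (auto simp: N.emeasure_eq_measure)
      have eq: "indicator ?E s = (of_bool (gauge3 (B j) < \<bar>X (B j) s\<bar>) :: real)" if "s \<in> space N" for s
        using that by (auto simp: indicator_def)
      show "integrable N (\<lambda>s. of_bool (gauge3 (B j) < \<bar>X (B j) s\<bar>) :: real)"
        using i by (rule Bochner_Integration.integrable_cong[THEN iffD1, rotated 2]) (auto simp: eq)
      have "(\<integral>s. of_bool (gauge3 (B j) < \<bar>X (B j) s\<bar>) \<partial>N) = (\<integral>s. indicator ?E s \<partial>N)"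
        by (rule Bochner_Integration.integral_cong) (auto simp: eq)
      also have "\<dots> = measure N ?E" by simp
      also have "\<dots> \<le> measure M {s\<in>space M. gauge3 (B j) < \<bar>X (B j) s\<bar>}"
        by (rule Nm_le[OF pb[OF j]])
      finally show "(\<integral>s. of_bool (gauge3 (B j) < \<bar>X (B j) s\<bar>) \<partial>N) \<le> measure M {s\<in>space M. gauge3 (B j) < \<bar>X (B j) s\<bar>}" .
    qed
    have W_int: "integrable N W" unfolding W_def using Wj(1) by auto
    have W_le: "(\<integral>s. W s \<partial>N) \<le> 1 + T"
    proof -
      have "(\<integral>s. W s \<partial>N) = (\<Sum>j\<in>J. a j / (gauge3 (B j))\<^sup>2 * (\<integral>s. of_bool (gauge3 (B j) < \<bar>X (B j) s\<bar>) \<partial>N))"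
        unfolding W_def using Wj(1) by (subst Bochner_Integration.integral_sum) auto
      also have "\<dots> \<le> (\<Sum>j\<in>J. a j / (gauge3 (B j))\<^sup>2 * measure M {s\<in>space M. gauge3 (B j) < \<bar>X (B j) s\<bar>})"
        using Wj(2) a by (intro sum_mono mult_left_mono) auto
      also have "\<dots> \<le> (\<Sum>j\<in>J. a j * (1 + T))"
      proof (rule sum_mono)
        fix j assume j: "j \<in> J"
        then have le: "measure M {s\<in>space M. gauge3 (B j) < \<bar>X (B j) s\<bar>} / (gauge3 (B j))\<^sup>2 \<le> 1 + T"
          unfolding T_def using B by (intro measure_gt_gauge3_le) (auto simp: J_def)
        show "a j / (gauge3 (B j))\<^sup>2 * measure M {s\<in>space M. gauge3 (B j) < \<bar>X (B j) s\<bar>} \<le> a j * (1 + T)"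
          using mult_left_mono[OF le a[of j]] by simp
      qed
      also have "\<dots> = 1 + T" using a1 by (simp flip: sum_distrib_right)
      finally show ?thesis .
    qed
    have pt: "AE s in N. sqrt (sqrt \<bar>X A s\<bar>) \<le> sqrt (sqrt \<kappa>) * (1 + (sqrt (sqrt (Xs s)) + (1 + W s)) / 2)"
    proof (rule NAE)
      show "AE s in M. sqrt (sqrt \<bar>X A s\<bar>) \<le> sqrt (sqrt \<kappa>) * (1 + (sqrt (sqrt (Xs s)) + (1 + W s)) / 2)"
        using XA Xs_eq
      proof eventually_elim
        case (elim s)
        have "\<bar>X A s\<bar> \<le> (\<Sum>j\<in>J. \<bar>c j\<bar> * \<bar>X (B j) s\<bar>)"
          unfolding elim(1) by (rule order_trans[OF sum_abs]) (simp add: abs_mult)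
        also have "\<dots> = \<kappa> * (\<Sum>j\<in>J. a j * \<bar>X (B j) s\<bar> / gauge3 (B j))"
          unfolding sum_distrib_left a_def using \<kappa> by (intro sum.cong) (auto simp: J_def)
        also have "\<dots> \<le> \<kappa> * (1 + sqrt (Xs s) * sqrt (W s))"
          unfolding elim(2) W_def using a a1 \<kappa>0
          by (intro mult_left_mono weighted_sum_le_sqrt) (auto simp: J_def)
        finally show ?case
          by (rule sqrt_sqrt_le_of_bound[OF _ \<kappa>0 _ W0]) (simp add: Xs_def square_sum_def sum_nonneg)
      qed
    qed
    have "I0 \<le> (\<integral>s. sqrt (sqrt \<kappa>) * (1 + (sqrt (sqrt (Xs s)) + (1 + W s)) / 2) \<partial>N)"
      unfolding I0_def using Xs_int(1) W_int by (intro integral_mono_AE XA4_int pt) auto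
    also have "\<dots> = sqrt (sqrt \<kappa>) * (measure N (space N) + ((\<integral>s. sqrt (sqrt (Xs s)) \<partial>N) + (measure N (space N) + (\<integral>s. W s \<partial>N))) / 2)"
      using Xs_int(1) W_int by simp
    also have "\<dots> \<le> sqrt (sqrt \<kappa>) * D"
      unfolding D_def using NT Xs_int(2) W_le \<kappa>0 by (intro mult_left_mono add_mono divide_right_mono) auto
    finally have "I0 / D \<le> sqrt (sqrt \<kappa>)" using D by (simp add: field_simps)
    then have "(I0 / D) ^ 4 \<le> sqrt (sqrt \<kappa>) ^ 4" using I0 D by (intro power_mono) auto
    also have "sqrt (sqrt \<kappa>) ^ 4 = ((sqrt (sqrt \<kappa>))\<^sup>2)\<^sup>2" by (simp flip: power_mult)
    also have "\<dots> = \<kappa>" using \<kappa>0 by simp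
    finally show ?thesis unfolding cost .
  qed
  show thesis by (rule that[of "(I0 / D) ^ 4"]) (use I0 D main in auto)
qed

end

section \<open>Control measures\<close>

lemma (in real_L0_measure) ex_dominated_measure:
  assumes A: "A \<in> \<E>" and ne: "\<not> (AE s in M. X A s = 0)"
  obtains \<nu> where "finite_measure \<nu>" "space \<nu> = \<Omega>" "sets \<nu> = \<E>" "0 < measure \<nu> A"
    "\<And>B. B \<in> \<E> \<Longrightarrow> eta B = 0 \<Longrightarrow> measure \<nu> B = 0"
proof -
  \<comment> \<open>Both cases are brought to a gauge \<open>\<Psi> (eta B)\<close> with
    \<open>\<Psi>\<close> monotone and continuous at \<open>\<Psi> 0 = 0\<close>, so that
    monotonicity, continuity and null sets carry over from \<open>eta\<close>.\<close>
  have "\<exists>\<Psi> a. 0 < a \<and> (\<forall>t\<ge>0. 0 \<le> \<Psi> t) \<and> mono \<Psi> \<and> isCont \<Psi> 0 \<and> \<Psi> 0 = 0 \<and>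
    (\<forall>l. snd ` set l \<subseteq> \<E> \<longrightarrow> step_fun l = indicator A \<longrightarrow> a \<le> step_cost (\<lambda>B. \<Psi> (eta B)) l)"
  proof (cases "bounded_on A")
    case True
    obtain a where a: "0 < a" "\<And>l. snd ` set l \<subseteq> {B\<in>\<E>. B \<subseteq> A} \<Longrightarrow> step_fun l = indicator A \<Longrightarrow> a \<le> step_cost gauge3 l"
      using bounded_gauge_subsets[OF A True ne] by blast
    have "a \<le> step_cost (\<lambda>B. root 3 (eta B)) l" if l: "snd ` set l \<subseteq> \<E>" "step_fun l = indicator A" for l
    proof -
      \<comment> \<open>Intersecting every set with \<open>A\<close> leaves the represented
        indicator unchanged and does not raise the cost, since \<open>eta\<close> is
        monotone.\<close>
      define l' where "l' = map (\<lambda>(c, B). (c, B \<inter> A)) l"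
      have "a \<le> step_cost gauge3 l'"
      proof (rule a(2))
        show "snd ` set l' \<subseteq> {B\<in>\<E>. B \<subseteq> A}"
          using l(1) A by (fastforce simp: l'_def)
        have "step_fun l' e = step_fun l e * indicator A e" for e
          unfolding l'_def by (induction l) (auto simp: step_fun_def indicator_def algebra_simps)
        then show "step_fun l' = indicator A" using l(2) by (auto simp: fun_eq_iff indicator_def)
      qed
      also have "\<dots> \<le> step_cost (\<lambda>B. root 3 (eta B)) l"
        unfolding l'_def
        by (induction l) (auto simp: step_cost_def gauge3_def eta_mono intro!: add_mono mult_left_mono)
      finally show ?thesis .
    qed
    then show ?thesis
      using a(1) by (intro exI[of _ "root 3"] exI[of _ a]) (auto simp: mono_def isCont_real_root)
  next
    case False
    then obtain a where a: "0 < a" "\<And>K. \<exists>C\<in>\<E>. C \<subseteq> A \<and> a < measure M {s\<in>space M. K < \<bar>X C s\<bar>}"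
      unfolding bounded_on_def by (force simp: not_le)
    have "a \<le> step_cost (\<lambda>B. 2 * eta B) l" if "snd ` set l \<subseteq> \<E>" "step_fun l = indicator A" for l
      by (rule unbounded_gauge[OF A a(2) that])
    then show ?thesis
      using a(1) by (intro exI[of _ "\<lambda>t. 2 * t"] exI[of _ a]) (auto simp: mono_def)
  qed
  then obtain \<Psi> a where \<Psi>: "0 < a" "\<And>t. 0 \<le> t \<Longrightarrow> 0 \<le> \<Psi> t" "mono \<Psi>" "isCont \<Psi> 0" "\<Psi> 0 = 0"
    and low: "\<And>l. snd ` set l \<subseteq> \<E> \<Longrightarrow> step_fun l = indicator A \<Longrightarrow> a \<le> step_cost (\<lambda>B. \<Psi> (eta B)) l"
    by blast
  have "(\<lambda>i. \<Psi> (eta (B i))) \<longlonglongrightarrow> 0" if "range B \<subseteq> \<E>" "decseq B" "(\<Inter>i. B i) = {}" for B :: "nat \<Rightarrow> 'e set"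
    using isCont_tendsto_compose[OF \<Psi>(4) eta_decseq_tendsto_0[OF that]] \<Psi>(5) by simp
  then obtain \<nu> where \<nu>: "finite_measure \<nu>" "space \<nu> = \<Omega>" "sets \<nu> = \<E>" "0 < measure \<nu> A"
    "\<And>B. B \<in> \<E> \<Longrightarrow> measure \<nu> B \<le> \<Psi> (eta B)"
    using ex_measure_le_gauge[OF dom.sigma_algebra_axioms \<Psi>(2)[OF eta_nonneg] monoD[OF \<Psi>(3) eta_mono] _ A \<Psi>(1) low]
    by blast
  have "measure \<nu> B = 0" if "B \<in> \<E>" "eta B = 0" for B
    using \<nu>(5)[OF that(1)] that(2) \<Psi>(5) by (simp add: measure_le_0_iff)
  then show thesis using \<nu> that by blast
qed

section \<open>Summing and gluing countably many measures\<close>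

lemma suminf_ennreal_swap:
  fixes f :: "nat \<Rightarrow> nat \<Rightarrow> ennreal"
  shows "(\<Sum>i. \<Sum>n. f i n) = (\<Sum>n. \<Sum>i. f i n)"
  using nn_integral_suminf[of f "count_space UNIV"] by (simp add: nn_integral_count_space_nat)

lemma ex_measure_sum:
  fixes \<nu> :: "nat \<Rightarrow> 'e measure"
  assumes fin: "\<And>n. finite_measure (\<nu> n)" and sp: "\<And>n. space (\<nu> n) = \<Omega>" and se: "\<And>n. sets (\<nu> n) = \<E>"
  obtains \<mu> where "finite_measure \<mu>" "space \<mu> = \<Omega>" "sets \<mu> = \<E>"
    "\<And>B n. B \<in> \<E> \<Longrightarrow> emeasure \<mu> B = 0 \<Longrightarrow> measure (\<nu> n) B = 0"
proof -
  \<comment> \<open>The weights bring the n-th total mass below \<open>(1 / 2) ^ n\<close>; adding 1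
    to the denominator covers the zero measure.\<close>
  define w where "w n = (1 / 2) ^ n / (measure (\<nu> n) \<Omega> + 1)" for n
  have w: "0 < w n" "w n * measure (\<nu> n) \<Omega> \<le> (1 / 2) ^ n" for n
  proof -
    have p: "0 < measure (\<nu> n) \<Omega> + 1" by (rule add_nonneg_pos) auto
    then show "0 < w n" by (simp add: w_def)
    have "measure (\<nu> n) \<Omega> / (measure (\<nu> n) \<Omega> + 1) \<le> 1" using p by simp
    then have "(1 / 2) ^ n * (measure (\<nu> n) \<Omega> / (measure (\<nu> n) \<Omega> + 1)) \<le> (1 / 2 :: real) ^ n * 1"
      by (intro mult_left_mono) auto
    then show "w n * measure (\<nu> n) \<Omega> \<le> (1 / 2) ^ n" by (simp add: w_def)
  qed
  define F where "F B = (\<Sum>n. ennreal (w n) * emeasure (\<nu> n) B)" for B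
  have sa: "sigma_algebra \<Omega> \<E>" using sets.sigma_algebra_axioms[of "\<nu> 0"] by (simp add: sp se)
  interpret sigma_algebra \<Omega> \<E> by (rule sa)
  define \<mu> where "\<mu> = measure_of \<Omega> \<E> F"
  have sets: "sets \<mu> = \<E>" and space: "space \<mu> = \<Omega>"
    unfolding \<mu>_def using space_closed by (auto simp: sets_measure_of_eq)
  have "countably_additive \<E> F"
  proof (rule countably_additiveI)
    fix A :: "nat \<Rightarrow> 'e set" assume A: "range A \<subseteq> \<E>" "disjoint_family A"
    have "(\<Sum>i. F (A i)) = (\<Sum>n. \<Sum>i. ennreal (w n) * emeasure (\<nu> n) (A i))"
      unfolding F_def by (rule suminf_ennreal_swap)
    also have "\<dots> = F (\<Union>i. A i)"
      unfolding F_def using A by (simp add: suminf_emeasure se)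
    finally show "(\<Sum>i. F (A i)) = F (\<Union>i. A i)" .
  qed
  then have em: "emeasure \<mu> B = F B" if "B \<in> \<E>" for B
    using emeasure_measure_of[OF \<mu>_def space_closed, of B] that
    by (simp add: sets positive_def F_def)
  have fe: "emeasure (\<nu> n) B = ennreal (measure (\<nu> n) B)" for n B
    using finite_measure.emeasure_eq_measure[OF fin] .
  show thesis
  proof
    have "F \<Omega> \<le> (\<Sum>n. ennreal ((1 / 2) ^ n))"
      unfolding F_def fe using w by (intro suminf_le) (auto simp: ennreal_mult[symmetric] less_imp_le intro!: ennreal_leI)
    also have "\<dots> = ennreal 2"
      using geometric_sums[of "1 / 2 :: real"] by (intro suminf_ennreal_eq) auto
    finally have "F \<Omega> < top" by (rule order_le_less_trans) simp
    then have "emeasure \<mu> (space \<mu>) \<noteq> \<infinity>" unfolding space em[OF top] by simp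
    then show "finite_measure \<mu>" by (rule finite_measureI)
    show "space \<mu> = \<Omega>" "sets \<mu> = \<E>" by fact+
    fix B n assume B: "B \<in> \<E>" "emeasure \<mu> B = 0"
    have "ennreal (w n) * emeasure (\<nu> n) B \<le> F B"
      unfolding F_def by (rule ennreal_le_suminf)
    then have "ennreal (w n) * emeasure (\<nu> n) B = 0" using B em by simp
    then have "emeasure (\<nu> n) B = 0" using w(1)[of n] by auto
    then show "measure (\<nu> n) B = 0" by (simp add: measure_def)
  qed
qed

text \<open>
  Two exhaustions: inside \<open>A\<close> the local measure controls \<open>f\<close> on what remains after removing a
  maximal disjoint family of null sets of that measure which are not \<open>f\<close>-null; then a maximal
  disjoint family of sets carrying such a controlling measure is countable and fills \<open>\<Omega>\<close> up to an
  \<open>f\<close>-null set.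
\<close>

lemma ex_control_of_local:
  fixes f :: "'e set \<Rightarrow> real"
  assumes sa: "sigma_algebra \<Omega> \<E>"
    and nonneg: "\<And>B. 0 \<le> f B"
    and vanish: "\<And>A :: nat \<Rightarrow> 'e set. range A \<subseteq> \<E> \<Longrightarrow> disjoint_family A \<Longrightarrow> (\<lambda>n. f (A n)) \<longlonglongrightarrow> 0"
    and null: "\<And>A :: nat \<Rightarrow> 'e set. range A \<subseteq> \<E> \<Longrightarrow> disjoint_family A \<Longrightarrow> (\<And>n. f (A n) = 0) \<Longrightarrow> f (\<Union>n. A n) = 0"
    and local: "\<And>A. A \<in> \<E> \<Longrightarrow> 0 < f A \<Longrightarrow> \<exists>\<nu>. finite_measure \<nu> \<and> space \<nu> = \<Omega> \<and> sets \<nu> = \<E> \<and>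
      0 < measure \<nu> A \<and> (\<forall>B\<in>\<E>. (\<forall>C\<in>\<E>. C \<subseteq> B \<longrightarrow> f C = 0) \<longrightarrow> measure \<nu> B = 0)"
  shows "\<exists>\<nu>. finite_measure \<nu> \<and> space \<nu> = \<Omega> \<and> sets \<nu> = \<E> \<and> (\<forall>A\<in>\<E>. emeasure \<nu> A = 0 \<longrightarrow> f A = 0)"
proof -
  interpret sigma_algebra \<Omega> \<E> by (rule sa)
  \<comment> \<open>\<open>f\<close> need not be monotone, so exhaustion is applied to
    \<open>f (pick B)\<close>. Choices inside disjoint sets are disjoint, which preserves
    convergence to 0.\<close>
  define pick where "pick B = (SOME C. C \<in> \<E> \<and> C \<subseteq> B \<and> 0 < f C)" for B
  have pick: "pick B \<in> \<E>" "pick B \<subseteq> B" "0 < f (pick B)" if "\<exists>C\<in>\<E>. C \<subseteq> B \<and> 0 < f C" for B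
  proof -
    have "pick B \<in> \<E> \<and> pick B \<subseteq> B \<and> 0 < f (pick B)"
      unfolding pick_def by (rule someI_ex) (use that in auto)
    then show "pick B \<in> \<E>" "pick B \<subseteq> B" "0 < f (pick B)" by auto
  qed
  have fe: "f {} = 0"
    using vanish[of "\<lambda>_. {}"] by (simp add: disjoint_family_on_def LIMSEQ_const_iff)
  have exh: "\<exists>\<D>\<subseteq>\<G>. disjoint \<D> \<and> countable \<D> \<and> (\<forall>D\<in>\<G>. D \<inter> \<Union>\<D> = {} \<longrightarrow> D = {})"
    if G: "\<forall>B\<in>\<G>. \<exists>C\<in>\<E>. C \<subseteq> B \<and> 0 < f C" for \<G>
  proof -
    obtain \<D> where "\<D> \<subseteq> \<G>" "disjoint \<D>" "countable \<D>" "\<And>D. D \<in> \<G> \<Longrightarrow> D \<inter> \<Union>\<D> = {} \<Longrightarrow> D = {}"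
    proof (rule disjoint_exhaustion[of \<G> "\<lambda>B. f (pick B)"])
      show "0 < f (pick B)" if "B \<in> \<G>" for B by (rule pick(3)[OF bspec[OF G that]])
      show "(\<lambda>n. f (pick (s n))) \<longlonglongrightarrow> 0" if "range s \<subseteq> \<G>" "disjoint_family s" for s :: "nat \<Rightarrow> 'e set"
      proof (rule vanish)
        have sG: "s n \<in> \<G>" for n using that(1) by auto
        show "range (\<lambda>n. pick (s n)) \<subseteq> \<E>" using pick(1)[OF bspec[OF G sG]] by auto
        show "disjoint_family (\<lambda>n. pick (s n))"
          using that(2) pick(2)[OF bspec[OF G sG]] unfolding disjoint_family_on_def by blast
      qed
    qed blast
    then show ?thesis by blast
  qed
  define good where "good C \<longleftrightarrow> C \<in> \<E> \<and> (\<exists>D\<in>\<E>. D \<subseteq> C \<and> 0 < f D) \<and>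
    (\<exists>\<nu>. finite_measure \<nu> \<and> space \<nu> = \<Omega> \<and> sets \<nu> = \<E> \<and> (\<forall>B\<in>\<E>. B \<subseteq> C \<longrightarrow> measure \<nu> B = 0 \<longrightarrow> f B = 0))" for C
  have ex_good: "\<exists>C. good C \<and> C \<subseteq> A" if A: "A \<in> \<E>" "0 < f A" for A
  proof -
    obtain \<nu> where \<nu>: "finite_measure \<nu>" "space \<nu> = \<Omega>" "sets \<nu> = \<E>" "0 < measure \<nu> A"
      and dom: "\<forall>B\<in>\<E>. (\<forall>C\<in>\<E>. C \<subseteq> B \<longrightarrow> f C = 0) \<longrightarrow> measure \<nu> B = 0"
      using local[OF A] by (elim exE conjE)
    interpret \<nu>: finite_measure \<nu> by (rule \<nu>(1))
    define \<G> where "\<G> = {B\<in>\<E>. B \<subseteq> A \<and> (\<exists>C\<in>\<E>. C \<subseteq> B \<and> 0 < f C) \<and> measure \<nu> B = 0}"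
    have "\<forall>B\<in>\<G>. \<exists>C\<in>\<E>. C \<subseteq> B \<and> 0 < f C" by (simp add: \<G>_def)
    from exh[OF this] obtain \<D> where D: "\<D> \<subseteq> \<G>" "disjoint \<D>" "countable \<D>"
      and maximal: "\<forall>D\<in>\<G>. D \<inter> \<Union>\<D> = {} \<longrightarrow> D = {}"
      by (elim exE conjE)
    have U: "\<Union>\<D> \<in> \<E>" using D(1,3) by (intro countable_Union) (auto simp: \<G>_def)
    have "(\<Union>D\<in>\<D>. D) \<in> null_sets \<nu>"
      using D(1,3) by (intro null_sets_UN') (auto simp: \<G>_def null_sets_def \<nu>(3) \<nu>.emeasure_eq_measure)
    then have U0: "measure \<nu> (\<Union>\<D>) = 0" by (simp add: measure_eq_0_null_sets)
    define C where "C = A - \<Union>\<D>"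
    have CE: "C \<in> \<E>" using A U by (auto simp: C_def)
    have "measure \<nu> A \<le> measure \<nu> (C \<union> \<Union>\<D>)"
      using A(1) U by (intro \<nu>.finite_measure_mono) (auto simp: C_def \<nu>(3) intro: Un)
    also have "\<dots> \<le> measure \<nu> C + measure \<nu> (\<Union>\<D>)"
      using CE U by (intro measure_Un_le) (auto simp: \<nu>(3))
    finally have "measure \<nu> C \<noteq> 0" using U0 \<nu>(4) by simp
    then have "\<not> (\<forall>D\<in>\<E>. D \<subseteq> C \<longrightarrow> f D = 0)" using dom CE by blast
    then have "\<exists>D\<in>\<E>. D \<subseteq> C \<and> 0 < f D" using nonneg by (metis order_le_less)
    moreover have "f B = 0" if B: "B \<in> \<E>" "B \<subseteq> C" "measure \<nu> B = 0" for B
    proof (rule ccontr)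
      assume "f B \<noteq> 0"
      then have "0 < f B" using nonneg[of B] by simp
      then have "B \<in> \<G>" using B by (auto simp: \<G>_def C_def)
      moreover have "B \<inter> \<Union>\<D> = {}" using B(2) by (auto simp: C_def)
      ultimately have "B = {}" using maximal by blast
      then show False using fe \<open>0 < f B\<close> by simp
    qed
    ultimately have "good C" unfolding good_def using CE \<nu>(1-3) by blast
    then show ?thesis by (auto simp: C_def)
  qed
  have "\<forall>C\<in>{C. good C}. \<exists>D\<in>\<E>. D \<subseteq> C \<and> 0 < f D" by (simp add: good_def)
  from exh[OF this] obtain \<D> where D: "\<D> \<subseteq> {C. good C}" "disjoint \<D>" "countable \<D>"
    and maximal: "\<forall>D\<in>{C. good C}. D \<inter> \<Union>\<D> = {} \<longrightarrow> D = {}"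
    by (elim exE conjE)
  have DE: "\<D> \<subseteq> \<E>" using D(1) by (auto simp: good_def)
  have U: "\<Union>\<D> \<in> \<E>" using DE D(3) by (intro countable_Union) auto
  have rest: "f B = 0" if B: "B \<in> \<E>" "B \<inter> \<Union>\<D> = {}" for B
  proof (rule ccontr)
    assume "f B \<noteq> 0"
    then have "0 < f B" using nonneg[of B] by simp
    then obtain C where C: "good C" "C \<subseteq> B" using ex_good[OF B(1)] by blast
    then have "C = {}" using maximal B(2) by blast
    then show False using C(1) fe unfolding good_def by auto
  qed
  show ?thesis
  proof (cases "\<D> = {}")
    \<comment> \<open>Without sets carrying a controlling measure, \<open>f\<close> vanishes on all
      of \<open>\<E>\<close> and the zero measure does.\<close>
    case True
    then have "f B = 0" if "B \<in> \<E>" for B using rest that by simp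
    moreover have "finite_measure (null_measure (sigma \<Omega> \<E>))" by (rule finite_measureI) simp
    moreover have "space (null_measure (sigma \<Omega> \<E>)) = \<Omega>" "sets (null_measure (sigma \<Omega> \<E>)) = \<E>"
      using space_closed by (auto simp: sets_measure_of_eq)
    ultimately show ?thesis by blast
  next
    case False
    define d where "d = from_nat_into \<D>"
    have d: "range d = \<D>" unfolding d_def using False D(3) by (rule range_from_nat_into)
    have "\<forall>n. \<exists>\<nu>. finite_measure \<nu> \<and> space \<nu> = \<Omega> \<and> sets \<nu> = \<E> \<and> (\<forall>B\<in>\<E>. B \<subseteq> d n \<longrightarrow> measure \<nu> B = 0 \<longrightarrow> f B = 0)"
      using d D(1) unfolding good_def by blast
    then obtain \<nu> where \<nu>: "\<And>n. finite_measure (\<nu> n)" "\<And>n. space (\<nu> n) = \<Omega>" "\<And>n. sets (\<nu> n) = \<E>"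
      "\<And>n B. B \<in> \<E> \<Longrightarrow> B \<subseteq> d n \<Longrightarrow> measure (\<nu> n) B = 0 \<Longrightarrow> f B = 0"
      by metis
    obtain \<mu> where \<mu>: "finite_measure \<mu>" "space \<mu> = \<Omega>" "sets \<mu> = \<E>"
      "\<And>B n. B \<in> \<E> \<Longrightarrow> emeasure \<mu> B = 0 \<Longrightarrow> measure (\<nu> n) B = 0"
      using ex_measure_sum[of \<nu> \<Omega> \<E>, OF \<nu>(1-3)] by blast
    have "f A = 0" if A: "A \<in> \<E>" "emeasure \<mu> A = 0" for A
    proof -
      \<comment> \<open>\<open>A\<close> is cut into the part outside \<open>\<Union>\<D>\<close>,
        at index 0, and the parts inside the disjointed members, shifted by one.\<close>
      define S where "S n = (if n = 0 then A - \<Union>\<D> else A \<inter> disjointed d (n - 1))" for n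
      have dE: "d n \<in> \<E>" for n using d DE by auto
      have djE: "disjointed d n \<in> \<E>" for n
        using dE by (intro range_subsetD[OF range_disjointed_sets]) auto
      have SE: "S n \<in> \<E>" for n unfolding S_def using A(1) U djE by auto
      have "A = (\<Union>n. S n)"
      proof -
        have "(\<Union>n. S n) = S 0 \<union> (\<Union>n. S (Suc n))"
          by (metis UN_extend_simps(10) UN_insert UNIV_nat_eq)
        also have "\<dots> = (A - \<Union>\<D>) \<union> (A \<inter> (\<Union>n. disjointed d n))" by (auto simp: S_def)
        also have "(\<Union>n. disjointed d n) = \<Union>\<D>" unfolding UN_disjointed_eq using d by simp
        finally show ?thesis by auto
      qed
      moreover have "disjoint_family S"
      proof -
        have "disjointed d n \<subseteq> \<Union>\<D>" for n using disjointed_subset[of d n] d by blast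
        moreover have "disjointed d m \<inter> disjointed d n = {}" if "m \<noteq> n" for m n
          using disjoint_family_disjointed[of d] that by (auto simp: disjoint_family_on_def)
        ultimately show ?thesis
          unfolding disjoint_family_on_def S_def by (auto; (metis IntI One_nat_def Suc_pred empty_iff gr0I subsetD UnionI))
      qed
      moreover have "f (S n) = 0" for n
      proof (cases n)
        case 0
        then show ?thesis using SE[of n] by (intro rest) (auto simp: S_def)
      next
        case (Suc k)
        have "emeasure \<mu> (S n) \<le> emeasure \<mu> A"
          using SE A(1) U by (intro emeasure_mono) (auto simp: S_def \<mu>(3))
        then have "emeasure \<mu> (S n) = 0" using A(2) by simp
        then have "measure (\<nu> k) (S n) = 0" using \<mu>(4) SE by blast
        moreover have "S n \<subseteq> d k" using disjointed_subset[of d k] Suc by (auto simp: S_def)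
        ultimately show ?thesis using \<nu>(4) SE by blast
      qed
      ultimately show ?thesis using null[of S] SE by auto
    qed
    then show ?thesis using \<mu>(1-3) by blast
  qed
qed

section \<open>Measures with values in Frechet-space-valued functions\<close>

text \<open>Additivity and continuity at 0 together already give real linearity and continuity
  everywhere.\<close>

definition continuous_functional :: "('z::fnormed_vector \<Rightarrow> real) \<Rightarrow> bool" where
  "continuous_functional \<phi> \<longleftrightarrow> (\<forall>x y. \<phi> (x + y) = \<phi> x + \<phi> y) \<and>
    (\<forall>e>0. \<exists>d>0. \<forall>z. fnorm z < d \<longrightarrow> \<bar>\<phi> z\<bar> \<le> e)"

lemma continuous_functional_diff:
  assumes "continuous_functional \<phi>"
  shows "\<phi> 0 = 0" "\<phi> (x - y) = \<phi> x - \<phi> y"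
proof -
  have add: "\<phi> (x + y) = \<phi> x + \<phi> y" for x y
    using assms by (simp add: continuous_functional_def)
  show "\<phi> 0 = 0" using add[of 0 0] by simp
  show "\<phi> (x - y) = \<phi> x - \<phi> y" using add[of "x - y" y] by simp
qed

lemma continuous_functional_sum:
  assumes "continuous_functional \<phi>"
  shows "\<phi> (\<Sum>i\<in>I. x i) = (\<Sum>i\<in>I. \<phi> (x i))"
  using continuous_functional_diff(1)[OF assms] assms
  by (induction I rule: infinite_finite_induct) (auto simp: continuous_functional_def)

lemma continuous_functional_tendsto:
  fixes x :: "nat \<Rightarrow> 'z::fnormed_vector"
  assumes \<phi>: "continuous_functional \<phi>" and x: "x \<longlonglongrightarrow> l"
  shows "(\<lambda>n. \<phi> (x n)) \<longlonglongrightarrow> \<phi> l"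
proof (rule tendstoI)
  fix e :: real assume "0 < e"
  then obtain d where d: "0 < d" "\<And>z. fnorm z < d \<Longrightarrow> \<bar>\<phi> z\<bar> \<le> e / 2"
    using \<phi> unfolding continuous_functional_def by (meson half_gt_zero)
  have "\<forall>\<^sub>F n in sequentially. dist (x n) l < d" using x d(1) by (rule tendstoD)
  then show "\<forall>\<^sub>F n in sequentially. dist (\<phi> (x n)) (\<phi> l) < e"
  proof eventually_elim
    case (elim n)
    then have "\<bar>\<phi> (x n - l)\<bar> \<le> e / 2" using d(2) by (simp add: dist_fnorm)
    then show ?case
      using \<open>0 < e\<close> by (simp add: continuous_functional_diff(2)[OF \<phi>] dist_real_def)
  qed
qed

text \<open>Hahn--Banach for the Minkowski functional of \<open>U\<close>, expressed by the prices
  \<open>R\<close>. Its value at \<open>c\<close> is at least 1, since otherwise star-shapedness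
  about 0 would put \<open>c\<close> into \<open>U\<close>. Continuity comes from an F-norm ball
  inside \<open>U\<close>, scaled by \<open>fnorm_scaleR_bound\<close>.\<close>

lemma open_convex_separation:
  fixes U :: "'z::fnormed_vector set"
  assumes U: "open U" "convex U" "0 \<in> U" and c: "c \<notin> U"
  obtains \<phi> where "continuous_functional \<phi>" "1 \<le> \<phi> c" "\<And>z. z \<in> U \<Longrightarrow> \<phi> z \<le> 1"
proof -
  obtain r where r: "0 < r" "\<And>z. fnorm z < r \<Longrightarrow> z \<in> U"
    using U(1,3) unfolding open_dist by (metis fnorm_eq_dist)
  define R where "R z t \<longleftrightarrow> 0 < t \<and> (1 / t) *\<^sub>R z \<in> U" for z t
  have absorb: "\<exists>t>0. (1 / t) *\<^sub>R z \<in> U" for z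
  proof -
    have "\<forall>\<^sub>F a in at 0. fnorm (a *\<^sub>R z) < r"
      using fnorm_scaleR_tendsto_0[of z] r(1) by (rule order_tendstoD)
    then obtain d where d: "0 < d" "\<And>a. a \<noteq> 0 \<Longrightarrow> dist a 0 < d \<Longrightarrow> fnorm (a *\<^sub>R z) < r"
      unfolding eventually_at by auto
    have "fnorm ((1 / (2 / d)) *\<^sub>R z) < r" using d by simp
    then show ?thesis using r(2) d(1) by (intro exI[of _ "2 / d"]) auto
  qed
  have star: "u *\<^sub>R z \<in> U" if "z \<in> U" "0 \<le> u" "u \<le> 1" for z u
    using convexD[OF U(2) that(1) U(3) that(2), of "1 - u"] that by simp
  have R: "\<forall>z\<in>UNIV. (\<exists>t. R z t) \<and> (\<exists>m. \<forall>t. R z t \<longrightarrow> m \<le> t)"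
    "\<forall>x\<in>UNIV. \<forall>y\<in>UNIV. \<forall>t u. R x t \<longrightarrow> R y u \<longrightarrow> R (x + y) (t + u)"
    "\<forall>a>0. \<forall>z\<in>UNIV. \<forall>t. R z t \<longrightarrow> R (a *\<^sub>R z) (a * t)"
  proof -
    show "\<forall>z\<in>UNIV. (\<exists>t. R z t) \<and> (\<exists>m. \<forall>t. R z t \<longrightarrow> m \<le> t)"
      using absorb by (auto simp: R_def intro: less_imp_le)
    have "R (x + y) (t + u)" if t: "R x t" and u: "R y u" for x y t u
    proof -
      have "(t / (t + u)) *\<^sub>R ((1 / t) *\<^sub>R x) + (u / (t + u)) *\<^sub>R ((1 / u) *\<^sub>R y) \<in> U"
        using t u by (intro convexD[OF U(2)]) (auto simp: R_def simp flip: add_divide_distrib)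
      then show ?thesis using t u by (simp add: R_def scaleR_add_right)
    qed
    then show "\<forall>x\<in>UNIV. \<forall>y\<in>UNIV. \<forall>t u. R x t \<longrightarrow> R y u \<longrightarrow> R (x + y) (t + u)" by blast
  qed (auto simp: R_def)
  note V = real_vector.vector_space_axioms module.subspace_UNIV[OF real_vector.module_axioms]
  note p = sublinear_Inf[OF V R]
  obtain \<phi> where \<phi>: "\<And>x y. \<phi> (x + y) = \<phi> x + \<phi> y" "\<And>x. \<phi> x \<le> Inf {t. R x t}" "\<phi> c = Inf {t. R c t}"
    using hahn_banach_sublinear[OF V p(3), of c] by (metis UNIV_I)
  have \<phi>_le: "\<phi> z \<le> t" if "R z t" for z t
    using \<phi>(2)[of z] p(1)[OF _ that] by simp
  show thesis
  proof
    show "1 \<le> \<phi> c"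
      unfolding \<phi>(3)
    proof (rule p(2), simp, rule ccontr)
      fix t assume "R c t" "\<not> 1 \<le> t"
      then have t: "0 < t" "(1 / t) *\<^sub>R c \<in> U" "t \<le> 1" by (auto simp: R_def)
      have "t *\<^sub>R ((1 / t) *\<^sub>R c) \<in> U" by (rule star[OF t(2)]) (use t in auto)
      then show False using c t(1) by simp
    qed
    show "\<phi> z \<le> 1" if "z \<in> U" for z
      using \<phi>_le[of z 1] that by (simp add: R_def)
    show "continuous_functional \<phi>"
      unfolding continuous_functional_def
    proof (intro conjI allI impI \<phi>(1))
      fix e :: real assume e: "0 < e"
      obtain n where n: "\<bar>1 / e\<bar> \<le> real n" "0 < n"
        using real_arch_simple[of "max 1 (1 / e)"] e by (metis abs_of_pos max.bounded_iff less_numeral_extra(1) of_nat_0_less_iff order_less_le_trans zero_less_divide_1_iff)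
      have small: "\<phi> z \<le> e" if z: "fnorm z < r / n" for z
      proof -
        have "fnorm ((1 / e) *\<^sub>R z) \<le> real n * fnorm z" by (rule fnorm_scaleR_bound[OF n(1)])
        also have "\<dots> < r" using z n(2) by (simp add: field_simps)
        finally have "(1 / e) *\<^sub>R z \<in> U" by (rule r(2))
        then show ?thesis using e by (intro \<phi>_le) (simp add: R_def)
      qed
      have neg: "\<phi> (- z) = - \<phi> z" for z
        using \<phi>(1)[of z "- z"] \<phi>(1)[of 0 0] by simp
      have "\<bar>\<phi> z\<bar> \<le> e" if "fnorm z < r / n" for z
        using small[of z] small[of "- z"] that neg by simp
      then show "\<exists>d>0. \<forall>z. fnorm z < d \<longrightarrow> \<bar>\<phi> z\<bar> \<le> e"
        using r(1) n(2) by (intro exI[of _ "r / n"]) auto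
    qed
  qed
qed

text \<open>As \<open>M\<close> may be incomplete, the composition with \<open>f\<close> may fail to
  be Borel. The limit of the functional along simple approximations is a Borel version of
  it.\<close>

lemma bochner_measurable_functional:
  fixes f :: "'s \<Rightarrow> 'z::fnormed_vector"
  assumes f: "bochner_measurable M f" and \<phi>: "continuous_functional \<phi>"
  obtains y where "y \<in> borel_measurable M" "AE s in M. y s = \<phi> (f s)"
proof -
  obtain g where g: "\<forall>n. simple_function M (g n)" "AE s in M. (\<lambda>n. g n s) \<longlonglongrightarrow> f s"
    using f by (rule bochner_measurableE)
  have "(\<lambda>s. \<phi> (g n s)) \<in> borel_measurable M" for n
    using simple_function_compose[OF g(1)[rule_format, of n], of \<phi>]
    by (intro borel_measurable_simple_function) (simp add: comp_def)
  then have "(\<lambda>s. lim (\<lambda>n. \<phi> (g n s))) \<in> borel_measurable M"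
    by (rule borel_measurable_lim_metric)
  moreover have "AE s in M. lim (\<lambda>n. \<phi> (g n s)) = \<phi> (f s)"
    using g(2) by eventually_elim (rule limI[OF continuous_functional_tendsto[OF \<phi>]])
  ultimately show thesis by (rule that)
qed

text \<open>The simple functions approximating \<open>f\<close> take countably many values in all,
  so countably many separating functionals suffice, one for each value \<open>c\<close> and each
  neighbourhood \<open>V k\<close>. No separability of the space is assumed.\<close>

lemma functionals_separate_AE:
  fixes f :: "'s \<Rightarrow> 'z::frechet_space"
  assumes f: "bochner_measurable M f" and ne: "\<not> (AE s in M. f s = 0)"
  obtains \<phi> where "continuous_functional \<phi>" "\<not> (AE s in M. \<phi> (f s) = 0)"
proof (rule ccontr)
  assume "\<not> thesis"
  then have all: "AE s in M. \<phi> (f s) = 0" if "continuous_functional \<phi>" for \<phi>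
    using that \<open>\<And>\<phi>. continuous_functional \<phi> \<Longrightarrow> \<not> (AE s in M. \<phi> (f s) = 0) \<Longrightarrow> thesis\<close> by blast
  obtain g where g: "\<forall>n. simple_function M (g n)" "AE s in M. (\<lambda>n. g n s) \<longlonglongrightarrow> f s"
    using f by (rule bochner_measurableE)
  have "\<exists>V. open V \<and> convex V \<and> 0 \<in> V \<and> V \<subseteq> ball (0::'z) (1 / Suc k)" for k
    by (rule ex_convex_nhd_0) auto
  then obtain V where V: "\<And>k. open (V k)" "\<And>k. convex (V k)" "\<And>k. 0 \<in> V k"
    "\<And>k. V k \<subseteq> ball (0::'z) (1 / Suc k)" by metis
  have "\<exists>\<phi>. continuous_functional \<phi> \<and> (c \<notin> V k \<longrightarrow> 1 \<le> \<phi> c \<and> (\<forall>z\<in>V k. \<phi> z \<le> 1))" for c k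
  proof (cases "c \<in> V k")
    case True
    have "continuous_functional (\<lambda>_::'z. 0)"
      by (auto simp: continuous_functional_def intro: exI[of _ 1])
    then show ?thesis using True by blast
  next
    case False
    then show ?thesis using open_convex_separation[OF V(1-3), of c k] by metis
  qed
  then obtain \<Phi> where \<Phi>: "\<And>c k. continuous_functional (\<Phi> c k)"
    "\<And>c k. c \<notin> V k \<Longrightarrow> 1 \<le> \<Phi> c k c" "\<And>c k z. c \<notin> V k \<Longrightarrow> z \<in> V k \<Longrightarrow> \<Phi> c k z \<le> 1" by metis
  define Q where "Q = (\<Union>n. g n ` space M)"
  have "countable Q"
    unfolding Q_def using g(1) by (auto simp: simple_function_def intro: countable_finite)
  then have "AE s in M. \<forall>c\<in>Q. \<forall>k. \<Phi> c k (f s) = 0"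
    using all[OF \<Phi>(1)] by (simp add: AE_ball_countable AE_all_countable)
  then have "AE s in M. f s = 0"
    using g(2) AE_space
  proof eventually_elim
    case (elim s)
    show ?case
    proof (rule ccontr)
      assume "f s \<noteq> 0"
      then have pos: "0 < fnorm (f s)" using fnorm_nonneg[of "f s"] by (simp add: order_less_le)
      obtain k where k: "1 / real (Suc k) < fnorm (f s) / 2"
        using reals_Archimedean[of "fnorm (f s) / 2"] pos by (auto simp: inverse_eq_divide)
      \<comment> \<open>Doubling the difference gains the contradiction: a functional vanishing at
        \<open>f s\<close> and at most 1 on \<open>V k\<close> is at most 1/2 at the nearby value
        \<open>c\<close>, while separation demands at least 1.\<close>
      have "(\<lambda>n. g n s - f s) \<longlonglongrightarrow> 0"
        by (rule tendsto_dist_le[OF iffD1[OF tendsto_dist_iff elim(2)]]) (simp add: dist_fnorm)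
      then have "(\<lambda>n. 2 *\<^sub>R (g n s - f s)) \<longlonglongrightarrow> 2 *\<^sub>R 0" by (rule tendsto_scaleR_fnormed)
      then have "\<forall>\<^sub>F n in sequentially. 2 *\<^sub>R (g n s - f s) \<in> V k"
        using V(1,3) by (intro topological_tendstoD) auto
      moreover have "\<forall>\<^sub>F n in sequentially. dist (g n s) (f s) < fnorm (f s) / 2"
        using elim(2) pos by (intro tendstoD) auto
      ultimately have "\<forall>\<^sub>F n in sequentially. 2 *\<^sub>R (g n s - f s) \<in> V k \<and> dist (g n s) (f s) < fnorm (f s) / 2"
        by (rule eventually_conj)
      then obtain n where n: "2 *\<^sub>R (g n s - f s) \<in> V k" "dist (g n s) (f s) < fnorm (f s) / 2"
        using eventually_happens'[OF sequentially_bot] by blast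
      define c where "c = g n s"
      have "fnorm (f s) \<le> dist (f s) c + fnorm c"
        using dist_triangle[of "f s" 0 c] by (simp add: fnorm_eq_dist)
      then have "1 / real (Suc k) < fnorm c" using n(2) k by (simp add: c_def dist_commute)
      then have cV: "c \<notin> V k" using V(4)[of k] by (auto simp: fnorm_eq_dist dist_commute)
      have cQ: "c \<in> Q" using elim(3) by (auto simp: Q_def c_def)
      let ?\<phi> = "\<Phi> c k"
      have "?\<phi> (2 *\<^sub>R (c - f s)) = 2 * ?\<phi> (c - f s)"
        using \<Phi>(1)[of c k] by (simp add: scaleR_2 continuous_functional_def)
      also have "?\<phi> (c - f s) = ?\<phi> c"
        using elim(1) cQ by (simp add: continuous_functional_diff(2)[OF \<Phi>(1)])
      finally have "2 * ?\<phi> c \<le> 1" using \<Phi>(3)[OF cV, of "2 *\<^sub>R (c - f s)"] n(1) by (simp add: c_def)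
      then show False using \<Phi>(2)[OF cV] by simp
    qed
  qed
  then show False using ne by simp
qed

context finite_measure
begin

text \<open>Where \<open>h n\<close> has small F-norm the functional is at most \<open>e0\<close>;
  the remaining set has small outer measure, and for the Borel function \<open>y n\<close> outer
  measure is measure.\<close>

lemma rho_functional_tendsto_0:
  fixes h :: "nat \<Rightarrow> 'a \<Rightarrow> 'z::fnormed_vector"
  assumes \<phi>: "continuous_functional \<phi>" and h: "(\<lambda>n. measure_fnorm M (h n)) \<longlonglongrightarrow> 0"
    and y: "\<And>n. y n \<in> borel_measurable M" "\<And>n. AE s in M. y n s = \<phi> (h n s)"
  shows "(\<lambda>n. rho M (y n)) \<longlonglongrightarrow> 0"
proof (rule LIMSEQ_I)
  fix e :: real assume e: "0 < e"
  define T where "T = measure M (space M) + 1"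
  have T: "0 < T" unfolding T_def by (rule add_nonneg_pos) auto
  define e0 where "e0 = e / (4 * T)"
  have e0: "0 < e0" using e T by (simp add: e0_def)
  obtain d where d: "0 < d" "\<And>z. fnorm z < d \<Longrightarrow> \<bar>\<phi> z\<bar> \<le> e0"
    using \<phi> e0 unfolding continuous_functional_def by blast
  define r where "r = min d (e / 4)"
  have "0 < r" using d e by (simp add: r_def)
  then have "\<forall>\<^sub>F n in sequentially. measure_fnorm M (h n) < r"
    using h by (intro order_tendstoD) auto
  then obtain N where N: "\<And>n. N \<le> n \<Longrightarrow> measure_fnorm M (h n) < r"
    by (auto simp: eventually_sequentially)
  have "norm (rho M (y n) - 0) < e" if n: "N \<le> n" for n
  proof -
    note [measurable] = y(1)[of n]
    obtain e' where e': "0 < e'" "e' < r" "outer_measure_of M {s \<in> space M. e' \<le> fnorm (h n s)} \<le> ennreal e'"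
      using measure_fnorm_less_E[OF N[OF n]] by blast
    let ?A = "{s\<in>space M. e0 < \<bar>y n s\<bar>}"
    have "AE s in M. s \<in> ?A \<longrightarrow> s \<in> {s \<in> space M. e' \<le> fnorm (h n s)}"
      using y(2)[of n]
    proof eventually_elim
      case (elim s)
      show ?case
      proof
        assume s: "s \<in> ?A"
        then have "\<not> fnorm (h n s) < d" using d(2)[of "h n s"] elim by auto
        then show "s \<in> {s \<in> space M. e' \<le> fnorm (h n s)}" using s e'(2) by (simp add: r_def)
      qed
    qed
    then have "outer_measure_of M ?A \<le> outer_measure_of M {s \<in> space M. e' \<le> fnorm (h n s)}"
      by (rule outer_measure_of_le_AE) auto
    also note e'(3)
    also have "outer_measure_of M ?A = emeasure M ?A"
      by (rule outer_measure_of_eq) measurable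
    finally have A: "measure M ?A \<le> e'" using e'(1) by (simp add: emeasure_eq_measure)
    have "rho M (y n) \<le> (\<integral>s. e0 + indicator ?A s \<partial>M)"
      unfolding rho_def
      by (intro integral_mono integrable_min_abs Bochner_Integration.integrable_add integrable_real_indicator)
        (use e0 in \<open>auto simp: indicator_def emeasure_eq_measure\<close>)
    also have "\<dots> = e0 * measure M (space M) + measure M ?A"
      by (subst Bochner_Integration.integral_add)
         (auto intro!: integrable_real_indicator simp: emeasure_eq_measure)
    also have "\<dots> \<le> e0 * T + e / 4"
      using A e'(2) e0 by (intro add_mono mult_left_mono) (auto simp: T_def r_def)
    also have "\<dots> < e" using T e by (simp add: e0_def)
    finally show ?thesis by simp
  qed
  then show "\<exists>N. \<forall>n\<ge>N. norm (rho M (y n) - 0) < e" by blast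
qed

end

section \<open>Reduction of the vector measure to real-valued ones\<close>

locale L0_vector_measure = finite_measure M + dom: sigma_algebra \<Omega> \<E>
  for M :: "'s measure" and \<Omega> :: "'e set" and \<E> +
  fixes \<mm> :: "'e set \<Rightarrow> ('s \<Rightarrow> 'z::frechet_space) set"
  assumes mm: "\<mm> \<in> \<E> \<rightarrow> L0 M" and ca: "countably_additive_L0 M \<E> \<mm>"
begin

abbreviation rep :: "'e set \<Rightarrow> 's \<Rightarrow> 'z" where
  "rep B \<equiv> L0_rep (\<mm> B)"

lemma mm_L0: "B \<in> \<E> \<Longrightarrow> \<mm> B \<in> L0 M"
  using mm by auto

lemma L0_sum_class:
  assumes "range A \<subseteq> \<E>"
  shows "L0_sum M (\<lambda>i. \<mm> (A i)) n = L0_class M (\<lambda>s. \<Sum>i<n. rep (A i) s)"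
proof (induction n)
  case (Suc n)
  have "L0_class M (rep (A n)) = \<mm> (A n)"
    using assms by (intro L0_class_rep mm_L0) auto
  then have "L0_sum M (\<lambda>i. \<mm> (A i)) (Suc n) = L0_add M (L0_class M (\<lambda>s. \<Sum>i<n. rep (A i) s)) (L0_class M (rep (A n)))"
    using Suc by simp
  then show ?case by (simp add: L0_add_class)
qed (simp add: L0_zero_def)

lemma sums_measure_fnorm:
  assumes A: "range A \<subseteq> \<E>" "disjoint_family A"
  shows "(\<lambda>n. measure_fnorm M (\<lambda>s. (\<Sum>i<n. rep (A i) s) - rep (\<Union>i. A i) s)) \<longlonglongrightarrow> 0"
proof -
  interpret L: Metric_space "L0 M :: ('s \<Rightarrow> 'z) set set" "L0_dist M" by (rule Metric_space_L0)
  have U: "(\<Union>i. A i) \<in> \<E>" using A(1) by (rule dom.countable_UN)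
  have d: "L0_dist M (L0_sum M (\<lambda>i. \<mm> (A i)) n) (\<mm> (\<Union>i. A i)) =
      measure_fnorm M (\<lambda>s. (\<Sum>i<n. rep (A i) s) - rep (\<Union>i. A i) s)" for n
    unfolding L0_sum_class[OF A(1)]
    using L0_dist_class[of M _ "rep (\<Union>i. A i)"] L0_class_rep[OF mm_L0[OF U]] by metis
  have "limitin L.mtopology (L0_sum M (\<lambda>i. \<mm> (A i))) (\<mm> (\<Union>i. A i)) sequentially"
    using ca A unfolding countably_additive_L0_def L0_topology_def by blast
  then have "\<forall>e>0. \<exists>N. \<forall>n\<ge>N. L0_dist M (L0_sum M (\<lambda>i. \<mm> (A i)) n) (\<mm> (\<Union>i. A i)) < e"
    unfolding L.limit_metric_sequentially by blast
  then show ?thesis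
    unfolding d by (intro LIMSEQ_I) (simp add: measure_fnorm_nonneg)
qed

lemma disjoint_measure_fnorm:
  assumes A: "range A \<subseteq> \<E>" "disjoint_family A"
  shows "(\<lambda>n. measure_fnorm M (rep (A n))) \<longlonglongrightarrow> 0"
proof -
  let ?d = "\<lambda>n. measure_fnorm M (\<lambda>s. (\<Sum>i<n. rep (A i) s) - rep (\<Union>i. A i) s)"
  have lim: "(\<lambda>n. ?d (Suc n) + ?d n) \<longlonglongrightarrow> 0"
    using tendsto_add[OF LIMSEQ_Suc[OF sums_measure_fnorm[OF A]] sums_measure_fnorm[OF A]] by simp
  have "measure_fnorm M (rep (A n)) \<le> ?d (Suc n) + ?d n" for n
  proof -
    have "measure_fnorm M (\<lambda>s. - ((\<Sum>i<n. rep (A i) s) - rep (\<Union>i. A i) s)) = ?d n"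
      by (simp add: measure_fnorm_def del: minus_diff_eq)
    moreover have "(\<lambda>s. ((\<Sum>i<Suc n. rep (A i) s) - rep (\<Union>i. A i) s) + - ((\<Sum>i<n. rep (A i) s) - rep (\<Union>i. A i) s)) = rep (A n)"
      by (simp add: fun_eq_iff)
    ultimately show ?thesis
      using measure_fnorm_triangle[of "\<lambda>s. (\<Sum>i<Suc n. rep (A i) s) - rep (\<Union>i. A i) s" "\<lambda>s. - ((\<Sum>i<n. rep (A i) s) - rep (\<Union>i. A i) s)"]
      by simp
  qed
  then show ?thesis
    by (intro metric_tendsto_imp_tendsto[OF lim] always_eventually)
       (auto simp: dist_real_def measure_fnorm_nonneg intro: order_trans[OF _ abs_ge_self])
qed

lemma measure_fnorm_rep_eq_0_iff:
  assumes "B \<in> \<E>"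
  shows "measure_fnorm M (rep B) = 0 \<longleftrightarrow> \<mm> B = L0_zero M"
  using L0_class_eq_iff[of M "rep B" "\<lambda>_. 0"] L0_class_rep[OF mm_L0[OF assms]]
  by (simp add: measure_fnorm_eq_0_iff L0_zero_def)

text \<open>If every \<open>A n\<close> is null, each error of the partial sums is almost everywhere
  minus the value on the union, so the constant sequence of its norms tends to 0.\<close>

lemma null_UN:
  fixes A :: "nat \<Rightarrow> 'e set"
  assumes A: "range A \<subseteq> \<E>" "disjoint_family A" "\<And>n. measure_fnorm M (rep (A n)) = 0"
  shows "measure_fnorm M (rep (\<Union>n. A n)) = 0"
proof -
  let ?U = "\<Union>i. A i"
  have "AE s in M. \<forall>n. rep (A n) s = 0"
    using A(3) unfolding AE_all_countable measure_fnorm_eq_0_iff by (rule allI)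
  then have "AE s in M. (\<Sum>i<n. rep (A i) s) - rep ?U s = - rep ?U s" for n
    by eventually_elim simp
  then have "measure_fnorm M (\<lambda>s. (\<Sum>i<n. rep (A i) s) - rep ?U s) = measure_fnorm M (\<lambda>s. - rep ?U s)" for n
    by (rule measure_fnorm_cong_AE)
  then have "(\<lambda>n::nat. measure_fnorm M (\<lambda>s. - rep ?U s)) \<longlonglongrightarrow> 0"
    using sums_measure_fnorm[OF A(1,2)] by simp
  then show ?thesis by (simp add: LIMSEQ_const_iff measure_fnorm_def)
qed

text \<open>One functional that detects \<open>\<mm> A\<close> suffices. A set all of whose
  measurable subsets are null for \<open>\<mm>\<close> has \<open>eta\<close> zero for the real
  measure obtained from any functional, so the property to be glued does not mention the
  functional.\<close>

lemma local_dominated_measure: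
  assumes A: "A \<in> \<E>" and pos: "0 < measure_fnorm M (rep A)"
  shows "\<exists>\<nu>. finite_measure \<nu> \<and> space \<nu> = \<Omega> \<and> sets \<nu> = \<E> \<and> 0 < measure \<nu> A \<and>
    (\<forall>B\<in>\<E>. (\<forall>C\<in>\<E>. C \<subseteq> B \<longrightarrow> measure_fnorm M (rep C) = 0) \<longrightarrow> measure \<nu> B = 0)"
proof -
  have "\<not> (AE s in M. rep A s = 0)" using pos measure_fnorm_eq_0_iff[of "rep A"] by simp
  then obtain \<phi> where \<phi>: "continuous_functional \<phi>" "\<not> (AE s in M. \<phi> (rep A s) = 0)"
    using functionals_separate_AE[OF bochner_measurable_rep[OF mm_L0[OF A]]] by blast
  have "\<forall>B\<in>\<E>. \<exists>y. y \<in> borel_measurable M \<and> (AE s in M. y s = \<phi> (rep B s))"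
    using bochner_measurable_functional[OF bochner_measurable_rep[OF mm_L0] \<phi>(1)] by metis
  then obtain X where X: "\<And>B. B \<in> \<E> \<Longrightarrow> X B \<in> borel_measurable M" "\<And>B. B \<in> \<E> \<Longrightarrow> AE s in M. X B s = \<phi> (rep B s)"
    by metis
  interpret X: real_L0_measure M \<Omega> \<E> X
  proof (unfold_locales, rule X(1), assumption)
    fix A :: "nat \<Rightarrow> 'e set" assume A: "range A \<subseteq> \<E>" "disjoint_family A"
    have AE: "A i \<in> \<E>" for i using A(1) by (rule range_subsetD)
    have U: "(\<Union>i. A i) \<in> \<E>" using A(1) by (rule dom.countable_UN)
    note [measurable] = X(1)[OF AE] X(1)[OF U]
    show "(\<lambda>n. rho M (\<lambda>s. (\<Sum>i<n. X (A i) s) - X (\<Union>i. A i) s)) \<longlonglongrightarrow> 0"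
    proof (rule rho_functional_tendsto_0[OF \<phi>(1) sums_measure_fnorm[OF A]])
      fix n
      show "(\<lambda>s. (\<Sum>i<n. X (A i) s) - X (\<Union>i. A i) s) \<in> borel_measurable M" by measurable
      have "AE s in M. \<forall>i. X (A i) s = \<phi> (rep (A i) s)"
        unfolding AE_all_countable using X(2)[OF AE] by (rule allI)
      then show "AE s in M. (\<Sum>i<n. X (A i) s) - X (\<Union>i. A i) s = \<phi> ((\<Sum>i<n. rep (A i) s) - rep (\<Union>i. A i) s)"
        using X(2)[OF U]
        by eventually_elim (simp add: continuous_functional_diff(2)[OF \<phi>(1)] continuous_functional_sum[OF \<phi>(1)])
    qed
  qed
  have "\<not> (AE s in M. X A s = 0)"
  proof
    assume "AE s in M. X A s = 0"
    then have "AE s in M. \<phi> (rep A s) = 0" using X(2)[OF A] by eventually_elim simp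
    then show False using \<phi>(2) by simp
  qed
  then obtain \<nu> where \<nu>: "finite_measure \<nu>" "space \<nu> = \<Omega>" "sets \<nu> = \<E>" "0 < measure \<nu> A"
    "\<And>B. B \<in> \<E> \<Longrightarrow> X.eta B = 0 \<Longrightarrow> measure \<nu> B = 0"
    using X.ex_dominated_measure[OF A] by blast
  have "X.eta B = 0" if B: "\<forall>C\<in>\<E>. C \<subseteq> B \<longrightarrow> measure_fnorm M (rep C) = 0" for B
  proof -
    have "rho M (X C) \<le> 0" if C: "C \<in> \<E>" "C \<subseteq> B" for C
    proof -
      have "AE s in M. rep C s = 0" using B C by (simp add: measure_fnorm_eq_0_iff)
      then have "AE s in M. X C s = 0"
        using X(2)[OF C(1)] by eventually_elim (simp add: continuous_functional_diff(1)[OF \<phi>(1)])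
      then have "rho M (X C) = rho M (\<lambda>_. 0)" using X(1)[OF C(1)] by (intro rho_cong_AE) auto
      then show ?thesis by (simp add: rho_def)
    qed
    then have "X.eta B \<le> 0" by (rule X.eta_le)
    then show ?thesis using X.eta_nonneg[of B] by simp
  qed
  then show ?thesis using \<nu> by blast
qed

end

theorem theorem3p5:
  fixes M :: "'s measure"
    and \<Omega> :: "'e set" and \<E> :: "'e set set"
    and \<mm> :: "'e set \<Rightarrow> ('s \<Rightarrow> 'z::frechet_space) set"
  assumes "finite_measure M"
    and "sigma_algebra \<Omega> \<E>"
    and "\<mm> \<in> \<E> \<rightarrow> L0 M"
    and "countably_additive_L0 M \<E> \<mm>"
  shows "\<exists>\<nu> :: 'e measure. control_measure M \<Omega> \<E> \<mm> \<nu>"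
proof -
  interpret finite_measure M by (rule assms(1))
  interpret L0_vector_measure M \<Omega> \<E> \<mm>
    by (intro L0_vector_measure.intro L0_vector_measure_axioms.intro assms)
  obtain \<nu> where "finite_measure \<nu>" "space \<nu> = \<Omega>" "sets \<nu> = \<E>"
    "\<forall>A\<in>\<E>. emeasure \<nu> A = 0 \<longrightarrow> measure_fnorm M (rep A) = 0"
    using ex_control_of_local[OF assms(2) measure_fnorm_nonneg disjoint_measure_fnorm null_UN local_dominated_measure]
    by blast
  then have "control_measure M \<Omega> \<E> \<mm> \<nu>"
    unfolding control_measure_def by (auto simp: measure_fnorm_rep_eq_0_iff)
  then show ?thesis ..
qed

end
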